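(* Let $N\ge1$ and $p>1$. Let $\phi^i$ and $\phi^b$ be nonnegative measurable functions in $\Omega$ and on $\partial\Omega$, respectively. Consider the problem $$(\mathrm{SH})\qquad\begin{cases}\partial_tu=\Delta u+u^p, & x\in\Omega,\ t>0,\\ \partial_tu+\partial_\nu u=0, & x\in\partial\Omega,\ t>0,\\ u(x,0)=\phi^i(x)\ge0, & x\in\Omega,\\ u(x,0)=\phi^b(x)\ge0, & x\in\partial\Omega.\end{cases}$$ Let $p_F:=1+\frac2N$. (1) If $1<p\le p_F$, then problem (SH) possesses no global-in-time positive solutions. (2) Let $p>p_F$. Then there exists $\delta>0$ such that, if $\phi=(\phi^i,\phi^b)$ satisfies $$\|\phi\|_{L^1(\Omega)\times L^1(\partial\Omega)}+\|\phi\|_{L^\infty(\Omega)\times L^\infty(\partial\Omega)}\le\delta,$$ then problem (SH) possesses a global-in-time positive solution.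
   Context: $N\ge1$ is an integer and $\Omega:=\{x=(x',x_N)\in\mathbb R^N: x'\in\mathbb R^{N-1},\ x_N\in(0,\infty)\}$; if $N=1$, then $\Omega=(0,\infty)$ and $\partial\Omega=\{0\}$. $\partial_\nu:=-\partial/\partial x_N$. $\sigma$ is the surface measure on $\partial\Omega$ if $N\ge2$, and $\sigma(\{0\})=1$ if $N=1$. For $y=(y',y_N)\in\overline\Omega$, $y^*=(y',-y_N)$; $e_N=(0,\dots,0,1)$. $\Gamma_N(x,t):=(4\pi t)^{-N/2}e^{-|x|^2/(4t)}$ for $(x,t)\in\mathbb R^N\times(0,\infty)$. For $(x,y,t)\in\overline\Omega\times\overline\Omega\times(0,\infty)$, $$G(x,y,t):=\Gamma_N(x-y,t)-\Gamma_N(x-y^*,t)-2\int_0^t(\partial_{x_N}\Gamma_N)(x-y^*+\tau e_N,t-\tau)\,d\tau .$$ For a pair $\phi=(\phi^i,\phi^b)$ of measurable functions in $\Omega$ and on $\partial\Omega$, $$[\mathsf{G}(t)\phi](x):=\int_\Omega G(x,y,t)\phi^i(y)\,dy+\int_{\partial\Omega}G(x,y,t)\phi^b(y)\,d\sigma(y),\qquad (x,t)\in\overline\Omega\times(0,\infty),$$ if it is well-defined. $\|(f,g)\|_{L^r(\Omega)\times L^r(\partial\Omega)}:=\|f\|_{L^r(\Omega)}+\|g\|_{L^r(\partial\Omega)}$. Definition of solution. Let $T\in(0,\infty]$. A nonnegative continuous function $u$ in $\overline\Omega\times(0,T)$ is called a solution of problem (SH) in $\Omega\times(0,T)$ if $u\in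 L^\infty_{\rm loc}((0,T):L^\infty(\Omega))$ and $$u(x,t)=[\mathsf{G}(t)\phi](x)+\int_0^t[\mathsf{G}(t-s)(u(s)^p,0)](x)\,ds,\qquad (x,t)\in\overline\Omega\times(0,T).$$ If $T=\infty$, $u$ is called a global-in-time solution of (SH). A positive solution is a solution with $u>0$ in $\overline\Omega\times(0,T)$. *)

theory Defs
  imports "HOL-Analysis.Analysis" "HOL-Probability.Essential_Supremum"
begin

text \<open>
  \<open>\<real>\<^sup>N\<close> is \<^typ>\<open>real ^ 'n\<close> with \<open>N = CARD('n) \<ge> 1\<close>; the index type is linearly ordered
  so that there is a last coordinate \<open>x\<^sub>N\<close>. For \<open>N = 1\<close> the definitions below give
  \<open>\<Omega> = (0,\<infinity>)\<close>, \<open>\<partial>\<Omega> = {0}\<close> and the unit point mass at \<open>0\<close> as boundary measure.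
\<close>

type_synonym 'n pt = "(real, 'n) vec"

definition last_idx :: "'n::{finite,linorder}" where
  "last_idx = Max UNIV"

definition Omega :: "('n::{finite,linorder}) pt set" where
  "Omega = {x. x $ last_idx > 0}"

definition e_last :: "('n::{finite,linorder}) pt" where
  "e_last = axis last_idx 1"

definition reflect :: "('n::{finite,linorder}) pt \<Rightarrow> 'n pt" where
  "reflect y = (\<chi> i. if i = last_idx then - y $ i else y $ i)"

text \<open>
  Surface measure on \<open>\<partial>\<Omega>\<close>: the image of \<open>(N-1)\<close>-dimensional Lebesgue measure under
  \<open>x' \<mapsto> (x',0)\<close>, completed. If \<open>N = 1\<close>, the product over the empty index set is a unit point mass.
\<close>

definition surface_measure :: "('n::{finite,linorder}) pt measure" where
  "surface_measure =
     restrict_space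
       (completion
         (distr (PiM (UNIV - {last_idx}) (\<lambda>_. lborel)) borel
           (\<lambda>f. \<chi> i. if i = last_idx then 0 else f i)))
       (frontier Omega)"

definition heat_kernel :: "('n::{finite,linorder}) pt \<Rightarrow> real \<Rightarrow> real" where
  "heat_kernel x t =
     (4 * pi * t) powr (- real CARD('n) / 2) * exp (- (norm x)\<^sup>2 / (4 * t))"

definition d_last_heat_kernel :: "('n::{finite,linorder}) pt \<Rightarrow> real \<Rightarrow> real" where
  "d_last_heat_kernel x t = deriv (\<lambda>h. heat_kernel (x + h *\<^sub>R e_last) t) 0"

definition G_kernel ::
    "('n::{finite,linorder}) pt \<Rightarrow> 'n pt \<Rightarrow> real \<Rightarrow> real" where
  "G_kernel x y t =
     heat_kernel (x - y) t - heat_kernel (x - reflect y) t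
     - 2 * (LINT \<tau>:{0<..<t}|lborel. d_last_heat_kernel (x - reflect y + \<tau> *\<^sub>R e_last) (t - \<tau>))"

text \<open>
  A pair \<open>\<phi> = (\<phi>\<^sup>i, \<phi>\<^sup>b)\<close> is represented by two total functions on \<open>\<real>\<^sup>N\<close>; only the values of the
  first on \<open>\<Omega>\<close> and of the second on \<open>\<partial>\<Omega>\<close> matter.
\<close>

type_synonym 'n data = "('n pt \<Rightarrow> real) \<times> ('n pt \<Rightarrow> real)"

definition G_op :: "real \<Rightarrow> ('n::{finite,linorder}) data \<Rightarrow> 'n pt \<Rightarrow> real" where
  "G_op t \<phi> x =
     (LINT y|lebesgue_on Omega. G_kernel x y t * fst \<phi> y)
     + (LINT y|surface_measure. G_kernel x y t * snd \<phi> y)"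

text \<open>
  Bochner integrals of non-integrable functions are \<open>0\<close> by convention, so that
  well-definedness has to be demanded separately.
\<close>

definition G_op_defined :: "real \<Rightarrow> ('n::{finite,linorder}) data \<Rightarrow> 'n pt \<Rightarrow> bool" where
  "G_op_defined t \<phi> x \<longleftrightarrow>
     integrable (lebesgue_on Omega) (\<lambda>y. G_kernel x y t * fst \<phi> y) \<and>
     integrable surface_measure (\<lambda>y. G_kernel x y t * snd \<phi> y)"

definition Linf_loc :: "ereal \<Rightarrow> (('n::{finite,linorder}) pt \<Rightarrow> real \<Rightarrow> real) \<Rightarrow> bool" where
  "Linf_loc T u \<longleftrightarrow>
     (\<forall>a b. 0 < a \<longrightarrow> a \<le> b \<longrightarrow> ereal b < T \<longrightarrow>
        (\<exists>M. AE t in lebesgue_on {a..b}. AE x in lebesgue_on Omega. \<bar>u x t\<bar> \<le> M))"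

definition SH_solution ::
    "real \<Rightarrow> ('n::{finite,linorder}) data \<Rightarrow> ereal \<Rightarrow> ('n pt \<Rightarrow> real \<Rightarrow> real) \<Rightarrow> bool" where
  "SH_solution p \<phi> T u \<longleftrightarrow>
     continuous_on (closure Omega \<times> {t. 0 < t \<and> ereal t < T}) (\<lambda>(x, t). u x t) \<and>
     (\<forall>x\<in>closure Omega. \<forall>t. 0 < t \<and> ereal t < T \<longrightarrow> 0 \<le> u x t) \<and>
     Linf_loc T u \<and>
     (\<forall>x\<in>closure Omega. \<forall>t. 0 < t \<and> ereal t < T \<longrightarrow>
        G_op_defined t \<phi> x \<and>
        (\<forall>s\<in>{0<..<t}. G_op_defined (t - s) (\<lambda>y. u y s powr p, \<lambda>_. 0) x) \<and>
        set_integrable lborel {0<..<t} (\<lambda>s. G_op (t - s) (\<lambda>y. u y s powr p, \<lambda>_. 0) x) \<and>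
        u x t = G_op t \<phi> x
                + (LINT s:{0<..<t}|lborel. G_op (t - s) (\<lambda>y. u y s powr p, \<lambda>_. 0) x))"

definition global_solution ::
    "real \<Rightarrow> ('n::{finite,linorder}) data \<Rightarrow> ('n pt \<Rightarrow> real \<Rightarrow> real) \<Rightarrow> bool" where
  "global_solution p \<phi> u \<longleftrightarrow> SH_solution p \<phi> \<infinity> u"

definition global_positive_solution ::
    "real \<Rightarrow> ('n::{finite,linorder}) data \<Rightarrow> ('n pt \<Rightarrow> real \<Rightarrow> real) \<Rightarrow> bool" where
  "global_positive_solution p \<phi> u \<longleftrightarrow>
     global_solution p \<phi> u \<and> (\<forall>x\<in>closure Omega. \<forall>t>0. 0 < u x t)"

definition initial_data :: "('n::{finite,linorder}) data \<Rightarrow> bool" where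
  "initial_data \<phi> \<longleftrightarrow>
     fst \<phi> \<in> borel_measurable (lebesgue_on Omega) \<and> (\<forall>x\<in>Omega. 0 \<le> fst \<phi> x) \<and>
     snd \<phi> \<in> borel_measurable surface_measure \<and> (\<forall>x\<in>frontier Omega. 0 \<le> snd \<phi> x)"

definition trivial_data :: "('n::{finite,linorder}) data \<Rightarrow> bool" where
  "trivial_data \<phi> \<longleftrightarrow>
     (AE x in lebesgue_on Omega. fst \<phi> x = 0) \<and> (AE x in surface_measure. snd \<phi> x = 0)"

definition L1_norm :: "'a measure \<Rightarrow> ('a \<Rightarrow> real) \<Rightarrow> ennreal" where
  "L1_norm M f = (\<integral>\<^sup>+ x. ennreal \<bar>f x\<bar> \<partial>M)"

definition Linf_norm :: "'a measure \<Rightarrow> ('a \<Rightarrow> real) \<Rightarrow> ennreal" where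
  "Linf_norm M f = esssup M (\<lambda>x. ennreal \<bar>f x\<bar>)"

definition L1_pair_norm :: "('n::{finite,linorder}) data \<Rightarrow> ennreal" where
  "L1_pair_norm \<phi> = L1_norm (lebesgue_on Omega) (fst \<phi>) + L1_norm surface_measure (snd \<phi>)"

definition Linf_pair_norm :: "('n::{finite,linorder}) data \<Rightarrow> ennreal" where
  "Linf_pair_norm \<phi> = Linf_norm (lebesgue_on Omega) (fst \<phi>) + Linf_norm surface_measure (snd \<phi>)"

end

theory Submission
  imports Defs "HOL-Real_Asymp.Real_Asymp" "HOL-Probability.Distributions"
begin

text \<open>
  Write the kernel as \<open>G = \<Gamma>(x - y) - \<Gamma>(x - y\<^sup>*) + K\<close> with \<open>K \<ge> 0\<close> the time integral of
  \<open>(x\<^sub>N + y\<^sub>N + \<tau>) / (t - \<tau>) \<cdot> \<Gamma>(x - y\<^sup>* + \<tau> e\<^sub>N, t - \<tau>)\<close>. No semigroup property of \<open>G\<close> is needed.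

  For \<open>p \<le> p\<^sub>F\<close>, the lower bound \<open>G \<ge> c R\<^bsup>- N\<^esup>\<close> on the parabolic scale \<open>R\<close> (which \<open>K\<close> provides) shows that
  \<open>A(R)\<close>, the integral of \<open>u\<^sup>p\<close> over \<open>(0, 2R)\<^sup>N \<times> (0, R\<^sup>2)\<close>, satisfies \<open>u \<ge> c R\<^bsup>- N\<^esup> A(R)\<close> at the scale \<open>2R\<close>,
  and hence \<open>A(2R) \<ge> A(R) + c A(R)\<^sup>p\<close>. So \<open>A(R)\<close> is unbounded. Once it is large, the source \<open>u\<^sup>p\<close> on a cube of
  side \<open>2R\<close>, whose kernel mass up to time \<open>4R\<^sup>2\<close> is bounded below, makes \<open>u\<close> blow up by time \<open>4R\<^sup>2\<close>.

  For \<open>p > p\<^sub>F\<close>, the mass of \<open>G\<close> is bounded and \<open>G\<close> decays like \<open>t\<^bsup>- N/2\<^esup>\<close>. Hence the class of functions with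
  \<open>0 \<le> W \<le> M (1 + t)\<^bsup>- N/2\<^esup>\<close> and spatial integrals at most \<open>M\<close> is preserved by the integral equation for small
  \<open>M\<close>, because the source is integrable in time: its decay exponent \<open>N (p - 1) / 2\<close> exceeds \<open>1\<close>. The monotone
  iteration started at \<open>0\<close> converges to a solution.
\<close>
section \<open>The Green kernel\<close>

text \<open>K is not invariant under parabolic scaling: at spatial scale R and times of order
  \<open>R\<^sup>2\<close>, its lower bound comes from values of \<open>\<tau>\<close> of order R.
  Since \<open>R \<ge> 1\<close>, such \<open>\<tau>\<close> leave \<open>t - \<tau>\<close> of
  order \<open>R\<^sup>2\<close>, and unlike the Dirichlet part K does not degenerate when x or y
  approaches the boundary. For small t the same term forces the worse bound
  \<open>t powr (- N)\<close>. Small times are therefore controlled by the bounded mass and the sup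
  norm, large times by the kernel bound and the L1 norm; this is why the data are measured in both
  norms.

  The increment of A from R to 2R carries the factor \<open>R powr (N + 2 - N * p)\<close>, whose
  exponent is nonnegative exactly for p at most \<open>p\<^sub>F\<close>. In the critical case the
  factor is constant, and increments bounded below still sum to infinity.

  Most estimates live in \<open>ennreal\<close>, where Tonelli and monotone convergence ask for no
  integrability. The Bochner integrals of the definition are converted where a solution is taken
  apart or assembled.\<close>

definition bdry_integrand :: "('n::{finite,linorder}) pt \<Rightarrow> 'n pt \<Rightarrow> real \<Rightarrow> real \<Rightarrow> real" where
  "bdry_integrand x y t \<tau> =
     (x $ last_idx + y $ last_idx + \<tau>) / (t - \<tau>) * heat_kernel (x - reflect y + \<tau> *\<^sub>R e_last) (t - \<tau>)"

definition tang_sq :: "('n::{finite,linorder}) pt \<Rightarrow> 'n pt \<Rightarrow> real" where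
  "tang_sq x y = (\<Sum>i\<in>UNIV - {last_idx}. (x $ i - y $ i)\<^sup>2)"

lemma norm_sq_vec: "(norm (x :: 'n::{finite,linorder} pt))\<^sup>2 = (\<Sum>i\<in>UNIV - {last_idx}. (x $ i)\<^sup>2) + (x $ last_idx)\<^sup>2"
proof -
  have "(norm x)\<^sup>2 = (\<Sum>i\<in>UNIV. (x $ i)\<^sup>2)"
    unfolding power2_norm_eq_inner inner_vec_def by (simp add: power2_eq_square)
  then show ?thesis
    by (simp add: sum.remove[of UNIV "last_idx::'n"])
qed

lemma e_last_nth: "e_last $ i = (if i = last_idx then 1 else 0)"
  by (simp add: e_last_def axis_def)

lemma reflect_nth: "reflect y $ i = (if i = last_idx then - y $ i else y $ i)"
  by (simp add: reflect_def)

lemma norm_sq_diff: "(norm (x - y))\<^sup>2 = tang_sq x y + (x $ last_idx - y $ last_idx)\<^sup>2"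
  by (simp add: norm_sq_vec tang_sq_def)

lemma norm_sq_image:
  "(norm (x - reflect y + \<tau> *\<^sub>R e_last))\<^sup>2 = tang_sq x y + (x $ last_idx + y $ last_idx + \<tau>)\<^sup>2"
  by (simp add: norm_sq_vec tang_sq_def e_last_nth reflect_nth)

lemma norm_sq_reflect:
  "(norm (x - reflect y))\<^sup>2 = tang_sq x y + (x $ last_idx + y $ last_idx)\<^sup>2"
  using norm_sq_image[of x y 0] by simp

lemma tang_sq_nonneg: "0 \<le> tang_sq x y"
  by (simp add: tang_sq_def sum_nonneg)

lemma tang_sq_commute: "tang_sq x y = tang_sq y x"
  by (simp add: tang_sq_def power2_commute)

lemma heat_kernel_nonneg: "0 \<le> heat_kernel x t"
  by (simp add: heat_kernel_def)

lemma heat_kernel_pos: "0 < t \<Longrightarrow> 0 < heat_kernel x t"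
  by (simp add: heat_kernel_def)

lemma d_last_heat_kernel_eq:
  assumes "t > 0"
  shows "d_last_heat_kernel x t = - (x $ last_idx) / (2 * t) * heat_kernel x t"
proof -
  define S where "S = (\<Sum>i\<in>UNIV - {last_idx}. (x $ i)\<^sup>2)"
  have *: "heat_kernel (x + h *\<^sub>R e_last) t =
     (4 * pi * t) powr (- real CARD('a) / 2) * exp (- (S + (x $ last_idx + h)\<^sup>2) / (4 * t))" for h
    by (simp add: heat_kernel_def norm_sq_vec S_def e_last_nth)
  have "((\<lambda>h. heat_kernel (x + h *\<^sub>R e_last) t) has_real_derivative
      (4 * pi * t) powr (- real CARD('a) / 2) * (exp (- (S + (x $ last_idx + 0)\<^sup>2) / (4 * t))
        * (- (2 * (x $ last_idx + 0)) / (4 * t)))) (at 0)"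
    unfolding * using assms by (auto intro!: derivative_eq_intros)
  from DERIV_imp_deriv[OF this] show ?thesis
    using *[of 0] by (simp add: d_last_heat_kernel_def)
qed

text \<open>Differentiating the Gaussian produces the factor -x_N / (2 t). The -2 in front turns it
  into an integrand that is visibly nonnegative on the closed half-space.\<close>

lemma G_kernel_eq:
  "G_kernel x y t = heat_kernel (x - y) t - heat_kernel (x - reflect y) t
     + (LINT \<tau>:{0<..<t}|lborel. bdry_integrand x y t \<tau>)"
proof -
  have "(LINT \<tau>:{0<..<t}|lborel. bdry_integrand x y t \<tau>) =
        (LINT \<tau>:{0<..<t}|lborel. (-2) * d_last_heat_kernel (x - reflect y + \<tau> *\<^sub>R e_last) (t - \<tau>))"
    by (intro set_lebesgue_integral_cong)
       (auto simp: bdry_integrand_def d_last_heat_kernel_eq e_last_nth reflect_nth divide_simps algebra_simps)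
  then show ?thesis by (simp only: G_kernel_def set_integral_mult_right)
qed

lemma bdry_integrand_alt:
  fixes x :: "'n::{finite,linorder} pt"
  shows "bdry_integrand x y t \<tau> = (x $ last_idx + y $ last_idx + \<tau>) / (t - \<tau>) *
     ((4 * pi * (t - \<tau>)) powr (- real CARD('n) / 2) *
      exp (- (tang_sq x y + (x $ last_idx + y $ last_idx + \<tau>)\<^sup>2) / (4 * (t - \<tau>))))"
  by (simp add: bdry_integrand_def heat_kernel_def norm_sq_image)

lemma bdry_integrand_commute: "bdry_integrand x y t \<tau> = bdry_integrand y x t \<tau>"
  by (simp add: bdry_integrand_alt tang_sq_commute[of x y] add.commute)

text \<open>The mass estimates below integrate over the second argument. Symmetry turns them into
  estimates of integrals over x, which the L1 bounds of the evolution require.\<close>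

lemma G_kernel_commute: "G_kernel x y t = G_kernel y x t"
  by (simp add: G_kernel_eq bdry_integrand_commute[of x y] heat_kernel_def norm_minus_commute[of x y]
      norm_sq_reflect tang_sq_commute[of x y] add.commute)

lemma Omega_halfspace: "Omega = {x. e_last \<bullet> x > (0::real)}"
  by (auto simp: Omega_def e_last_def inner_axis inner_commute)

lemma e_last_nonzero: "e_last \<noteq> (0 :: 'n::{finite,linorder} pt)"
  using e_last_nth[of "last_idx :: 'n"] by (metis zero_index zero_neq_one)

lemma closure_Omega: "closure Omega = {x :: 'n::{finite,linorder} pt. 0 \<le> x $ last_idx}"
  unfolding Omega_halfspace using closure_halfspace_gt[OF e_last_nonzero, of 0]
  by (auto simp: e_last_def inner_axis inner_commute)

lemma frontier_Omega: "frontier Omega = {x :: 'n::{finite,linorder} pt. x $ last_idx = 0}"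
  unfolding Omega_halfspace using frontier_halfspace_gt[of "e_last :: 'n pt" 0] e_last_nonzero
  by (auto simp: e_last_def inner_axis inner_commute)

section \<open>Pointwise bounds of K and of the whole kernel\<close>

lemma powr_mult_exp_le:
  fixes m :: real
  assumes "0 \<le> m"
  shows "\<exists>C>0. \<forall>z>0. z powr m * exp (- z) \<le> C"
proof -
  define k where "k = nat \<lceil>m\<rceil>"
  have "z powr m * exp (- z) \<le> fact k" if "z > 0" for z :: real
  proof (cases "z \<ge> 1")
    case True
    have "z powr m \<le> z powr real k"
      using True by (intro powr_mono) (auto simp: k_def real_nat_ceiling_ge)
    also have "\<dots> = z ^ k" using that by (simp add: powr_realpow)
    also have "\<dots> \<le> fact k * exp z"
    proof -
      \<comment> \<open>A single term of the exponential series, with k the ceiling of m, already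
        dominates.\<close>
      have "(\<Sum>n\<in>{k}. z ^ n /\<^sub>R fact n) \<le> (\<Sum>n. z ^ n /\<^sub>R fact n)"
        using that by (intro sum_le_suminf summable_exp_generic) auto
      then show ?thesis by (simp add: exp_def field_simps)
    qed
    finally have "z powr m * exp (-z) \<le> fact k * exp z * exp (-z)"
      by (intro mult_right_mono) auto
    then show ?thesis by (simp add: mult.assoc flip: exp_add)
  next
    case False
    have "z powr m * exp (-z) \<le> 1 * 1"
      using False that assms by (intro mult_mono powr_le1) auto
    also have "\<dots> \<le> (fact k :: real)" by (simp add: fact_ge_1)
    finally show ?thesis .
  qed
  then show ?thesis by (intro exI[of _ "fact k"]) auto
qed

lemma bdry_integrand_nonneg:
  "0 \<le> x $ last_idx \<Longrightarrow> 0 \<le> y $ last_idx \<Longrightarrow> 0 < \<tau> \<Longrightarrow> \<tau> < t \<Longrightarrow> 0 \<le> bdry_integrand x y t \<tau>"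
  by (simp add: bdry_integrand_def heat_kernel_nonneg)

lemma bdry_integrand_pos:
  "0 \<le> x $ last_idx \<Longrightarrow> 0 \<le> y $ last_idx \<Longrightarrow> 0 < \<tau> \<Longrightarrow> \<tau> < t \<Longrightarrow> 0 < bdry_integrand x y t \<tau>"
  by (simp add: bdry_integrand_def heat_kernel_pos add_nonneg_pos)

lemma borel_measurable_vec_nth [measurable]: "(\<lambda>x :: 'n::{finite,linorder} pt. x $ i) \<in> borel_measurable borel"
  by (intro borel_measurable_continuous_onI continuous_intros)

lemma bdry_integrand_measurable [measurable]:
  assumes [measurable]: "f \<in> M \<rightarrow>\<^sub>M borel" "g \<in> M \<rightarrow>\<^sub>M borel" "h \<in> M \<rightarrow>\<^sub>M borel" "k \<in> M \<rightarrow>\<^sub>M borel"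
  shows "(\<lambda>w. bdry_integrand (f w) (g w) (h w) (k w)) \<in> borel_measurable M"
  unfolding bdry_integrand_alt tang_sq_def by measurable

lemma heat_kernel_measurable [measurable]:
  assumes [measurable]: "f \<in> M \<rightarrow>\<^sub>M borel" "h \<in> M \<rightarrow>\<^sub>M borel"
  shows "(\<lambda>w. heat_kernel (f w) (h w)) \<in> borel_measurable M"
  unfolding heat_kernel_def by measurable

text \<open>The two summands come from splitting at \<open>\<tau> = t / 2\<close>. Before it,
  \<open>t - \<tau>\<close> is at least \<open>t / 2\<close> and only the power is estimated; the
  Gaussian is kept so that its integral in \<open>\<tau>\<close> is bounded uniformly in x and y.
  After it, \<open>t - \<tau>\<close> may tend to 0, but w = x_N + y_N + \<open>\<tau>\<close> is at
  least \<open>t / 2\<close>, so the Gaussian absorbs the singular power and leaves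
  \<open>w powr (- 1 - N)\<close>.\<close>

lemma bdry_integrand_le:
  "\<exists>C>0. \<forall>(x :: 'n::{finite,linorder} pt) y t \<tau>. 0 \<le> x $ last_idx \<longrightarrow> 0 \<le> y $ last_idx \<longrightarrow> 0 < \<tau> \<longrightarrow> \<tau> < t \<longrightarrow>
     bdry_integrand x y t \<tau> \<le>
       (t / 2) powr (- 1 - real CARD('n) / 2) *
         ((x $ last_idx + y $ last_idx + \<tau>) * exp (- (x $ last_idx + y $ last_idx + \<tau>)\<^sup>2 / (4 * t)))
       + C * (t / 2) powr (- 1 - real CARD('n))"
proof -
  define m where "m = 1 + real CARD('n) / 2"
  obtain C0 where C0: "C0 > 0" "\<And>z. z > 0 \<Longrightarrow> z powr m * exp (- z) \<le> C0"
    using powr_mult_exp_le[of m] by (auto simp: m_def)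
  define C where "C = 4 powr m * C0"
  have "C > 0" using C0 by (simp add: C_def)
  moreover have "bdry_integrand x y t \<tau> \<le> (t / 2) powr (- m) * ((x $ last_idx + y $ last_idx + \<tau>) * exp (- (x $ last_idx + y $ last_idx + \<tau>)\<^sup>2 / (4 * t)))
       + C * (t / 2) powr (1 - 2 * m)"
    if asm: "0 \<le> x $ last_idx" "0 \<le> y $ last_idx" "0 < \<tau>" "\<tau> < t" for x y :: "'n pt" and t \<tau>
  proof -
    define w where "w = x $ last_idx + y $ last_idx + \<tau>"
    define s where "s = t - \<tau>"
    have ws: "w \<ge> \<tau>" "w > 0" "s > 0" "s < t" "t > 0" using asm by (auto simp: w_def s_def)
    have "bdry_integrand x y t \<tau> \<le> w / s * (s powr (- real CARD('n) / 2) * exp (- w\<^sup>2 / (4 * s)))"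
      unfolding bdry_integrand_alt w_def[symmetric] s_def[symmetric]
    proof (intro mult_left_mono mult_mono)
      have "s * 1 \<le> s * (4 * pi)" using ws pi_gt3 by (intro mult_left_mono) auto
      then show "(4 * pi * s) powr (- real CARD('n) / 2) \<le> s powr (- real CARD('n) / 2)"
        using ws by (intro powr_mono2') (auto simp: mult_ac)
      show "exp (- (tang_sq x y + w\<^sup>2) / (4 * s)) \<le> exp (- w\<^sup>2 / (4 * s))"
        using ws tang_sq_nonneg[of x y] by (auto simp: divide_simps)
    qed (use ws in auto)
    also have "\<dots> = w * s powr (-m) * exp (- w\<^sup>2 / (4 * s))"
    proof -
      have "s powr (-m) = s powr (-1) * s powr (- real CARD('n) / 2)"
        unfolding m_def powr_add[symmetric] by simp
      moreover have "s powr (-1) = 1 / s" using ws by (simp add: powr_minus_divide)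
      ultimately show ?thesis by simp
    qed
    finally have g: "bdry_integrand x y t \<tau> \<le> w * s powr (-m) * exp (- w\<^sup>2 / (4 * s))" .
    show ?thesis unfolding w_def[symmetric]
    proof (cases "\<tau> \<le> t / 2")
      case True
      have "w * s powr (-m) * exp (- w\<^sup>2 / (4 * s)) \<le> w * (t / 2) powr (-m) * exp (- w\<^sup>2 / (4 * t))"
      proof (intro mult_mono mult_left_mono)
        show "s powr - m \<le> (t / 2) powr - m"
          using True ws by (intro powr_mono2') (auto simp: s_def m_def)
        have "w\<^sup>2 / (4 * t) \<le> w\<^sup>2 / (4 * s)" using ws by (intro divide_left_mono) auto
        then show "exp (- w\<^sup>2 / (4 * s)) \<le> exp (- w\<^sup>2 / (4 * t))" by simp
      qed (use ws in auto)
      moreover have "0 \<le> C * (t / 2) powr (1 - 2 * m)" using \<open>C > 0\<close> by simp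
      ultimately show "bdry_integrand x y t \<tau> \<le> (t / 2) powr - m * (w * exp (- w\<^sup>2 / (4 * t))) + C * (t / 2) powr (1 - 2 * m)"
        using g by (simp add: mult_ac)
    next
      case False
      \<comment> \<open>In terms of z the singular power is
        \<open>s powr (- m) = 4 powr m * z powr m * w powr (- 2 * m)\<close>, and
        \<open>z powr m * exp (- z)\<close> is bounded by \<open>C0\<close>.\<close>
      define z where "z = w\<^sup>2 / (4 * s)"
      have "z > 0" using ws by (simp add: z_def)
      have zm: "z powr m = w powr (2 * m) / (4 powr m * s powr m)"
        using ws by (simp add: z_def powr_divide powr_mult powr_powr flip: powr_numeral)
      have "w * s powr (-m) = w powr (1 - 2 * m) * 4 powr m * z powr m"
        using ws by (simp add: zm powr_diff powr_minus field_simps)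
      then have "w * s powr (-m) * exp (- w\<^sup>2 / (4 * s)) = w powr (1 - 2 * m) * 4 powr m * (z powr m * exp (- z))"
        by (simp add: z_def)
      also have "\<dots> \<le> (t / 2) powr (1 - 2 * m) * 4 powr m * C0"
      proof (intro mult_mono)
        show "w powr (1 - 2 * m) \<le> (t / 2) powr (1 - 2 * m)"
          using False ws by (intro powr_mono2') (auto simp: m_def)
      qed (use C0(2)[OF \<open>z > 0\<close>] in auto)
      also have "\<dots> = C * (t / 2) powr (1 - 2 * m)" by (simp add: C_def)
      finally have "bdry_integrand x y t \<tau> \<le> C * (t / 2) powr (1 - 2 * m)" using g by simp
      moreover have "0 \<le> (t / 2) powr - m * (w * exp (- w\<^sup>2 / (4 * t)))" using ws by simp
      ultimately show "bdry_integrand x y t \<tau> \<le> (t / 2) powr - m * (w * exp (- w\<^sup>2 / (4 * t))) + C * (t / 2) powr (1 - 2 * m)"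
        by linarith
    qed
  qed
  ultimately show ?thesis by (intro exI[of _ C]) (auto simp: m_def)
qed

lemma gauss_tail_integral:
  assumes "t > 0" "b \<ge> (0::real)"
  shows "integrable lborel (\<lambda>\<tau>. (b + \<tau>) * exp (- (b + \<tau>)\<^sup>2 / (4 * t)) * indicator {0..t} \<tau>)"
    and "(\<integral>\<tau>. (b + \<tau>) * exp (- (b + \<tau>)\<^sup>2 / (4 * t)) * indicator {0..t} \<tau> \<partial>lborel) \<le> 2 * t"
proof -
  have *: "DERIV (\<lambda>\<tau>. - 2 * t * exp (- (b + \<tau>)\<^sup>2 / (4 * t))) \<tau> :> (b + \<tau>) * exp (- (b + \<tau>)\<^sup>2 / (4 * t))" for \<tau>
    using assms by (auto intro!: derivative_eq_intros simp: field_simps)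
  show "integrable lborel (\<lambda>\<tau>. (b + \<tau>) * exp (- (b + \<tau>)\<^sup>2 / (4 * t)) * indicator {0..t} \<tau>)"
    using assms by (intro integrable_FTC_Icc_nonneg[OF _ *[THEN has_field_derivative_at_within]]) (auto intro!: continuous_intros)
  have "(\<integral>\<tau>. (b + \<tau>) * exp (- (b + \<tau>)\<^sup>2 / (4 * t)) * indicator {0..t} \<tau> \<partial>lborel) =
     - 2 * t * exp (- (b + t)\<^sup>2 / (4 * t)) - (- 2 * t * exp (- (b + 0)\<^sup>2 / (4 * t)))"
    using assms by (intro integral_FTC_Icc_real[OF _ *]) (auto intro!: continuous_intros)
  also have "\<dots> \<le> 2 * t * 1"
  proof -
    have "0 \<le> t * exp (- (b + t)\<^sup>2 / (4 * t))" using assms by simp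
    moreover have "t * exp (- (b + 0)\<^sup>2 / (4 * t)) \<le> t * 1" using assms by (intro mult_left_mono) auto
    ultimately show ?thesis by linarith
  qed
  finally show "(\<integral>\<tau>. (b + \<tau>) * exp (- (b + \<tau>)\<^sup>2 / (4 * t)) * indicator {0..t} \<tau> \<partial>lborel) \<le> 2 * t" by simp
qed

lemma gauss_tail_set_integral:
  assumes "t > 0" "b \<ge> (0::real)"
  shows "set_integrable lborel {0<..<t} (\<lambda>\<tau>. A * ((b + \<tau>) * exp (- (b + \<tau>)\<^sup>2 / (4 * t))) + B)"
    and "0 \<le> A \<Longrightarrow> (LINT \<tau>:{0<..<t}|lborel. A * ((b + \<tau>) * exp (- (b + \<tau>)\<^sup>2 / (4 * t))) + B) \<le> A * (2 * t) + B * t"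
proof -
  let ?f = "\<lambda>\<tau>. (b + \<tau>) * exp (- (b + \<tau>)\<^sup>2 / (4 * t))"
  have i0: "set_integrable lborel {0..t} ?f"
    using gauss_tail_integral(1)[OF assms] by (simp add: set_integrable_def mult.commute)
  have i1: "set_integrable lborel {0<..<t} ?f"
    by (rule set_integrable_subset[OF i0]) auto
  have i2: "set_integrable lborel {0<..<t} (\<lambda>_. B)"
    using assms by (auto simp: set_integrable_def intro!: integrable_real_indicator)
  show "set_integrable lborel {0<..<t} (\<lambda>\<tau>. A * ?f \<tau> + B)"
    using i1 i2 by (intro set_integral_add(1) set_integrable_mult_right) auto
  have "(LINT \<tau>:{0<..<t}|lborel. ?f \<tau>) \<le> (LINT \<tau>:{0..t}|lborel. ?f \<tau>)"
    unfolding set_lebesgue_integral_def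
    using i0 i1 assms by (intro integral_mono) (auto simp: set_integrable_def indicator_def)
  also have "\<dots> \<le> 2 * t"
    using gauss_tail_integral(2)[OF assms] by (simp add: set_lebesgue_integral_def mult.commute)
  finally have f: "(LINT \<tau>:{0<..<t}|lborel. ?f \<tau>) \<le> 2 * t" .
  have "(LINT \<tau>:{0<..<t}|lborel. A * ?f \<tau> + B) =
     A * (LINT \<tau>:{0<..<t}|lborel. ?f \<tau>) + (LINT \<tau>:{0<..<t}|lborel. B)"
    using i1 i2 by (subst set_integral_add(2)) (auto intro!: set_integrable_mult_right)
  also have "(LINT \<tau>:{0<..<t}|lborel. B) = B * t"
    using assms by (simp add: set_lebesgue_integral_def)
  finally show "(LINT \<tau>:{0<..<t}|lborel. A * ?f \<tau> + B) \<le> A * (2 * t) + B * t" if "0 \<le> A"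
    using f that by (simp add: mult_left_mono)
qed

lemma bdry_integrand_integrable:
  assumes "0 \<le> x $ last_idx" "0 \<le> y $ last_idx" "t > 0"
  shows "set_integrable lborel {0<..<t} (bdry_integrand x y t)"
proof -
  obtain C where C: "C > 0" "\<And>\<tau>. 0 < \<tau> \<Longrightarrow> \<tau> < t \<Longrightarrow> bdry_integrand x y t \<tau> \<le>
       (t / 2) powr (- 1 - real CARD('a) / 2) *
         ((x $ last_idx + y $ last_idx + \<tau>) * exp (- (x $ last_idx + y $ last_idx + \<tau>)\<^sup>2 / (4 * t)))
       + C * (t / 2) powr (- 1 - real CARD('a))"
    using bdry_integrand_le[where 'n='a] assms by blast
  show ?thesis
    by (rule set_integrable_bound[OF gauss_tail_set_integral(1)[of t "x $ last_idx + y $ last_idx"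
         "(t / 2) powr (- 1 - real CARD('a) / 2)" "C * (t / 2) powr (- 1 - real CARD('a))"]])
       (use assms C bdry_integrand_nonneg[of x y _ t] in \<open>auto intro!: AE_I2 simp: set_borel_measurable_def intro: order_trans\<close>)
qed

text \<open>Integrating \<open>bdry_integrand_le\<close> over an interval of length t gains one
  power of t in each summand. The power \<open>- N / 2\<close> governs large t, the power
  \<open>- N\<close> small t.\<close>

lemma bdry_integral_le:
  "\<exists>C>0. \<forall>(x :: 'n::{finite,linorder} pt) y t. 0 \<le> x $ last_idx \<longrightarrow> 0 \<le> y $ last_idx \<longrightarrow> 0 < t \<longrightarrow>
     (LINT \<tau>:{0<..<t}|lborel. bdry_integrand x y t \<tau>) \<le> C * (t powr (- real CARD('n) / 2) + t powr (- real CARD('n)))"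
proof -
  define N where "N = real CARD('n)"
  obtain C where C: "C > 0" "\<And>(x :: 'n::{finite,linorder} pt) y t \<tau>. 0 \<le> x $ last_idx \<Longrightarrow> 0 \<le> y $ last_idx \<Longrightarrow> 0 < \<tau> \<Longrightarrow> \<tau> < t \<Longrightarrow> bdry_integrand x y t \<tau> \<le>
       (t / 2) powr (- 1 - N / 2) *
         ((x $ last_idx + y $ last_idx + \<tau>) * exp (- (x $ last_idx + y $ last_idx + \<tau>)\<^sup>2 / (4 * t)))
       + C * (t / 2) powr (- 1 - N)"
    using bdry_integrand_le[where 'n='n] unfolding N_def by blast
  define D where "D = max (2 * 2 powr (1 + N / 2)) (C * 2 powr (1 + N))"
  have "D > 0" by (simp add: D_def less_max_iff_disj)
  moreover have "(LINT \<tau>:{0<..<t}|lborel. bdry_integrand x y t \<tau>) \<le> D * (t powr (- N / 2) + t powr (- N))"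
    if asm: "0 \<le> x $ last_idx" "0 \<le> y $ last_idx" "0 < t" for x y :: "'n pt" and t
  proof -
    let ?b = "x $ last_idx + y $ last_idx"
    have "(LINT \<tau>:{0<..<t}|lborel. bdry_integrand x y t \<tau>) \<le>
      (LINT \<tau>:{0<..<t}|lborel. (t / 2) powr (- 1 - N / 2) * ((?b + \<tau>) * exp (- (?b + \<tau>)\<^sup>2 / (4 * t)))
         + C * (t / 2) powr (- 1 - N))"
      using asm C by (intro set_integral_mono bdry_integrand_integrable gauss_tail_set_integral(1)) auto
    also have "\<dots> \<le> (t / 2) powr (- 1 - N / 2) * (2 * t) + C * (t / 2) powr (- 1 - N) * t"
      using asm by (intro gauss_tail_set_integral(2)) auto
    also have "\<dots> = 2 * 2 powr (1 + N / 2) * t powr (- N / 2) + C * 2 powr (1 + N) * t powr (- N)"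
    proof -
      have "(t / 2) powr (- 1 - a) * t = 2 powr (1 + a) * t powr (- a)" for a
      proof -
        have "t powr (-1) = 1 / t" using asm by (simp add: powr_minus_divide)
        moreover have "t powr (-1 - a) = t powr (-1) * t powr (-a)" unfolding powr_add[symmetric] by simp
        moreover have "2 powr (1 + a) * 2 powr (- 1 - a) = (1::real)" by (simp flip: powr_add)
        ultimately show ?thesis using asm by (simp add: powr_divide field_simps)
      qed
      from this[of "N/2"] this[of N] show ?thesis by (simp add: mult_ac)
    qed
    also have "\<dots> \<le> D * t powr (- N / 2) + D * t powr (- N)"
      by (intro add_mono mult_right_mono) (auto simp: D_def)
    finally show ?thesis by (simp add: algebra_simps)
  qed
  ultimately show ?thesis by (auto simp: N_def)
qed

lemma bdry_integral_nonneg: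
  "0 \<le> x $ last_idx \<Longrightarrow> 0 \<le> y $ last_idx \<Longrightarrow> 0 \<le> (LINT \<tau>:{0<..<t}|lborel. bdry_integrand x y t \<tau>)"
  unfolding set_lebesgue_integral_def
  by (intro Bochner_Integration.integral_nonneg) (auto simp: indicator_def bdry_integrand_nonneg)

text \<open>The squared norms of \<open>x - reflect y\<close> and \<open>x - y\<close> differ by 4
  x_N y_N. Hence the Dirichlet part is nonnegative on the closed half-space, vanishes when x or y
  lies on the boundary, and keeps a fixed fraction of the free kernel where x_N y_N is at least
  t.\<close>

lemma heat_kernel_reflect_eq:
  assumes "t > 0"
  shows "heat_kernel (x - reflect y) t = heat_kernel (x - y) t * exp (- (x $ last_idx * y $ last_idx) / t)"
  using assms unfolding heat_kernel_def norm_sq_reflect unfolding norm_sq_diff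
  by (simp add: mult.assoc flip: exp_add) (simp add: power2_eq_square field_simps)

lemma heat_kernel_reflect_le:
  assumes "t > 0" "0 \<le> x $ last_idx" "0 \<le> y $ last_idx"
  shows "heat_kernel (x - reflect y) t \<le> heat_kernel (x - y) t"
  using assms heat_kernel_nonneg[of "x - y" t] by (auto simp: heat_kernel_reflect_eq intro!: mult_left_le)

lemma bdry_integral_le_G_kernel:
  assumes "t > 0" "0 \<le> x $ last_idx" "0 \<le> y $ last_idx"
  shows "(LINT \<tau>:{0<..<t}|lborel. bdry_integrand x y t \<tau>) \<le> G_kernel x y t"
  using heat_kernel_reflect_le[OF assms] by (simp add: G_kernel_eq)

lemma G_kernel_nonneg:
  "t > 0 \<Longrightarrow> 0 \<le> x $ last_idx \<Longrightarrow> 0 \<le> y $ last_idx \<Longrightarrow> 0 \<le> G_kernel x y t"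
  using bdry_integral_le_G_kernel bdry_integral_nonneg order_trans by blast

lemma set_integral_pos_interval:
  fixes f :: "real \<Rightarrow> real"
  assumes "a < b" "set_integrable lborel {a<..<b} f" "\<And>s. a < s \<Longrightarrow> s < b \<Longrightarrow> 0 < f s"
  shows "0 < (LINT s:{a<..<b}|lborel. f s)"
proof -
  have nn: "0 \<le> indicator {a<..<b} s * f s" for s
    using assms(3)[of s] by (auto simp: indicator_def)
  have "(LINT s:{a<..<b}|lborel. f s) \<noteq> 0"
  proof
    assume "(LINT s:{a<..<b}|lborel. f s) = 0"
    then have "AE s in lborel. indicator {a<..<b} s * f s = 0"
      using assms(2) nn by (subst (asm) set_lebesgue_integral_def, subst (asm) integral_nonneg_eq_0_iff_AE)
        (auto simp: set_integrable_def)
    then have "AE s in lborel. s \<notin> {a<..<b}"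
      by (rule AE_mp) (use assms(3) in \<open>force simp: indicator_def split: if_splits intro!: AE_I2\<close>)
    then have "emeasure lborel {a<..<b} = 0"
      by (subst (asm) AE_iff_measurable[of "{a<..<b}"]) auto
    then show False using \<open>a < b\<close> by simp
  qed
  moreover have "0 \<le> (LINT s:{a<..<b}|lborel. f s)"
    unfolding set_lebesgue_integral_def using nn by (intro Bochner_Integration.integral_nonneg) auto
  ultimately show ?thesis by linarith
qed

lemma G_kernel_pos:
  assumes "t > 0" "0 \<le> x $ last_idx" "0 \<le> y $ last_idx"
  shows "0 < G_kernel x y t"
  using bdry_integral_le_G_kernel[OF assms]
    set_integral_pos_interval[OF _ bdry_integrand_integrable[OF assms(2,3,1)] bdry_integrand_pos[OF assms(2,3)]] assms
  by fastforce

lemma G_kernel_le: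
  "\<exists>C>0. \<forall>(x :: 'n::{finite,linorder} pt) y t. 0 \<le> x $ last_idx \<longrightarrow> 0 \<le> y $ last_idx \<longrightarrow> 0 < t \<longrightarrow>
     G_kernel x y t \<le> C * (t powr (- real CARD('n) / 2) + t powr (- real CARD('n)))"
proof -
  define N where "N = real CARD('n)"
  obtain C where C: "C > 0" "\<And>(x :: 'n pt) y t. 0 \<le> x $ last_idx \<Longrightarrow> 0 \<le> y $ last_idx \<Longrightarrow> 0 < t \<Longrightarrow>
     (LINT \<tau>:{0<..<t}|lborel. bdry_integrand x y t \<tau>) \<le> C * (t powr (- N / 2) + t powr (- N))"
    using bdry_integral_le[where 'n='n] unfolding N_def by blast
  have "G_kernel x y t \<le> (C + 1) * (t powr (- N / 2) + t powr (- N))"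
    if asm: "0 \<le> x $ last_idx" "0 \<le> y $ last_idx" "0 < t" for x y :: "'n pt" and t
  proof -
    have "heat_kernel (x - y) t \<le> t powr (- N / 2) * 1"
      unfolding heat_kernel_def N_def
    proof (intro mult_mono)
      have "t * 1 \<le> t * (4 * pi)" using asm pi_gt3 by (intro mult_left_mono) auto
      then show "(4 * pi * t) powr (- real CARD('n) / 2) \<le> t powr (- real CARD('n) / 2)"
        using asm by (intro powr_mono2') (auto simp: mult_ac)
    qed (use asm in auto)
    also have "\<dots> \<le> t powr (- N / 2) + t powr (- N)" by simp
    finally show ?thesis using C(2)[OF asm] heat_kernel_nonneg[of "x - reflect y" t]
      by (simp add: G_kernel_eq distrib_right)
  qed
  then show ?thesis using C(1) by (intro exI[of _ "C + 1"]) (auto simp: N_def)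
qed

section \<open>Continuity and mass of the kernel\<close>

lemma le_exp_sq_quarter: "v \<le> exp (v\<^sup>2 / 4)" for v :: real
proof -
  have "v \<le> 1 + v\<^sup>2 / 4" using zero_le_power2[of "v / 2 - 1"] by (simp add: power2_eq_square field_simps)
  also have "\<dots> \<le> exp (v\<^sup>2 / 4)" by (rule exp_ge_add_one_self)
  finally show ?thesis .
qed

text \<open>The bound is uniform in the unbounded variables x, y and up to the singular end
  \<open>\<tau> = t\<close>, so that it can serve as a dominating constant. The factor w before the
  Gaussian costs only \<open>sqrt t\<close>, by \<open>le_exp_sq_quarter\<close> applied to
  \<open>w / sqrt t\<close>.\<close>

lemma bdry_integrand_bounded:
  assumes "0 < c" "c \<le> B"
  shows "\<exists>D. \<forall>(x :: 'n::{finite,linorder} pt) y t \<tau>. 0 \<le> x $ last_idx \<longrightarrow> 0 \<le> y $ last_idx \<longrightarrow>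
     c \<le> t \<longrightarrow> t \<le> B \<longrightarrow> 0 < \<tau> \<longrightarrow> \<tau> < t \<longrightarrow> bdry_integrand x y t \<tau> \<le> D"
proof -
  define N where "N = real CARD('n)"
  obtain C where C: "C > 0" "\<And>(x :: 'n::{finite,linorder} pt) y t \<tau>. 0 \<le> x $ last_idx \<Longrightarrow> 0 \<le> y $ last_idx \<Longrightarrow> 0 < \<tau> \<Longrightarrow> \<tau> < t \<Longrightarrow> bdry_integrand x y t \<tau> \<le>
       (t / 2) powr (- 1 - N / 2) *
         ((x $ last_idx + y $ last_idx + \<tau>) * exp (- (x $ last_idx + y $ last_idx + \<tau>)\<^sup>2 / (4 * t)))
       + C * (t / 2) powr (- 1 - N)"
    using bdry_integrand_le[where 'n='n] unfolding N_def by blast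
  have "bdry_integrand x y t \<tau> \<le> (c / 2) powr (- 1 - N / 2) * sqrt B + C * (c / 2) powr (- 1 - N)"
    if asm: "0 \<le> x $ last_idx" "0 \<le> y $ last_idx" "c \<le> t" "t \<le> B" "0 < \<tau>" "\<tau> < t" for x y :: "'n pt" and t \<tau>
  proof -
    define w where "w = x $ last_idx + y $ last_idx + \<tau>"
    have "w / sqrt t \<le> exp ((w / sqrt t)\<^sup>2 / 4)" by (rule le_exp_sq_quarter)
    also have "(w / sqrt t)\<^sup>2 / 4 = w\<^sup>2 / (4 * t)" using asm assms by (simp add: power_divide)
    finally have "w * exp (- w\<^sup>2 / (4 * t)) \<le> sqrt t"
      using asm assms by (simp add: exp_minus field_simps)
    also have "\<dots> \<le> sqrt B" using asm by simp
    finally have 1: "w * exp (- w\<^sup>2 / (4 * t)) \<le> sqrt B" .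
    have "bdry_integrand x y t \<tau> \<le> (t / 2) powr (- 1 - N / 2) * (w * exp (- w\<^sup>2 / (4 * t))) + C * (t / 2) powr (- 1 - N)"
      using C(2)[of x y \<tau> t] asm unfolding w_def by blast
    also have "\<dots> \<le> (c / 2) powr (- 1 - N / 2) * sqrt B + C * (c / 2) powr (- 1 - N)"
      using 1 asm assms C(1) by (intro add_mono mult_mono mult_left_mono powr_mono2') (auto simp: N_def w_def)
    finally show ?thesis .
  qed
  then show ?thesis by blast
qed

lemma tendsto_tang_sq:
  "X \<longlonglongrightarrow> x \<Longrightarrow> Y \<longlonglongrightarrow> y \<Longrightarrow> (\<lambda>n. tang_sq (X n) (Y n)) \<longlonglongrightarrow> tang_sq x y"
  unfolding tang_sq_def by (intro tendsto_intros)

lemma bdry_integrand_tendsto: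
  assumes "X \<longlonglongrightarrow> x" "Y \<longlonglongrightarrow> y" "T \<longlonglongrightarrow> t" "\<tau> < t"
  shows "(\<lambda>n. bdry_integrand (X n) (Y n) (T n) \<tau>) \<longlonglongrightarrow> bdry_integrand x y t \<tau>"
  unfolding bdry_integrand_alt
  using assms by (intro tendsto_intros tendsto_tang_sq) auto

lemma bdry_integral_tendsto:
  fixes x y :: "'n::{finite,linorder} pt"
  assumes "X \<longlonglongrightarrow> x" "Y \<longlonglongrightarrow> y" "T \<longlonglongrightarrow> t" "0 < t"
    and nn: "\<And>n. 0 \<le> X n $ last_idx" "\<And>n. 0 \<le> Y n $ last_idx" "\<And>n. 0 < T n"
  shows "(\<lambda>n. LINT \<tau>:{0<..<T n}|lborel. bdry_integrand (X n) (Y n) (T n) \<tau>)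
           \<longlonglongrightarrow> (LINT \<tau>:{0<..<t}|lborel. bdry_integrand x y t \<tau>)"
proof -
  obtain B where B: "\<And>n. T n \<le> B" "B > 0"
    using convergent_imp_Bseq[OF convergentI[OF assms(3)]] unfolding Bseq_def by (metis abs_le_D1 real_norm_def)
  \<comment> \<open>A bound on the reciprocals keeps all \<open>T n\<close> away from 0, the
    finitely many early ones included.\<close>
  have "(\<lambda>n. 1 / T n) \<longlonglongrightarrow> 1 / t" using assms by (intro tendsto_intros) auto
  then obtain D where D: "\<And>n. 1 / T n \<le> D" "D > 0"
    using convergent_imp_Bseq[OF convergentI, of "\<lambda>n. 1 / T n"] unfolding Bseq_def by (metis abs_le_D1 real_norm_def)
  have cT: "1 / D \<le> T n" for n using D(1)[of n] D(2) nn(3)[of n] by (simp add: field_simps)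
  obtain E where E: "\<And>(x :: 'n pt) y t \<tau>. 0 \<le> x $ last_idx \<Longrightarrow> 0 \<le> y $ last_idx \<Longrightarrow>
     1 / D \<le> t \<Longrightarrow> t \<le> B \<Longrightarrow> 0 < \<tau> \<Longrightarrow> \<tau> < t \<Longrightarrow> bdry_integrand x y t \<tau> \<le> E"
    using bdry_integrand_bounded[of "1 / D" B, where 'n='n] D(2) cT[of 0] B(1)[of 0] by fastforce
  \<comment> \<open>The interval of integration moves with n. Its indicators converge at every point
    except possibly \<open>\<tau> = t\<close>, which is a null set.\<close>
  have ae: "AE \<tau> in lborel. \<tau> \<noteq> t" by (rule AE_lborel_singleton)
  show ?thesis
    unfolding set_lebesgue_integral_def
  proof (rule integral_dominated_convergence[where w = "\<lambda>\<tau>. indicator {0..B} \<tau> * max E 0"])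
    show "(\<lambda>\<tau>. indicator {0<..<t} \<tau> *\<^sub>R bdry_integrand x y t \<tau>) \<in> borel_measurable lborel" by measurable
    show "(\<lambda>\<tau>. indicator {0<..<T n} \<tau> *\<^sub>R bdry_integrand (X n) (Y n) (T n) \<tau>) \<in> borel_measurable lborel" for n by measurable
    show "integrable lborel (\<lambda>\<tau>. indicator {0..B} \<tau> * max E 0)" using B by (auto intro!: integrable_real_indicator)
    show "AE \<tau> in lborel. (\<lambda>n. indicator {0<..<T n} \<tau> *\<^sub>R bdry_integrand (X n) (Y n) (T n) \<tau>)
        \<longlonglongrightarrow> indicator {0<..<t} \<tau> *\<^sub>R bdry_integrand x y t \<tau>"
      using ae
    proof eventually_elim
      case (elim \<tau>)
      have "eventually (\<lambda>n. indicator {0<..<T n} \<tau> = (indicator {0<..<t} \<tau> :: real)) sequentially"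
      proof (cases "\<tau> < t")
        case True
        from order_tendstoD(1)[OF assms(3) True] show ?thesis
          by eventually_elim (use True in \<open>auto simp: indicator_def\<close>)
      next
        case False
        then have "t < \<tau>" using elim by auto
        from order_tendstoD(2)[OF assms(3) this] show ?thesis
          by eventually_elim (use False in \<open>auto simp: indicator_def\<close>)
      qed
      note ind = tendsto_eventually[OF this]
      show ?case
      proof (cases "\<tau> < t")
        case True
        show ?thesis using tendsto_scaleR[OF ind bdry_integrand_tendsto[OF assms(1-3) True]] .
      next
        case False
        then have "t < \<tau>" using elim by auto
        from order_tendstoD(2)[OF assms(3) this]
        have "eventually (\<lambda>n. indicator {0<..<T n} \<tau> *\<^sub>R bdry_integrand (X n) (Y n) (T n) \<tau> = indicator {0<..<t} \<tau> *\<^sub>R bdry_integrand x y t \<tau>) sequentially"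
          by eventually_elim (use False in \<open>auto simp: indicator_def\<close>)
        then show ?thesis by (rule tendsto_eventually)
      qed
    qed
    show "AE \<tau> in lborel. norm (indicator {0<..<T n} \<tau> *\<^sub>R bdry_integrand (X n) (Y n) (T n) \<tau>) \<le> indicator {0..B} \<tau> * max E 0" for n
      using E[OF nn(1)[of n] nn(2)[of n] cT B(1)] B(1)[of n] bdry_integrand_nonneg[OF nn(1)[of n] nn(2)[of n], of _ "T n"]
      by (intro AE_I2) (auto simp: indicator_def le_max_iff_disj)
  qed
qed

lemma G_kernel_tendsto:
  fixes x y :: "'n::{finite,linorder} pt"
  assumes "X \<longlonglongrightarrow> x" "Y \<longlonglongrightarrow> y" "T \<longlonglongrightarrow> t" "0 < t"
    and nn: "\<And>n. 0 \<le> X n $ last_idx" "\<And>n. 0 \<le> Y n $ last_idx" "\<And>n. 0 < T n"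
  shows "(\<lambda>n. G_kernel (X n) (Y n) (T n)) \<longlonglongrightarrow> G_kernel x y t"
proof -
  have "(\<lambda>n. heat_kernel (X n - Y n) (T n) - heat_kernel (X n - reflect (Y n)) (T n))
     \<longlonglongrightarrow> heat_kernel (x - y) t - heat_kernel (x - reflect y) t"
    unfolding heat_kernel_def norm_sq_reflect
    using assms by (intro tendsto_intros tendsto_tang_sq) auto
  from tendsto_add[OF this bdry_integral_tendsto[OF assms]] show ?thesis
    by (simp add: G_kernel_eq)
qed

definition G_dom :: "('n::{finite,linorder} pt \<times> 'n pt \<times> real) set" where
  "G_dom = {(x, y, t). 0 \<le> x $ last_idx \<and> 0 \<le> y $ last_idx \<and> 0 < t}"

lemma continuous_on_G_kernel:
  "continuous_on (G_dom :: ('n::{finite,linorder} pt \<times> 'n pt \<times> real) set) (\<lambda>(x, y, t). G_kernel x y t)"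
  unfolding continuous_on_sequentially
proof safe
  fix X :: "nat \<Rightarrow> 'n pt \<times> 'n pt \<times> real" and x y t
  assume "(x, y, t) \<in> G_dom" "\<forall>n. X n \<in> G_dom" "X \<longlonglongrightarrow> (x, y, t)"
  then have dom: "0 < t" "0 \<le> fst (X n) $ last_idx" "0 \<le> fst (snd (X n)) $ last_idx" "0 < snd (snd (X n))" for n
    by (auto simp: G_dom_def split_beta dest!: spec[of _ n])
  have "(\<lambda>n. G_kernel (fst (X n)) (fst (snd (X n))) (snd (snd (X n)))) \<longlonglongrightarrow> G_kernel x y t"
    using tendsto_fst[OF \<open>X \<longlonglongrightarrow> (x, y, t)\<close>] tendsto_fst[OF tendsto_snd[OF \<open>X \<longlonglongrightarrow> (x, y, t)\<close>]]
      tendsto_snd[OF tendsto_snd[OF \<open>X \<longlonglongrightarrow> (x, y, t)\<close>]]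
    by (intro G_kernel_tendsto dom) simp_all
  then show "((\<lambda>(x, y, t). G_kernel x y t) \<circ> X) \<longlonglongrightarrow> G_kernel x y t"
    by (simp add: o_def split_beta)
qed

text \<open>Extension of the kernel by 0 off its domain of continuity. It is Borel in all variables
  jointly, so Tonelli applies without side conditions on x, y or t.\<close>

definition G0 :: "'n::{finite,linorder} pt \<Rightarrow> 'n pt \<Rightarrow> real \<Rightarrow> real" where
  "G0 x y t = (if 0 \<le> x $ last_idx \<and> 0 \<le> y $ last_idx \<and> 0 < t then G_kernel x y t else 0)"

lemma G_dom_sets: "(G_dom :: ('n::{finite,linorder} pt \<times> 'n pt \<times> real) set) \<in> sets borel"
proof -
  have "G_dom = {x :: 'n::{finite,linorder} pt. 0 \<le> x $ last_idx} \<times> {y :: 'n pt. 0 \<le> y $ last_idx} \<times> {0<..}"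
    by (auto simp: G_dom_def)
  also have "\<dots> \<in> sets (borel \<Otimes>\<^sub>M borel \<Otimes>\<^sub>M borel)"
    by (intro pair_measureI) auto
  finally show ?thesis unfolding borel_prod .
qed

lemma G0_measurable [measurable]:
  assumes [measurable]: "f \<in> M \<rightarrow>\<^sub>M borel" "g \<in> M \<rightarrow>\<^sub>M borel" "h \<in> M \<rightarrow>\<^sub>M borel"
  shows "(\<lambda>w. G0 (f w :: 'n::{finite,linorder} pt) (g w) (h w)) \<in> borel_measurable M"
proof -
  have 1: "(\<lambda>z :: 'n pt \<times> 'n pt \<times> real. indicator G_dom z *\<^sub>R (case z of (x, y, t) \<Rightarrow> G_kernel x y t)) \<in> borel_measurable borel"
    by (rule borel_measurable_continuous_on_indicator[OF G_dom_sets continuous_on_G_kernel])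
  have 2: "(\<lambda>w. (f w, g w, h w)) \<in> M \<rightarrow>\<^sub>M borel" by measurable
  have "(\<lambda>w. G0 (f w) (g w) (h w)) = (\<lambda>w. indicator G_dom (f w, g w, h w) *\<^sub>R (case (f w, g w, h w) of (x, y, t) \<Rightarrow> G_kernel x y t))"
    by (auto simp: G0_def G_dom_def fun_eq_iff indicator_def)
  then show ?thesis using measurable_compose[OF 2 1] by simp
qed

section \<open>Gaussian factorization and the mass of the kernel\<close>

definition gauss1 :: "real \<Rightarrow> real \<Rightarrow> real" where
  "gauss1 s u = (4 * pi * s) powr (- 1 / 2) * exp (- u\<^sup>2 / (4 * s))"

lemma gauss1_nonneg: "0 \<le> gauss1 s u"
  by (simp add: gauss1_def)

lemma gauss1_measurable [measurable]:
  assumes [measurable]: "f \<in> M \<rightarrow>\<^sub>M borel" "g \<in> M \<rightarrow>\<^sub>M borel"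
  shows "(\<lambda>w. gauss1 (f w) (g w)) \<in> borel_measurable M"
  unfolding gauss1_def by measurable

lemma gauss1_eq_normal_density:
  "s > 0 \<Longrightarrow> gauss1 s (a - u) = normal_density a (sqrt (2 * s)) u"
  by (simp add: gauss1_def normal_density_def power2_commute[of a u] powr_minus_divide powr_half_sqrt)

lemma nn_integral_gauss1:
  assumes "s > 0"
  shows "(\<integral>\<^sup>+ u. ennreal (gauss1 s (a - u)) \<partial>lborel) = 1"
  using assms integral_normal_density[of "sqrt (2 * s)" a]
  by (subst nn_integral_eq_integral) (auto simp: gauss1_eq_normal_density)

lemma gauss1_powr_prod:
  assumes "s > 0" "finite A"
  shows "(4 * pi * s) powr (- real (card A) / 2) * exp (- (\<Sum>i\<in>A. (f i)\<^sup>2) / (4 * s)) = (\<Prod>i\<in>A. gauss1 s (f i))"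
proof -
  have "(4 * pi * s) powr (- real (card A) / 2) = ((4 * pi * s) powr (- 1 / 2)) ^ card A"
    using assms by (simp add: powr_powr flip: powr_realpow)
  moreover have "exp (- (\<Sum>i\<in>A. (f i)\<^sup>2) / (4 * s)) = (\<Prod>i\<in>A. exp (- (f i)\<^sup>2 / (4 * s)))"
    using assms by (simp add: exp_sum sum_divide_distrib flip: sum_negf)
  ultimately show ?thesis by (simp add: gauss1_def prod.distrib)
qed

lemma heat_kernel_prod:
  assumes "s > 0"
  shows "heat_kernel x s = (\<Prod>i\<in>UNIV. gauss1 s (x $ i))"
proof -
  have "(norm x)\<^sup>2 = (\<Sum>i\<in>UNIV. (x $ i)\<^sup>2)"
    unfolding power2_norm_eq_inner inner_vec_def by (simp add: power2_eq_square)
  then show ?thesis using gauss1_powr_prod[OF assms, of UNIV "($) x"] by (simp add: heat_kernel_def)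
qed

lemma bdry_integrand_prod:
  assumes "\<tau> < t"
  shows "bdry_integrand x y t \<tau> =
     (x $ last_idx + y $ last_idx + \<tau>) / (t - \<tau>) * gauss1 (t - \<tau>) (x $ last_idx + y $ last_idx + \<tau>) *
     (\<Prod>i\<in>UNIV - {last_idx}. gauss1 (t - \<tau>) (x $ i - y $ i))"
proof -
  have "heat_kernel (x - reflect y + \<tau> *\<^sub>R e_last) (t - \<tau>) =
     gauss1 (t - \<tau>) (x $ last_idx + y $ last_idx + \<tau>) * (\<Prod>i\<in>UNIV - {last_idx}. gauss1 (t - \<tau>) (x $ i - y $ i))"
    using assms by (subst heat_kernel_prod) (auto simp: prod.remove[of UNIV last_idx] e_last_nth reflect_nth)
  then show ?thesis by (simp add: bdry_integrand_def)
qed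

lemma nn_integral_vec_prod:
  fixes f :: "'n::finite \<Rightarrow> real \<Rightarrow> real"
  assumes [measurable]: "\<And>i. f i \<in> borel_measurable borel" and nn: "\<And>i u. 0 \<le> f i u"
  shows "(\<integral>\<^sup>+ x. ennreal (\<Prod>i\<in>UNIV. f i (x $ i)) \<partial>lborel) = (\<Prod>i\<in>UNIV. \<integral>\<^sup>+ u. ennreal (f i u) \<partial>lborel)"
proof -
  define e where "e = (\<lambda>i. axis i (1::real) :: (real, 'n) vec)"
  have inj: "inj e" by (auto simp: inj_def e_def axis_eq_axis)
  have Basis: "Basis = range e" by (auto simp: Basis_vec_def e_def)
  have red: "(\<Prod>b\<in>Basis. h b) = (\<Prod>i\<in>UNIV. h (e i))" for h :: "_ \<Rightarrow> 'c::comm_monoid_mult"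
    unfolding Basis by (rule prod.reindex_cong[OF inj]) auto
  have "(\<integral>\<^sup>+ x. (\<Prod>b\<in>Basis. ennreal (f (inv e b) (x \<bullet> b))) \<partial>lborel) = (\<Prod>b\<in>Basis. \<integral>\<^sup>+ u. ennreal (f (inv e b) u) \<partial>lborel)"
    by (intro nn_integral_lborel_prod) auto
  then show ?thesis
    unfolding red by (simp add: inv_f_f[OF inj]) (simp add: e_def inner_axis prod_ennreal nn)
qed

lemma nn_integral_heat_kernel:
  assumes "s > 0"
  shows "(\<integral>\<^sup>+ y. ennreal (heat_kernel (x - y :: 'n::{finite,linorder} pt) s) \<partial>lborel) = 1"
  using assms nn_integral_vec_prod[of "\<lambda>i u. gauss1 s (x $ i - u)"]
  by (simp add: heat_kernel_prod nn_integral_gauss1 gauss1_nonneg)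

text \<open>The integrand is the u-derivative of \<open>- 2 * gauss1 s (c + u)\<close>. The integral
  of K over the normal variable is therefore exact, and the factor 1 / s disappears.\<close>

lemma nn_integral_gauss1_tail:
  assumes "s > 0" "c \<ge> 0"
  shows "(\<integral>\<^sup>+ u. ennreal (indicator {0<..} u * ((c + u) / s * gauss1 s (c + u))) \<partial>lborel) = ennreal (2 * gauss1 s c)"
proof -
  have "(\<integral>\<^sup>+ u. ennreal (indicator {0<..} u * ((c + u) / s * gauss1 s (c + u))) \<partial>lborel) =
     (\<integral>\<^sup>+ u. ennreal ((c + u) / s * gauss1 s (c + u)) * indicator {0..} u \<partial>lborel)"
    by (rule nn_integral_cong_AE, rule AE_mp[OF AE_lborel_singleton[of 0]])
       (auto intro!: AE_I2 simp: indicator_def)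
  also have "\<dots> = ennreal (0 - (- 2 * gauss1 s (c + 0)))"
  proof (rule nn_integral_FTC_atLeast)
    show "DERIV (\<lambda>u. - 2 * gauss1 s (c + u)) u :> (c + u) / s * gauss1 s (c + u)" for u
      unfolding gauss1_def using assms by (auto intro!: derivative_eq_intros simp: field_simps)
    have "filterlim (\<lambda>u. - (c + u)\<^sup>2 / (4 * s)) at_bot at_top"
      using assms by real_asymp
    then have "((\<lambda>u. exp (- (c + u)\<^sup>2 / (4 * s))) \<longlongrightarrow> 0) at_top"
      by (rule filterlim_compose[OF exp_at_bot])
    from tendsto_mult_left[OF this, of "- 2 * (4 * pi * s) powr (- 1 / 2)"]
    show "((\<lambda>u. - 2 * gauss1 s (c + u)) \<longlongrightarrow> 0) at_top"
      by (simp add: gauss1_def mult.assoc)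
  qed (use assms in \<open>auto simp: gauss1_nonneg\<close>)
  finally show ?thesis by simp
qed

lemma nn_integral_bdry_integrand_Omega:
  fixes x :: "'n::{finite,linorder} pt"
  assumes "0 < \<tau>" "\<tau> < t" "0 \<le> x $ last_idx"
  shows "(\<integral>\<^sup>+ y. ennreal (bdry_integrand x y t \<tau>) * indicator Omega y \<partial>lborel) =
     ennreal (2 * gauss1 (t - \<tau>) (x $ last_idx + \<tau>))"
proof -
  let ?s = "t - \<tau>" and ?c = "x $ last_idx + \<tau>"
  define f :: "'n \<Rightarrow> real \<Rightarrow> real" where
    "f i u = (if i = last_idx then indicator {0<..} u * ((?c + u) / ?s * gauss1 ?s (?c + u)) else gauss1 ?s (x $ i - u))" for i u
  have [measurable]: "f i \<in> borel_measurable borel" for i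
    unfolding f_def by (cases "i = last_idx") simp_all
  have nn: "0 \<le> f i u" for i u
    using assms by (auto simp: f_def gauss1_nonneg indicator_def)
  have "(\<integral>\<^sup>+ y. ennreal (bdry_integrand x y t \<tau>) * indicator Omega y \<partial>lborel) = (\<integral>\<^sup>+ y. ennreal (\<Prod>i\<in>UNIV. f i (y $ i)) \<partial>lborel)"
  proof (intro nn_integral_cong)
    fix y :: "'n pt"
    have "(\<Prod>i\<in>UNIV. f i (y $ i)) = f last_idx (y $ last_idx) * (\<Prod>i\<in>UNIV - {last_idx}. gauss1 ?s (x $ i - y $ i))"
      by (subst prod.remove[of UNIV last_idx]) (auto simp: f_def)
    also have "\<dots> = bdry_integrand x y t \<tau> * indicator Omega y"
      using assms by (auto simp: bdry_integrand_prod f_def indicator_def Omega_def algebra_simps)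
    finally show "ennreal (bdry_integrand x y t \<tau>) * indicator Omega y = ennreal (\<Prod>i\<in>UNIV. f i (y $ i))"
      by (auto simp: indicator_def)
  qed
  also have "\<dots> = (\<Prod>i\<in>UNIV. \<integral>\<^sup>+ u. ennreal (f i u) \<partial>lborel)"
    by (rule nn_integral_vec_prod[OF _ nn]) measurable
  also have "\<dots> = (\<integral>\<^sup>+ u. ennreal (f last_idx u) \<partial>lborel) * (\<Prod>i\<in>UNIV - {last_idx}. \<integral>\<^sup>+ u. ennreal (gauss1 ?s (x $ i - u)) \<partial>lborel)"
    by (subst prod.remove[of UNIV last_idx]) (auto simp: f_def)
  also have "\<dots> = ennreal (2 * gauss1 ?s ?c)"
    using assms nn_integral_gauss1_tail[of ?s ?c] by (simp add: f_def nn_integral_gauss1)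
  finally show ?thesis .
qed

lemma measurable_embed:
  "(\<lambda>v. (\<chi> i. if i = last_idx then 0 else v i) :: 'n::{finite,linorder} pt) \<in>
     borel_measurable (PiM (UNIV - {last_idx}) (\<lambda>_. lborel))"
proof (subst borel_measurable_euclidean_space, rule ballI)
  fix b :: "'n pt" assume "b \<in> Basis"
  then obtain i where b: "b = axis i 1" by (auto simp: Basis_vec_def)
  show "(\<lambda>v. ((\<chi> i. if i = last_idx then 0 else v i) :: 'n pt) \<bullet> b) \<in> borel_measurable (PiM (UNIV - {last_idx}) (\<lambda>_. lborel))"
    unfolding b inner_axis by (cases "i = last_idx") auto
qed

text \<open>Completion does not change nonnegative integrals of Borel functions, and the embedding
  takes all its values in the frontier, so the restriction removes nothing.\<close>

lemma nn_integral_surface_measure: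
  assumes [measurable]: "f \<in> borel_measurable borel"
  shows "(\<integral>\<^sup>+ y. f y \<partial>(surface_measure :: 'n::{finite,linorder} pt measure)) =
    (\<integral>\<^sup>+ v. f (\<chi> i. if i = last_idx then 0 else v i) \<partial>PiM (UNIV - {last_idx}) (\<lambda>_. lborel))"
proof -
  let ?P = "PiM (UNIV - {last_idx :: 'n}) (\<lambda>_. lborel :: real measure)"
  let ?e = "\<lambda>v. (\<chi> i. if i = last_idx then 0 else v i) :: 'n pt"
  have [measurable]: "?e \<in> borel_measurable ?P" by (rule measurable_embed)
  have [measurable]: "frontier Omega \<in> sets (borel :: 'n pt measure)" by simp
  have "(\<integral>\<^sup>+ y. f y \<partial>(surface_measure :: 'n pt measure)) = (\<integral>\<^sup>+ y. f y * indicator (frontier Omega) y \<partial>distr ?P borel ?e)"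
    unfolding surface_measure_def
    by (subst nn_integral_restrict_space) (auto simp: nn_integral_completion intro!: sets_completionI_sets)
  also have "\<dots> = (\<integral>\<^sup>+ v. f (?e v) * indicator (frontier Omega) (?e v) \<partial>?P)"
    by (rule nn_integral_distr) measurable
  also have "\<dots> = (\<integral>\<^sup>+ v. f (?e v) \<partial>?P)"
    by (intro nn_integral_cong) (auto simp: frontier_Omega)
  finally show ?thesis .
qed

lemma nn_integral_bdry_integrand_frontier:
  fixes x :: "'n::{finite,linorder} pt"
  assumes "0 < \<tau>" "\<tau> < t" "0 \<le> x $ last_idx"
  shows "(\<integral>\<^sup>+ v. ennreal (bdry_integrand x (\<chi> i. if i = last_idx then 0 else v i) t \<tau>) \<partial>PiM (UNIV - {last_idx}) (\<lambda>_. lborel)) =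
     ennreal ((x $ last_idx + \<tau>) / (t - \<tau>) * gauss1 (t - \<tau>) (x $ last_idx + \<tau>))"
proof -
  interpret product_sigma_finite "\<lambda>_ :: 'n. lborel :: real measure" by standard
  let ?s = "t - \<tau>" and ?c = "x $ last_idx + \<tau>"
  let ?P = "PiM (UNIV - {last_idx :: 'n}) (\<lambda>_. lborel :: real measure)"
  have "(\<integral>\<^sup>+ v. ennreal (bdry_integrand x (\<chi> i. if i = last_idx then 0 else v i) t \<tau>) \<partial>?P) =
    (\<integral>\<^sup>+ v. ennreal (?c / ?s * gauss1 ?s ?c) * (\<Prod>i\<in>UNIV - {last_idx}. ennreal (gauss1 ?s (x $ i - v i))) \<partial>?P)"
    using assms by (intro nn_integral_cong)
      (simp add: bdry_integrand_prod prod_ennreal gauss1_nonneg prod_nonneg flip: ennreal_mult)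
  also have "\<dots> = ennreal (?c / ?s * gauss1 ?s ?c) * (\<integral>\<^sup>+ v. (\<Prod>i\<in>UNIV - {last_idx}. ennreal (gauss1 ?s (x $ i - v i))) \<partial>?P)"
    by (intro nn_integral_cmult) measurable
  also have "(\<integral>\<^sup>+ v. (\<Prod>i\<in>UNIV - {last_idx}. ennreal (gauss1 ?s (x $ i - v i))) \<partial>?P) =
     (\<Prod>i\<in>UNIV - {last_idx}. \<integral>\<^sup>+ u. ennreal (gauss1 ?s (x $ i - u)) \<partial>lborel)"
    by (rule product_nn_integral_prod) auto
  also have "\<dots> = 1" using assms by (simp add: nn_integral_gauss1)
  finally show ?thesis by simp
qed

text \<open>The integrand may be singular at t. The fundamental theorem can then be applied on
  closed subintervals only, and the uniform bound passes to the limit by monotone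
  convergence.\<close>

lemma nn_integral_open_interval_le:
  fixes f :: "real \<Rightarrow> ennreal"
  assumes [measurable]: "f \<in> borel_measurable borel" and "0 < t"
    and le: "\<And>c. 0 < c \<Longrightarrow> c < t \<Longrightarrow> (\<integral>\<^sup>+ s. f s * indicator {0..c} s \<partial>lborel) \<le> B"
  shows "(\<integral>\<^sup>+ s. f s * indicator {0<..<t} s \<partial>lborel) \<le> B"
proof -
  \<comment> \<open>The shift by 2 makes the first endpoint \<open>t / 2\<close>, hence already
    positive.\<close>
  define c where "c n = t - t / real (n + 2)" for n
  have c: "0 < c n" "c n < t" for n using \<open>0 < t\<close> by (auto simp: c_def field_simps add_pos_nonneg)
  have mono: "c m \<le> c n" if "m \<le> n" for m n
    using \<open>0 < t\<close> that by (auto simp: c_def intro!: divide_left_mono)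
  have lim: "c \<longlonglongrightarrow> t"
    unfolding c_def by real_asymp
  have "(\<lambda>n. \<integral>\<^sup>+ s. f s * indicator {0..c n} s \<partial>lborel) \<longlonglongrightarrow> (\<integral>\<^sup>+ s. f s * indicator {0..<t} s \<partial>lborel)"
  proof (rule nn_integral_LIMSEQ)
    show "incseq (\<lambda>n s. f s * indicator {0..c n} s)"
      using mono by (auto simp: incseq_def le_fun_def indicator_def intro: order_trans)
    show "(\<lambda>n. f s * indicator {0..c n} s) \<longlonglongrightarrow> f s * indicator {0..<t} s" for s
    proof (cases "0 \<le> s \<and> s < t")
      case True
      then have "eventually (\<lambda>n. s < c n) sequentially" using order_tendstoD(1)[OF lim] by auto
      then have "eventually (\<lambda>n. f s * indicator {0..c n} s = f s * indicator {0..<t} s) sequentially"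
        by eventually_elim (use True in \<open>auto simp: indicator_def\<close>)
      then show ?thesis by (rule tendsto_eventually)
    next
      case False
      then have "f s * indicator {0..c n} s = f s * indicator {0..<t} s" for n
        using c(2)[of n] by (auto simp: indicator_def)
      then show ?thesis by simp
    qed
  qed measurable
  then have "(\<integral>\<^sup>+ s. f s * indicator {0..<t} s \<partial>lborel) \<le> B"
    by (rule LIMSEQ_le_const2) (use le c in auto)
  moreover have "(\<integral>\<^sup>+ s. f s * indicator {0<..<t} s \<partial>lborel) \<le> (\<integral>\<^sup>+ s. f s * indicator {0..<t} s \<partial>lborel)"
    by (intro nn_integral_mono) (auto simp: indicator_def)
  ultimately show ?thesis by simp
qed

text \<open>With \<open>z = (a + \<tau>) / (2 \<surd>(t - \<tau>))\<close> the integrand is \<open>(2 / \<surd>\<pi>) z' exp (- z\<^sup>2)\<close>, which is at most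
  \<open>2 z' / (1 + z\<^sup>2)\<close>, the derivative of \<open>2 arctan z\<close>.\<close>

lemma nn_integral_bdry_mass:
  assumes "0 < t" "0 \<le> a"
  shows "(\<integral>\<^sup>+ \<tau>. ennreal (2 * gauss1 (t - \<tau>) (a + \<tau>) + (a + \<tau>) / (t - \<tau>) * gauss1 (t - \<tau>) (a + \<tau>))
            * indicator {0<..<t} \<tau> \<partial>lborel) \<le> ennreal 4"
proof (rule nn_integral_open_interval_le)
  fix c assume c: "0 < c" "c < t"
  define z where "z \<tau> = (a + \<tau>) / (2 * sqrt (t - \<tau>))" for \<tau>
  define z' where "z' \<tau> = 1 / (2 * sqrt (t - \<tau>)) + (a + \<tau>) / (4 * (t - \<tau>) * sqrt (t - \<tau>))" for \<tau>
  \<comment> \<open>To be read with p = \<open>sqrt pi\<close>, r =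
    \<open>sqrt (t - \<tau>)\<close>, s = \<open>t - \<tau>\<close> and w =
    \<open>a + \<tau>\<close>: then \<open>E / (2 * p * r)\<close> is the value of
    \<open>gauss1\<close>, and the inner bracket on the right is \<open>z'\<close>.\<close>
  have algebra: "2 * (E / (2 * p * r)) + w / s * (E / (2 * p * r)) = (2 / p) * ((1 / (2 * r) + w / (4 * s * r)) * E)"
    if "p > 0" "r > 0" "s > 0" for p r s E w :: real
    using that by (simp add: field_simps)
  have bound: "2 * gauss1 (t - \<tau>) (a + \<tau>) + (a + \<tau>) / (t - \<tau>) * gauss1 (t - \<tau>) (a + \<tau>) \<le> 2 * (z' \<tau> * (1 / (1 + (z \<tau>)\<^sup>2)))"
    and z'_nn: "0 \<le> z' \<tau>" if \<tau>: "0 \<le> \<tau>" "\<tau> \<le> c" for \<tau>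
  proof -
    have s: "t - \<tau> > 0" using \<tau> c by auto
    show z'_nn: "0 \<le> z' \<tau>" using s \<tau> assms by (simp add: z'_def)
    have zz: "(z \<tau>)\<^sup>2 = (a + \<tau>)\<^sup>2 / (4 * (t - \<tau>))"
      using s by (simp add: z_def power_divide power_mult_distrib)
    have g: "gauss1 (t - \<tau>) (a + \<tau>) = exp (- (z \<tau>)\<^sup>2) / (2 * sqrt pi * sqrt (t - \<tau>))"
      using s by (simp add: gauss1_def zz powr_minus_divide powr_half_sqrt real_sqrt_mult)
    have "2 * gauss1 (t - \<tau>) (a + \<tau>) + (a + \<tau>) / (t - \<tau>) * gauss1 (t - \<tau>) (a + \<tau>)
       = (2 / sqrt pi) * (z' \<tau> * exp (- (z \<tau>)\<^sup>2))"
      unfolding g z'_def using s by (intro algebra) auto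
    also have "\<dots> \<le> 2 * (z' \<tau> * (1 / (1 + (z \<tau>)\<^sup>2)))"
    proof (intro mult_mono mult_left_mono)
      show "2 / sqrt pi \<le> 2" using pi_gt3 by (simp add: field_simps)
      have "1 + (z \<tau>)\<^sup>2 \<le> exp ((z \<tau>)\<^sup>2)" by (rule exp_ge_add_one_self)
      then show "exp (- (z \<tau>)\<^sup>2) \<le> 1 / (1 + (z \<tau>)\<^sup>2)"
        by (simp add: exp_minus field_simps add_pos_nonneg)
    qed (use z'_nn in auto)
    finally show "2 * gauss1 (t - \<tau>) (a + \<tau>) + (a + \<tau>) / (t - \<tau>) * gauss1 (t - \<tau>) (a + \<tau>) \<le> 2 * (z' \<tau> * (1 / (1 + (z \<tau>)\<^sup>2)))" .
  qed
  have [measurable]: "z \<in> borel_measurable borel" "z' \<in> borel_measurable borel"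
    unfolding z_def z'_def by measurable
  have "(\<integral>\<^sup>+ \<tau>. ennreal (2 * gauss1 (t - \<tau>) (a + \<tau>) + (a + \<tau>) / (t - \<tau>) * gauss1 (t - \<tau>) (a + \<tau>))
            * indicator {0..c} \<tau> \<partial>lborel) \<le> (\<integral>\<^sup>+ \<tau>. ennreal (2 * (z' \<tau> * (1 / (1 + (z \<tau>)\<^sup>2)))) * indicator {0..c} \<tau> \<partial>lborel)"
    using bound by (intro nn_integral_mono) (auto simp: indicator_def intro!: ennreal_leI)
  also have "\<dots> = ennreal (2 * arctan (z c) - 2 * arctan (z 0))"
  proof (rule nn_integral_FTC_Icc)
    fix \<tau> assume "\<tau> \<in> {0..c}"
    then have \<tau>: "0 \<le> \<tau>" "\<tau> \<le> c" by auto
    have s: "t - \<tau> > 0" using \<tau> c by auto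
    define r where "r = sqrt (t - \<tau>)"
    have r: "r > 0" "t - \<tau> = r * r" using s by (auto simp: r_def)
    have dr: "DERIV (\<lambda>\<tau>. sqrt (t - \<tau>)) \<tau> :> - 1 / (2 * r)"
      using s by (auto intro!: derivative_eq_intros simp: r_def field_simps)
    have da: "DERIV (\<lambda>\<tau>. a + \<tau>) \<tau> :> 1" by (auto intro!: derivative_eq_intros)
    have "DERIV z \<tau> :> (1 * (2 * r) - (a + \<tau>) * (2 * (- 1 / (2 * r)))) / (2 * r * (2 * r))"
      unfolding z_def using DERIV_divide[OF da DERIV_cmult[OF dr, of 2]] r(1) by (simp add: r_def)
    moreover have "(1 * (2 * r) - (a + \<tau>) * (2 * (- 1 / (2 * r)))) / (2 * r * (2 * r)) = z' \<tau>"
      unfolding z'_def r_def[symmetric] r(2) using r(1) by (simp add: field_simps)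
    ultimately have "DERIV z \<tau> :> z' \<tau>" by simp
    then show "((\<lambda>\<tau>. 2 * arctan (z \<tau>)) has_real_derivative 2 * (z' \<tau> * (1 / (1 + (z \<tau>)\<^sup>2)))) (at \<tau>)"
      by (auto intro!: derivative_eq_intros simp: field_simps)
    show "0 \<le> 2 * (z' \<tau> * (1 / (1 + (z \<tau>)\<^sup>2)))" using z'_nn[OF \<tau>] by simp
  qed (use c in auto)
  also have "\<dots> \<le> ennreal 4"
  proof (rule ennreal_leI)
    have "0 \<le> arctan (z 0)" using assms by (simp add: z_def)
    then show "2 * arctan (z c) - 2 * arctan (z 0) \<le> 4"
      using arctan_ubound[of "z c"] pi_less_4 by linarith
  qed
  finally show "(\<integral>\<^sup>+ \<tau>. ennreal (2 * gauss1 (t - \<tau>) (a + \<tau>) + (a + \<tau>) / (t - \<tau>) * gauss1 (t - \<tau>) (a + \<tau>))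
            * indicator {0..c} \<tau> \<partial>lborel) \<le> ennreal 4" .
qed (use assms in auto)

lemma bdry_integral_eq_nn:
  assumes "0 \<le> x $ last_idx" "0 \<le> y $ last_idx" "t > 0"
  shows "ennreal (LINT \<tau>:{0<..<t}|lborel. bdry_integrand x y t \<tau>) =
    (\<integral>\<^sup>+ \<tau>. ennreal (bdry_integrand x y t \<tau>) * indicator {0<..<t} \<tau> \<partial>lborel)"
proof -
  have "ennreal (LINT \<tau>:{0<..<t}|lborel. bdry_integrand x y t \<tau>) =
     (\<integral>\<^sup>+ \<tau>. ennreal (indicator {0<..<t} \<tau> *\<^sub>R bdry_integrand x y t \<tau>) \<partial>lborel)"
    unfolding set_lebesgue_integral_def
    using bdry_integrand_integrable[OF assms] bdry_integrand_nonneg[OF assms(1,2)]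
    by (subst nn_integral_eq_integral) (auto simp: set_integrable_def indicator_def)
  also have "\<dots> = (\<integral>\<^sup>+ \<tau>. ennreal (bdry_integrand x y t \<tau>) * indicator {0<..<t} \<tau> \<partial>lborel)"
    by (intro nn_integral_cong) (auto simp: indicator_def)
  finally show ?thesis .
qed

text \<open>The constant is 1 + 4: the free Gaussian over the whole space, and K after Tonelli in y
  and \<open>\<tau>\<close>; the image term is discarded. Integrating K over \<open>Omega\<close>
  produces the first summand in \<open>nn_integral_bdry_mass\<close>, integrating it over the
  boundary the second, so one time integral serves both measures.\<close>

lemma nn_integral_G0_Omega_le:
  fixes x :: "'n::{finite,linorder} pt"
  shows "(\<integral>\<^sup>+ y. ennreal (G0 x y t) * indicator Omega y \<partial>lborel) \<le> ennreal 5"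
proof (cases "0 \<le> x $ last_idx \<and> 0 < t")
  case True
  have [measurable]: "Omega \<in> sets (borel :: 'n pt measure)"
    unfolding Omega_def by measurable
  have "(\<integral>\<^sup>+ y. ennreal (G0 x y t) * indicator Omega y \<partial>lborel) \<le>
     (\<integral>\<^sup>+ y. ennreal (heat_kernel (x - y) t) +
       (\<integral>\<^sup>+ \<tau>. ennreal (bdry_integrand x y t \<tau>) * indicator {0<..<t} \<tau> \<partial>lborel) * indicator Omega y \<partial>lborel)"
  proof (intro nn_integral_mono)
    fix y :: "'n pt"
    show "ennreal (G0 x y t) * indicator Omega y \<le> ennreal (heat_kernel (x - y) t) +
       (\<integral>\<^sup>+ \<tau>. ennreal (bdry_integrand x y t \<tau>) * indicator {0<..<t} \<tau> \<partial>lborel) * indicator Omega y"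
    proof (cases "y \<in> Omega")
      case y: True
      then have "ennreal (G0 x y t) \<le> ennreal (heat_kernel (x - y) t + (LINT \<tau>:{0<..<t}|lborel. bdry_integrand x y t \<tau>))"
        using True heat_kernel_nonneg[of "x - reflect y" t] by (intro ennreal_leI) (auto simp: G0_def Omega_def G_kernel_eq)
      also have "\<dots> = ennreal (heat_kernel (x - y) t) + ennreal (LINT \<tau>:{0<..<t}|lborel. bdry_integrand x y t \<tau>)"
        using True y bdry_integral_nonneg[of x y t] by (intro ennreal_plus) (auto simp: heat_kernel_nonneg Omega_def)
      finally show ?thesis using True y bdry_integral_eq_nn[of x y t] by (simp add: Omega_def)
    qed simp
  qed
  also have "\<dots> = (\<integral>\<^sup>+ y. ennreal (heat_kernel (x - y) t) \<partial>lborel) +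
     (\<integral>\<^sup>+ y. (\<integral>\<^sup>+ \<tau>. ennreal (bdry_integrand x y t \<tau>) * indicator {0<..<t} \<tau> \<partial>lborel) * indicator Omega y \<partial>lborel)"
    by (intro nn_integral_add) measurable
  also have "(\<integral>\<^sup>+ y. (\<integral>\<^sup>+ \<tau>. ennreal (bdry_integrand x y t \<tau>) * indicator {0<..<t} \<tau> \<partial>lborel) * indicator Omega y \<partial>lborel)
     = (\<integral>\<^sup>+ y. (\<integral>\<^sup>+ \<tau>. ennreal (bdry_integrand x y t \<tau>) * indicator {0<..<t} \<tau> * indicator Omega y \<partial>lborel) \<partial>lborel)"
    by (intro nn_integral_cong nn_integral_multc[symmetric]) measurable
  also have "\<dots> = (\<integral>\<^sup>+ \<tau>. (\<integral>\<^sup>+ y. ennreal (bdry_integrand x y t \<tau>) * indicator {0<..<t} \<tau> * indicator Omega y \<partial>lborel) \<partial>lborel)"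
    by (rule lborel_pair.Fubini') measurable
  also have "\<dots> \<le> (\<integral>\<^sup>+ \<tau>. ennreal (2 * gauss1 (t - \<tau>) (x $ last_idx + \<tau>) + (x $ last_idx + \<tau>) / (t - \<tau>) * gauss1 (t - \<tau>) (x $ last_idx + \<tau>))
            * indicator {0<..<t} \<tau> \<partial>lborel)"
  proof (intro nn_integral_mono)
    fix \<tau> :: real
    show "(\<integral>\<^sup>+ y. ennreal (bdry_integrand x y t \<tau>) * indicator {0<..<t} \<tau> * indicator Omega y \<partial>lborel) \<le>
      ennreal (2 * gauss1 (t - \<tau>) (x $ last_idx + \<tau>) + (x $ last_idx + \<tau>) / (t - \<tau>) * gauss1 (t - \<tau>) (x $ last_idx + \<tau>))
            * indicator {0<..<t} \<tau>"
      using True nn_integral_bdry_integrand_Omega[of \<tau> t x]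
      by (cases "\<tau> \<in> {0<..<t}") (auto intro!: ennreal_leI simp: gauss1_nonneg)
  qed
  also have "\<dots> \<le> ennreal 4" using True by (intro nn_integral_bdry_mass) auto
  finally show ?thesis
    using True by (simp add: nn_integral_heat_kernel add_mono)
next
  case False
  then have "G0 x y t = 0" for y by (auto simp: G0_def)
  then show ?thesis by simp
qed

text \<open>For y on the boundary the Dirichlet part cancels and G is K alone, of mass at most 4.
  The weaker 5 gives both measures the same constant in \<open>half_space_data\<close>.\<close>

lemma nn_integral_G0_surface_le:
  fixes x :: "'n::{finite,linorder} pt"
  shows "(\<integral>\<^sup>+ y. ennreal (G0 x y t) \<partial>surface_measure) \<le> ennreal 5"
proof (cases "0 \<le> x $ last_idx \<and> 0 < t")
  case True
  let ?P = "PiM (UNIV - {last_idx :: 'n}) (\<lambda>_. lborel :: real measure)"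
  let ?e = "\<lambda>v. (\<chi> i. if i = last_idx then 0 else v i) :: 'n pt"
  interpret product_sigma_finite "\<lambda>_ :: 'n. lborel :: real measure" by standard
  interpret P: sigma_finite_measure ?P by (rule sigma_finite) simp
  interpret pair_sigma_finite "lborel :: real measure" ?P by standard
  have [measurable]: "?e \<in> borel_measurable ?P" by (rule measurable_embed)
  have "(\<integral>\<^sup>+ y. ennreal (G0 x y t) \<partial>surface_measure) = (\<integral>\<^sup>+ v. ennreal (G0 x (?e v) t) \<partial>?P)"
    by (rule nn_integral_surface_measure) measurable
  also have "\<dots> = (\<integral>\<^sup>+ v. \<integral>\<^sup>+ \<tau>. ennreal (bdry_integrand x (?e v) t \<tau>) * indicator {0<..<t} \<tau> \<partial>lborel \<partial>?P)"
  proof (intro nn_integral_cong)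
    fix v
    have "G0 x (?e v) t = (LINT \<tau>:{0<..<t}|lborel. bdry_integrand x (?e v) t \<tau>)"
      using True by (simp add: G0_def G_kernel_eq heat_kernel_reflect_eq)
    then show "ennreal (G0 x (?e v) t) = (\<integral>\<^sup>+ \<tau>. ennreal (bdry_integrand x (?e v) t \<tau>) * indicator {0<..<t} \<tau> \<partial>lborel)"
      using True bdry_integral_eq_nn[of x "?e v" t] by simp
  qed
  also have "\<dots> = (\<integral>\<^sup>+ \<tau>. \<integral>\<^sup>+ v. ennreal (bdry_integrand x (?e v) t \<tau>) * indicator {0<..<t} \<tau> \<partial>?P \<partial>lborel)"
    by (rule Fubini') measurable
  also have "\<dots> \<le> (\<integral>\<^sup>+ \<tau>. ennreal (2 * gauss1 (t - \<tau>) (x $ last_idx + \<tau>) + (x $ last_idx + \<tau>) / (t - \<tau>) * gauss1 (t - \<tau>) (x $ last_idx + \<tau>))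
            * indicator {0<..<t} \<tau> \<partial>lborel)"
  proof (intro nn_integral_mono)
    fix \<tau> :: real
    show "(\<integral>\<^sup>+ v. ennreal (bdry_integrand x (?e v) t \<tau>) * indicator {0<..<t} \<tau> \<partial>?P) \<le>
      ennreal (2 * gauss1 (t - \<tau>) (x $ last_idx + \<tau>) + (x $ last_idx + \<tau>) / (t - \<tau>) * gauss1 (t - \<tau>) (x $ last_idx + \<tau>))
            * indicator {0<..<t} \<tau>"
      using True nn_integral_bdry_integrand_frontier[of \<tau> t x]
      by (cases "\<tau> \<in> {0<..<t}") (auto intro!: ennreal_leI simp: gauss1_nonneg)
  qed
  also have "\<dots> \<le> ennreal 4" using True by (intro nn_integral_bdry_mass) auto
  also have "\<dots> \<le> ennreal 5" by (rule ennreal_leI) simp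
  finally show ?thesis .
next
  case False
  then have "G0 x y t = 0" for y by (auto simp: G0_def)
  then show ?thesis by simp
qed

section \<open>Nonexistence\<close>

lemma emeasure_cbox_side:
  assumes "0 \<le> l"
  shows "emeasure lborel (cbox (\<chi> i. z i) (\<chi> i. z i + l) :: (real ^ 'n) set) = ennreal (l ^ CARD('n))"
proof -
  have *: "((\<chi> i. z i + l) - (\<chi> i. z i)) \<bullet> b = l" "(\<chi> i. z i) \<bullet> b \<le> (\<chi> i. z i + l) \<bullet> b"
    if "b \<in> Basis" for b :: "real ^ 'n"
    using that assms by (auto simp: Basis_vec_def inner_axis)
  then show ?thesis by (subst emeasure_lborel_cbox) auto
qed

text \<open>Side and distance from the boundary are both r. For times up to \<open>r\<^sup>2\<close>
  the boundary condition then takes away only a fixed fraction of the free heat kernel.\<close>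

definition cube :: "real \<Rightarrow> (real ^ 'n) set" where
  "cube r = cbox (\<chi> i. r) (\<chi> i. 2 * r)"

lemma mem_cube: "x \<in> cube r \<longleftrightarrow> (\<forall>i. r \<le> x $ i \<and> x $ i \<le> 2 * r)"
  by (auto simp: cube_def mem_box_cart)

lemma cube_sets [measurable]: "cube r \<in> sets borel"
  by (simp add: cube_def)

text \<open>Only \<open>\<tau>\<close> between R/4 and R/2 is used. There w = x_N + y_N +
  \<open>\<tau>\<close> is of order R even if x and y lie on the boundary, and
  \<open>t - \<tau>\<close> is of order \<open>R\<^sup>2\<close> because
  \<open>R \<le> R\<^sup>2\<close>. The integrand is then at least of order 1/R times
  \<open>R powr (- N)\<close>, on an interval of length R/4.\<close>

lemma G_kernel_lower:
  "\<exists>c>0. \<forall>R\<ge>1. \<forall>(x :: 'n::{finite,linorder} pt) y t. (\<forall>i. 0 \<le> x $ i \<and> x $ i \<le> 4 * R) \<longrightarrow> (\<forall>i. 0 \<le> y $ i \<and> y $ i \<le> 2 * R) \<longrightarrow>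
     R\<^sup>2 \<le> t \<longrightarrow> t \<le> 4 * R\<^sup>2 \<longrightarrow> c * R powr (- real CARD('n)) \<le> G_kernel x y t"
proof -
  define N where "N = real CARD('n)"
  \<comment> \<open>The squared distance is at most \<open>(16 * N + 49) * R\<^sup>2\<close>, with
    49 from \<open>w \<le> 7 * R\<close>, and the denominator \<open>4 * (t - \<tau>)\<close> is at
    least \<open>2 * R\<^sup>2\<close>. The 64 below is 16 from
    \<open>w / s \<ge> 1 / (16 * R)\<close> times 4 from the interval length R/4.\<close>
  define E where "E = (16 * N + 49) / 2"
  define c where "c = (16 * pi) powr (- N / 2) * exp (- E) / 64"
  have "c > 0" by (simp add: c_def)
  moreover have "c * R powr (- N) \<le> G_kernel x y t"
    if R: "R \<ge> 1" and x: "\<And>i. 0 \<le> x $ i \<and> x $ i \<le> 4 * R" and y: "\<And>i. 0 \<le> y $ i \<and> y $ i \<le> 2 * R"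
      and t: "R\<^sup>2 \<le> t" "t \<le> 4 * R\<^sup>2" for R t and x y :: "'n pt"
  proof -
    define m where "m = 1 / (16 * R) * ((16 * pi) powr (- N / 2) * (R powr (- N) * exp (- E)))"
    have RR: "R \<le> R\<^sup>2" using R by (simp add: power2_eq_square)
    have tpos: "0 < t" using R t by (smt (verit) zero_less_power2)
    have tang: "tang_sq x y \<le> N * (16 * R\<^sup>2)"
    proof -
      have "tang_sq x y \<le> (\<Sum>i\<in>UNIV - {last_idx :: 'n}. 16 * R\<^sup>2)"
        unfolding tang_sq_def
      proof (rule sum_mono)
        fix i :: 'n
        have "\<bar>x $ i - y $ i\<bar> \<le> 4 * R" using x[of i] y[of i] R by auto
        then have "\<bar>x $ i - y $ i\<bar>\<^sup>2 \<le> (4 * R)\<^sup>2" by (intro power_mono) auto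
        then show "(x $ i - y $ i)\<^sup>2 \<le> 16 * R\<^sup>2" by (simp add: power_mult_distrib)
      qed
      also have "\<dots> \<le> (\<Sum>i\<in>(UNIV :: 'n set). 16 * R\<^sup>2)"
        by (rule sum_mono2) auto
      finally show ?thesis by (simp add: N_def)
    qed
    have m: "m \<le> bdry_integrand x y t \<tau>" if \<tau>: "R / 4 < \<tau>" "\<tau> < R / 2" for \<tau>
    proof -
      define s where "s = t - \<tau>"
      define w where "w = x $ last_idx + y $ last_idx + \<tau>"
      have s: "R\<^sup>2 / 2 \<le> s" "s \<le> 4 * R\<^sup>2" "s > 0"
        using \<tau> t RR R by (auto simp: s_def)
      have w: "R / 4 \<le> w" "w \<le> 7 * R" using x[of last_idx] y[of last_idx] \<tau> by (auto simp: w_def)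
      show ?thesis
        unfolding bdry_integrand_alt w_def[symmetric] s_def[symmetric] m_def N_def[symmetric]
      proof (rule mult_mono)
        have "1 / (16 * R) = (R / 4) / (4 * R\<^sup>2)" using R by (simp add: power2_eq_square)
        also have "\<dots> \<le> w / s" using w s R by (intro frac_le) auto
        finally show "1 / (16 * R) \<le> w / s" .
        have "(16 * pi) powr (- N / 2) * R powr (- N) = (16 * pi) powr (- N / 2) * (R\<^sup>2) powr (- N / 2)"
          using R by (simp add: powr_powr flip: powr_numeral)
        also have "\<dots> = (16 * pi * R\<^sup>2) powr (- N / 2)" using R by (simp add: powr_mult)
        also have "\<dots> \<le> (4 * pi * s) powr (- N / 2)"
          using s R by (intro powr_mono2') (auto simp: N_def)
        finally show "(16 * pi) powr (- N / 2) * (R powr (- N) * exp (- E)) \<le> (4 * pi * s) powr (- N / 2) * exp (- (tang_sq x y + w\<^sup>2) / (4 * s))"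
          unfolding mult.assoc[symmetric]
        proof (rule mult_mono)
          have "w\<^sup>2 \<le> (7 * R)\<^sup>2" using w R by (intro power_mono) auto
          then have "tang_sq x y + w\<^sup>2 \<le> (16 * N + 49) * R\<^sup>2" using tang by (simp add: algebra_simps power_mult_distrib)
          also have "\<dots> = E * (2 * R\<^sup>2)" by (simp add: E_def)
          also have "\<dots> \<le> E * (4 * s)" using s by (intro mult_left_mono) (auto simp: E_def N_def)
          finally show "exp (- E) \<le> exp (- (tang_sq x y + w\<^sup>2) / (4 * s))" using s by (simp add: field_simps)
        qed auto
      qed (use R s w in auto)
    qed
    have "c * R powr (- N) = (LINT \<tau>|lborel. indicator {R/4<..<R/2} \<tau> * m)"
      using R by (simp add: m_def c_def field_simps)
    also have "\<dots> \<le> (LINT \<tau>:{0<..<t}|lborel. bdry_integrand x y t \<tau>)"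
      unfolding set_lebesgue_integral_def
    proof (rule integral_mono)
      show "integrable lborel (\<lambda>\<tau>. indicator {R/4<..<R/2} \<tau> * m)"
        using R by (auto intro!: integrable_real_indicator)
      show "integrable lborel (\<lambda>\<tau>. indicator {0<..<t} \<tau> *\<^sub>R bdry_integrand x y t \<tau>)"
        using bdry_integrand_integrable[of x y t] x y tpos by (simp add: set_integrable_def)
      show "indicator {R/4<..<R/2} \<tau> * m \<le> indicator {0<..<t} \<tau> *\<^sub>R bdry_integrand x y t \<tau>" for \<tau>
        using m[of \<tau>] bdry_integrand_nonneg[of x y \<tau> t] x y R RR t by (auto simp: indicator_def)
    qed
    also have "\<dots> \<le> G_kernel x y t" using x y tpos by (intro bdry_integral_le_G_kernel) auto
    finally show ?thesis .
  qed
  ultimately show ?thesis by (auto simp: N_def)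
qed

text \<open>A subcube of side \<open>sqrt t\<close> around x has volume
  \<open>t powr (N / 2)\<close>, and on it the free kernel is at least a constant times
  \<open>t powr (- N / 2)\<close>. The factor \<open>1 - exp (- 1)\<close> is what reflection
  leaves, since x_N y_N is at least \<open>r\<^sup>2\<close> and hence at least t. Thus
  \<open>\<kappa>\<close> depends on N alone.\<close>

lemma G0_cube_mass:
  "\<exists>\<kappa>>0. \<forall>r>0. \<forall>(x :: 'n::{finite,linorder} pt) t. x \<in> cube r \<longrightarrow> 0 < t \<longrightarrow> t \<le> r\<^sup>2 \<longrightarrow>
     ennreal \<kappa> \<le> (\<integral>\<^sup>+ y. ennreal (G0 x y t) * indicator (cube r) y \<partial>lborel)"
proof -
  define N where "N = real CARD('n)"
  define \<kappa> where "\<kappa> = (4 * pi) powr (- N / 2) * exp (- N / 4) * (1 - exp (- 1))"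
  have "\<kappa> > 0" by (simp add: \<kappa>_def)
  moreover have "ennreal \<kappa> \<le> (\<integral>\<^sup>+ y. ennreal (G0 x y t) * indicator (cube r) y \<partial>lborel)"
    if r: "r > 0" and x: "x \<in> cube r" and t: "0 < t" "t \<le> r\<^sup>2" for r t and x :: "'n pt"
  proof -
    \<comment> \<open>Lower corner of the subcube: x itself where there is room above it, otherwise
      pushed back so that the subcube ends at 2 r. It contains x and stays inside
      \<open>cube r\<close> because \<open>sqrt t \<le> r\<close>.\<close>
    define z where "z i = min (x $ i) (2 * r - sqrt t)" for i
    define Q where "Q = (cbox (\<chi> i. z i) (\<chi> i. z i + sqrt t) :: 'n pt set)"
    define m where "m = t powr (- N / 2) * \<kappa>"
    have st: "sqrt t \<le> r" "0 \<le> sqrt t" using r t real_le_lsqrt by auto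
    have x': "r \<le> x $ i" "x $ i \<le> 2 * r" for i using x by (auto simp: mem_cube)
    have Q: "y \<in> cube r" "\<And>i. \<bar>x $ i - y $ i\<bar> \<le> sqrt t" if "y \<in> Q" for y
    proof -
      have y: "z i \<le> y $ i" "y $ i \<le> z i + sqrt t" for i using that by (auto simp: Q_def mem_box_cart)
      show "y \<in> cube r"
        unfolding mem_cube
      proof
        fix i show "r \<le> y $ i \<and> y $ i \<le> 2 * r" using y[of i] x'[of i] st by (auto simp: z_def min_def split: if_splits)
      qed
      show "\<bar>x $ i - y $ i\<bar> \<le> sqrt t" for i using y[of i] x'[of i] st by (auto simp: z_def min_def split: if_splits)
    qed
    have m: "m \<le> G0 x y t" if y: "y \<in> Q" for y
    proof -
      have y': "r \<le> y $ i" for i using Q(1)[OF y] by (auto simp: mem_cube)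
      have nn: "0 \<le> x $ last_idx" "0 \<le> y $ last_idx" using x'[of last_idx] y'[of last_idx] r by auto
      have "(norm (x - y))\<^sup>2 = (\<Sum>i\<in>UNIV. (x $ i - y $ i)\<^sup>2)"
        unfolding power2_norm_eq_inner inner_vec_def by (simp add: power2_eq_square)
      also have "\<dots> \<le> (\<Sum>i\<in>(UNIV :: 'n set). t)"
      proof (rule sum_mono)
        fix i
        have "\<bar>x $ i - y $ i\<bar>\<^sup>2 \<le> (sqrt t)\<^sup>2" using Q(2)[OF y] by (intro power_mono) auto
        then show "(x $ i - y $ i)\<^sup>2 \<le> t" using t by simp
      qed
      finally have n: "(norm (x - y))\<^sup>2 \<le> N * t" by (simp add: N_def)
      have hk: "(4 * pi) powr (- N / 2) * t powr (- N / 2) * exp (- N / 4) \<le> heat_kernel (x - y) t"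
        unfolding heat_kernel_def N_def[symmetric]
      proof (rule mult_mono)
        show "exp (- N / 4) \<le> exp (- (norm (x - y))\<^sup>2 / (4 * t))" using n t by (simp add: field_simps)
        show "(4 * pi) powr (- N / 2) * t powr (- N / 2) \<le> (4 * pi * t) powr (- N / 2)" using t by (simp add: powr_mult)
      qed auto
      have "r * r \<le> x $ last_idx * y $ last_idx" using x'[of last_idx] y'[of last_idx] r by (intro mult_mono) auto
      then have "exp (- (x $ last_idx * y $ last_idx) / t) \<le> exp (- 1)"
        using t by (simp add: power2_eq_square field_simps)
      then have "heat_kernel (x - reflect y) t \<le> heat_kernel (x - y) t * exp (- 1)"
        using t by (simp add: heat_kernel_reflect_eq heat_kernel_nonneg mult_left_mono)
      then have "heat_kernel (x - y) t * (1 - exp (- 1)) \<le> G_kernel x y t"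
        using bdry_integral_nonneg[OF nn, of t] by (simp add: G_kernel_eq algebra_simps)
      moreover have "m \<le> heat_kernel (x - y) t * (1 - exp (- 1))"
        using mult_right_mono[OF hk, of "1 - exp (- 1)"] by (simp add: m_def \<kappa>_def mult_ac)
      ultimately show ?thesis using nn t by (simp add: G0_def)
    qed
    have "ennreal \<kappa> = ennreal m * emeasure lborel Q"
    proof -
      have "sqrt t ^ CARD('n) = t powr (N / 2)"
        using t by (simp add: N_def powr_realpow[symmetric] powr_half_sqrt[symmetric] powr_powr)
      then have "m * sqrt t ^ CARD('n) = \<kappa>" using t by (simp add: m_def flip: powr_add)
      moreover have "0 \<le> m" using \<open>\<kappa> > 0\<close> by (simp add: m_def)
      ultimately show ?thesis
        unfolding Q_def using emeasure_cbox_side[OF st(2), of z] t by (simp flip: ennreal_mult)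
    qed
    also have "\<dots> = (\<integral>\<^sup>+ y. ennreal m * indicator Q y \<partial>lborel)"
      by (subst nn_integral_cmult_indicator) (auto simp: Q_def)
    also have "\<dots> \<le> (\<integral>\<^sup>+ y. ennreal (G0 x y t) * indicator (cube r) y \<partial>lborel)"
      using m Q(1) by (intro nn_integral_mono) (auto simp: indicator_def intro!: ennreal_leI)
    finally show ?thesis .
  qed
  ultimately show ?thesis by auto
qed

section \<open>Growth of the source mass under doubling of the scale\<close>

lemma emeasure_open_cube:
  assumes "0 < l"
  shows "emeasure lborel {y :: real ^ 'n. \<forall>i. 0 < y $ i \<and> y $ i < l} = ennreal (l ^ CARD('n))"
proof -
  have "{y :: real ^ 'n. \<forall>i. 0 < y $ i \<and> y $ i < l} = box 0 (\<chi> i. l)"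
    by (auto simp: mem_box_cart)
  moreover have "emeasure lborel (box 0 (\<chi> i. l) :: (real ^ 'n) set) = ennreal (l ^ CARD('n))"
  proof -
    have *: "((\<chi> i. l) - 0) \<bullet> b = l" "0 \<bullet> b \<le> (\<chi> i. l) \<bullet> b" if "b \<in> Basis" for b :: "real ^ 'n"
      using that assms by (auto simp: Basis_vec_def inner_axis)
    then show ?thesis by (subst emeasure_lborel_box) auto
  qed
  ultimately show ?thesis by simp
qed

definition open_cube :: "real \<Rightarrow> (real ^ 'n) set" where
  "open_cube l = {y. \<forall>i. 0 < y $ i \<and> y $ i < l}"

lemma open_cube_sets [measurable]: "(open_cube l :: (real ^ 'n) set) \<in> sets borel"
proof -
  have "open_cube l = (box 0 (\<chi> i. l) :: (real ^ 'n) set)"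
    by (auto simp: mem_box_cart open_cube_def)
  then show ?thesis by simp
qed

lemma open_cube_subset_Omega: "open_cube l \<subseteq> Omega"
  by (auto simp: open_cube_def Omega_def)

text \<open>What nonexistence retains of a solution. The contribution of the data is nonnegative and
  has been dropped, so the contradiction is the same for all initial data. \<open>super\<close> at
  every positive time is where globality enters.\<close>

locale positive_supersolution =
  fixes U :: "'n::{finite,linorder} pt \<Rightarrow> real \<Rightarrow> real" and p :: real
  assumes p: "1 < p" "p \<le> 1 + 2 / real CARD('n)"
    and meas: "(\<lambda>z. U (fst z) (snd z)) \<in> borel_measurable borel"
    and pos: "\<And>x t. 0 \<le> x $ last_idx \<Longrightarrow> 0 < t \<Longrightarrow> 0 < U x t"
    and super: "\<And>x t. 0 \<le> x $ last_idx \<Longrightarrow> 0 < t \<Longrightarrow>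
      (\<integral>\<^sup>+ s. (\<integral>\<^sup>+ y. ennreal (G0 x y (t - s) * U y s powr p) * indicator Omega y \<partial>lborel) * indicator {0<..<t} s \<partial>lborel)
        \<le> ennreal (U x t)"
begin

definition source_mass :: "real \<Rightarrow> ennreal" where
  "source_mass R = (\<integral>\<^sup>+ s. (\<integral>\<^sup>+ y. ennreal (U y s powr p) * indicator (open_cube (2 * R)) y \<partial>lborel)
      * indicator {0<..<R\<^sup>2} s \<partial>lborel)"

lemma U_measurable [measurable]:
  assumes [measurable]: "f \<in> M \<rightarrow>\<^sub>M borel" "g \<in> M \<rightarrow>\<^sub>M borel"
  shows "(\<lambda>w. U (f w) (g w)) \<in> borel_measurable M"
proof -
  have "(\<lambda>w. (f w, g w)) \<in> M \<rightarrow>\<^sub>M borel" by measurable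
  from measurable_compose[OF this meas] show ?thesis by simp
qed

text \<open>For a source time s below \<open>R\<^sup>2\<close> the elapsed time \<open>t - s\<close>
  lies in the window of \<open>G_kernel_lower\<close>. The range of x contains both the open cube of
  the next scale, where the doubling argument uses the bound, and \<open>cube (2 * R)\<close>, where
  the blow-up takes place.\<close>

lemma U_ge_source_mass:
  "\<exists>c>0. \<forall>R\<ge>1. \<forall>x t. (\<forall>i. 0 \<le> x $ i \<and> x $ i \<le> 4 * R) \<longrightarrow> 2 * R\<^sup>2 \<le> t \<longrightarrow> t \<le> 4 * R\<^sup>2 \<longrightarrow>
     ennreal (c * R powr (- real CARD('n))) * source_mass R \<le> ennreal (U x t)"
proof -
  obtain c where c: "c > 0" "\<And>R (x :: 'n pt) y t. 1 \<le> R \<Longrightarrow> (\<And>i. 0 \<le> x $ i \<and> x $ i \<le> 4 * R) \<Longrightarrow> (\<And>i. 0 \<le> y $ i \<and> y $ i \<le> 2 * R) \<Longrightarrow>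
     R\<^sup>2 \<le> t \<Longrightarrow> t \<le> 4 * R\<^sup>2 \<Longrightarrow> c * R powr (- real CARD('n)) \<le> G_kernel x y t"
    using G_kernel_lower[where 'n='n] by blast
  have "ennreal (c * R powr (- real CARD('n))) * source_mass R \<le> ennreal (U x t)"
    if R: "1 \<le> R" and x: "\<And>i. 0 \<le> x $ i \<and> x $ i \<le> 4 * R" and t: "2 * R\<^sup>2 \<le> t" "t \<le> 4 * R\<^sup>2" for R x t
  proof -
    let ?d = "c * R powr (- real CARD('n))"
    have tpos: "0 < t" using R t by (smt (verit) zero_less_power2)
    have "ennreal ?d * source_mass R =
      (\<integral>\<^sup>+ s. ennreal ?d * ((\<integral>\<^sup>+ y. ennreal (U y s powr p) * indicator (open_cube (2 * R)) y \<partial>lborel)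
         * indicator {0<..<R\<^sup>2} s) \<partial>lborel)"
      unfolding source_mass_def by (rule nn_integral_cmult[symmetric]) measurable
    also have "\<dots> \<le> (\<integral>\<^sup>+ s. (\<integral>\<^sup>+ y. ennreal (G0 x y (t - s) * U y s powr p) * indicator Omega y \<partial>lborel) * indicator {0<..<t} s \<partial>lborel)"
    proof (rule nn_integral_mono)
      fix s :: real
      show "ennreal ?d * ((\<integral>\<^sup>+ y. ennreal (U y s powr p) * indicator (open_cube (2 * R)) y \<partial>lborel) * indicator {0<..<R\<^sup>2} s)
        \<le> (\<integral>\<^sup>+ y. ennreal (G0 x y (t - s) * U y s powr p) * indicator Omega y \<partial>lborel) * indicator {0<..<t} s"
      proof (cases "s \<in> {0<..<R\<^sup>2}")
        case True
        then have s: "0 < s" "s < t" "R\<^sup>2 \<le> t - s" "t - s \<le> 4 * R\<^sup>2" using t by auto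
        have "ennreal ?d * (\<integral>\<^sup>+ y. ennreal (U y s powr p) * indicator (open_cube (2 * R)) y \<partial>lborel)
          = (\<integral>\<^sup>+ y. ennreal ?d * (ennreal (U y s powr p) * indicator (open_cube (2 * R)) y) \<partial>lborel)"
          by (rule nn_integral_cmult[symmetric]) measurable
        also have "\<dots> \<le> (\<integral>\<^sup>+ y. ennreal (G0 x y (t - s) * U y s powr p) * indicator Omega y \<partial>lborel)"
        proof (rule nn_integral_mono)
          fix y :: "'n pt"
          show "ennreal ?d * (ennreal (U y s powr p) * indicator (open_cube (2 * R)) y) \<le> ennreal (G0 x y (t - s) * U y s powr p) * indicator Omega y"
          proof (cases "y \<in> open_cube (2 * R)")
            case y: True
            have y': "0 < y $ i" "y $ i < 2 * R" for i using y by (auto simp: open_cube_def)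
            have "?d \<le> G0 x y (t - s)"
              using c(2)[of R x y "t - s"] R x y' s by (force simp: G0_def less_imp_le)
            then have "?d * U y s powr p \<le> G0 x y (t - s) * U y s powr p" by (intro mult_right_mono) auto
            moreover have "ennreal ?d * ennreal (U y s powr p) = ennreal (?d * U y s powr p)"
              using c(1) by (intro ennreal_mult[symmetric]) auto
            ultimately show ?thesis using y subsetD[OF open_cube_subset_Omega y] by (simp add: ennreal_leI)
          qed simp
        qed
        finally show ?thesis using True s by simp
      qed simp
    qed
    also have "\<dots> \<le> ennreal (U x t)" using x tpos by (intro super) auto
    finally show ?thesis .
  qed
  then show ?thesis using c(1) by blast
qed

text \<open>The seed of the doubling argument, provided by strict positivity of U.\<close>

lemma source_mass_pos: "source_mass 1 \<noteq> 0"
proof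
  assume "source_mass 1 = 0"
  then have "AE s in lborel. (\<integral>\<^sup>+ y. ennreal (U y s powr p) * indicator (open_cube 2) y \<partial>lborel) * indicator {0<..<1} s = 0"
    unfolding source_mass_def by (subst (asm) nn_integral_0_iff_AE) auto
  moreover have "(\<integral>\<^sup>+ y. ennreal (U y s powr p) * indicator (open_cube 2) y \<partial>lborel) \<noteq> 0" if "s > 0" for s
  proof
    assume "(\<integral>\<^sup>+ y. ennreal (U y s powr p) * indicator (open_cube 2) y \<partial>lborel) = 0"
    then have "AE y in lborel. ennreal (U y s powr p) * indicator (open_cube 2) y = 0"
      by (subst (asm) nn_integral_0_iff_AE) auto
    then have "AE y in lborel. y \<notin> (open_cube 2 :: 'n pt set)"
    proof (rule AE_mp, intro AE_I2 impI notI)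
      fix y assume "ennreal (U y s powr p) * indicator (open_cube 2) y = 0" "y \<in> open_cube 2"
      then have "U y s powr p \<le> 0" by (simp add: ennreal_eq_0_iff)
      moreover have "U y s > 0" using pos[of y s] \<open>s > 0\<close> \<open>y \<in> open_cube 2\<close> by (auto simp: open_cube_def less_imp_le)
      ultimately show False by simp
    qed
    then have "emeasure lborel (open_cube 2 :: 'n pt set) = 0"
      by (subst (asm) AE_iff_measurable[of "open_cube 2 :: 'n pt set"]) auto
    then show False by (simp add: open_cube_def emeasure_open_cube)
  qed
  ultimately have "AE s in lborel. s \<notin> {0<..<1::real}"
    by (elim AE_mp) (auto intro!: AE_I2 simp: indicator_def)
  then have "emeasure lborel {0<..<1::real} = 0"
    by (subst (asm) AE_iff_measurable[of "{0<..<1}"]) auto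
  then show False by simp
qed

text \<open>The gain comes from times between \<open>2 * R\<^sup>2\<close> and
  \<open>4 * R\<^sup>2\<close>, which are disjoint from those counted in
  \<open>source_mass R\<close>. There U is at least \<open>\<beta> = c * R powr (- N) * b\<close> on
  a cube of side 4 R, so the gain is \<open>\<beta> powr p\<close> times the space-time volume
  \<open>(4 * R) ^ N * (2 * R\<^sup>2)\<close>.\<close>

lemma source_mass_double:
  "\<exists>c>0. \<forall>R\<ge>1. \<forall>b\<ge>0. ennreal b \<le> source_mass R \<longrightarrow> ennreal (b + c * b powr p) \<le> source_mass (2 * R)"
proof -
  define N where "N = real CARD('n)"
  obtain c where c: "c > 0" "\<And>R x t. 1 \<le> R \<Longrightarrow> (\<And>i. 0 \<le> x $ i \<and> x $ i \<le> 4 * R) \<Longrightarrow> 2 * R\<^sup>2 \<le> t \<Longrightarrow> t \<le> 4 * R\<^sup>2 \<Longrightarrow>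
     ennreal (c * R powr (- N)) * source_mass R \<le> ennreal (U x t)"
    using U_ge_source_mass unfolding N_def by blast
  have "ennreal (b + c powr p * b powr p) \<le> source_mass (2 * R)"
    if R: "1 \<le> R" and b: "0 \<le> b" "ennreal b \<le> source_mass R" for R b
  proof -
    define \<beta> where "\<beta> = c * R powr (- N) * b"
    have \<beta>0: "0 \<le> \<beta>" using c(1) b by (simp add: \<beta>_def)
    have U: "\<beta> \<le> U x t" if "\<And>i. 0 \<le> x $ i \<and> x $ i \<le> 4 * R" "2 * R\<^sup>2 \<le> t" "t \<le> 4 * R\<^sup>2" for x t
    proof -
      have "ennreal \<beta> = ennreal (c * R powr (- N)) * ennreal b"
        using c(1) b by (simp add: \<beta>_def ennreal_mult)
      also have "\<dots> \<le> ennreal (c * R powr (- N)) * source_mass R" by (rule mult_left_mono[OF b(2)]) simp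
      also have "\<dots> \<le> ennreal (U x t)" using that R by (intro c(2)) auto
      finally have "ennreal \<beta> \<le> ennreal (U x t)" .
      moreover have "0 < t" using R that by (smt (verit) zero_less_power2)
      then have "0 < U x t" using that by (intro pos) auto
      ultimately show ?thesis by (simp add: ennreal_le_iff)
    qed
    define V where "V = (\<beta> powr p) * (4 * R) ^ CARD('n)"
    have V0: "0 \<le> V" using R by (simp add: V_def)
    have inner: "ennreal V \<le> (\<integral>\<^sup>+ y. ennreal (U y s powr p) * indicator (open_cube (2 * (2 * R))) y \<partial>lborel)"
      if s: "2 * R\<^sup>2 \<le> s" "s \<le> 4 * R\<^sup>2" for s
    proof -
      have "ennreal V = ennreal (\<beta> powr p) * emeasure lborel (open_cube (4 * R) :: 'n pt set)"
        using R by (simp add: V_def open_cube_def emeasure_open_cube ennreal_mult)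
      also have "\<dots> = (\<integral>\<^sup>+ y. ennreal (\<beta> powr p) * indicator (open_cube (4 * R) :: 'n pt set) y \<partial>lborel)"
        by (rule nn_integral_cmult_indicator[symmetric]) simp
      also have "\<dots> \<le> (\<integral>\<^sup>+ y. ennreal (U y s powr p) * indicator (open_cube (2 * (2 * R))) y \<partial>lborel)"
      proof (rule nn_integral_mono)
        fix y :: "'n pt"
        show "ennreal (\<beta> powr p) * indicator (open_cube (4 * R)) y \<le> ennreal (U y s powr p) * indicator (open_cube (2 * (2 * R))) y"
        proof (cases "y \<in> open_cube (4 * R)")
          case True
          then have "\<beta> \<le> U y s" using s by (intro U) (auto simp: open_cube_def less_imp_le)
          then have "\<beta> powr p \<le> U y s powr p" using \<beta>0 p by (intro powr_mono2) auto
          then show ?thesis using True by (simp add: ennreal_leI)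
        qed simp
      qed
      finally show ?thesis .
    qed
    have le: "c powr p * b powr p \<le> V * (2 * R\<^sup>2)"
    proof -
      have eq: "V * (2 * R\<^sup>2) = (c powr p * b powr p) * (2 * 4 ^ CARD('n) * R powr (N + 2 - N * p))"
      proof -
        have "\<beta> powr p = c powr p * R powr (- N * p) * b powr p"
          using c(1) b R by (simp add: \<beta>_def powr_mult powr_powr)
        moreover have "R ^ CARD('n) = R powr N" "R\<^sup>2 = R powr 2" using R by (simp_all add: N_def powr_realpow)
        moreover have "R powr (N + 2 - N * p) = R powr (- N * p) * R powr N * R powr 2" by (simp flip: powr_add add: algebra_simps)
        ultimately show ?thesis by (simp add: V_def power_mult_distrib mult_ac)
      qed
      \<comment> \<open>The exponent is nonnegative precisely because p is at most 1 + 2/N. At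
        equality it is 0, and the constant gain per doubling still suffices.\<close>
      have ge1: "1 \<le> 2 * 4 ^ CARD('n) * R powr (N + 2 - N * p)"
      proof -
        have "N * p \<le> N * (1 + 2 / N)" using p by (intro mult_left_mono) (auto simp: N_def)
        also have "\<dots> = N + 2" by (simp add: N_def field_simps)
        finally have "1 \<le> R powr (N + 2 - N * p)" using R by (intro ge_one_powr_ge_zero) auto
        moreover have "(1::real) \<le> 4 ^ CARD('n)" by simp
        ultimately have "1 * 1 \<le> 4 ^ CARD('n) * R powr (N + 2 - N * p)" by (intro mult_mono) auto
        then show ?thesis by simp
      qed
      have "(c powr p * b powr p) * 1 \<le> (c powr p * b powr p) * (2 * 4 ^ CARD('n) * R powr (N + 2 - N * p))"
        by (rule mult_left_mono[OF ge1]) simp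
      then show ?thesis unfolding eq by (simp only: mult_1_right)
    qed
    have "ennreal (b + c powr p * b powr p) \<le> ennreal b + ennreal (V * (2 * R\<^sup>2))"
      using b le V0 by (subst ennreal_plus[symmetric]) (auto intro!: ennreal_leI)
    also have "\<dots> \<le> source_mass R + (\<integral>\<^sup>+ s. ennreal V * indicator {2 * R\<^sup>2<..<4 * R\<^sup>2} s \<partial>lborel)"
      using b V0 by (intro add_mono) (simp_all add: nn_integral_cmult_indicator ennreal_mult)
    also have "\<dots> = (\<integral>\<^sup>+ s. (\<integral>\<^sup>+ y. ennreal (U y s powr p) * indicator (open_cube (2 * R)) y \<partial>lborel)
      * indicator {0<..<R\<^sup>2} s + ennreal V * indicator {2 * R\<^sup>2<..<4 * R\<^sup>2} s \<partial>lborel)"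
      unfolding source_mass_def by (rule nn_integral_add[symmetric]) measurable
    also have "\<dots> \<le> source_mass (2 * R)"
      unfolding source_mass_def
    proof (rule nn_integral_mono)
      fix s
      have mono: "(\<integral>\<^sup>+ y. ennreal (U y s powr p) * indicator (open_cube (2 * R)) y \<partial>lborel) \<le>
          (\<integral>\<^sup>+ y. ennreal (U y s powr p) * indicator (open_cube (2 * (2 * R))) y \<partial>lborel)"
        using R by (intro nn_integral_mono mult_left_mono) (auto simp: open_cube_def indicator_def intro: less_le_trans)
      have R2: "0 < R\<^sup>2" using R by simp
      consider "s \<in> {0<..<R\<^sup>2}" | "s \<in> {2 * R\<^sup>2<..<4 * R\<^sup>2}" | "s \<notin> {0<..<R\<^sup>2}" "s \<notin> {2 * R\<^sup>2<..<4 * R\<^sup>2}" by blast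
      then show "(\<integral>\<^sup>+ y. ennreal (U y s powr p) * indicator (open_cube (2 * R)) y \<partial>lborel)
      * indicator {0<..<R\<^sup>2} s + ennreal V * indicator {2 * R\<^sup>2<..<4 * R\<^sup>2} s \<le>
        (\<integral>\<^sup>+ y. ennreal (U y s powr p) * indicator (open_cube (2 * (2 * R))) y \<partial>lborel) * indicator {0<..<(2 * R)\<^sup>2} s"
      proof cases
        case 1
        then have "s \<notin> {2 * R\<^sup>2<..<4 * R\<^sup>2}" "s \<in> {0<..<(2 * R)\<^sup>2}" using R2 by (auto simp: power_mult_distrib)
        then show ?thesis using 1 mono by simp
      next
        case 2
        then have "s \<notin> {0<..<R\<^sup>2}" "s \<in> {0<..<(2 * R)\<^sup>2}" using R2 by (auto simp: power_mult_distrib)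
        then show ?thesis using 2 inner[of s] by simp
      qed simp
    qed
    finally show ?thesis .
  qed
  moreover have "0 < c powr p" using c(1) by simp
  ultimately show ?thesis by blast
qed

text \<open>The gain is monotone in the mass, so each doubling adds at least the gain computed from
  the seed b. Linear growth in the number of doublings is enough.\<close>

lemma source_mass_unbounded: "\<exists>R\<ge>1. ennreal B \<le> source_mass R"
proof -
  obtain c where c: "c > 0" "\<And>R b. 1 \<le> R \<Longrightarrow> 0 \<le> b \<Longrightarrow> ennreal b \<le> source_mass R \<Longrightarrow> ennreal (b + c * b powr p) \<le> source_mass (2 * R)"
    using source_mass_double by blast
  obtain b where b: "b > 0" "ennreal b \<le> source_mass 1"
  proof (cases "source_mass 1")
    case (real r)
    then show ?thesis using that[of r] source_mass_pos by (auto simp: less_le)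
  next
    case top
    then show ?thesis using that[of 1] by simp
  qed
  have *: "ennreal (b + real k * (c * b powr p)) \<le> source_mass (2 ^ k)" for k
  proof (induction k)
    case (Suc k)
    define d where "d = b + real k * (c * b powr p)"
    have d: "b \<le> d" using c(1) by (simp add: d_def)
    have "b powr p \<le> d powr p" using d b p by (intro powr_mono2) auto
    then have "b + real (Suc k) * (c * b powr p) \<le> d + c * d powr p"
      using c(1) by (simp add: d_def algebra_simps)
    then have "ennreal (b + real (Suc k) * (c * b powr p)) \<le> ennreal (d + c * d powr p)" by (rule ennreal_leI)
    also have "\<dots> \<le> source_mass (2 * 2 ^ k)"
      using d b Suc by (intro c(2)) (auto simp: d_def)
    finally show ?case by simp
  qed (use b in simp)
  obtain k where k: "B / (c * b powr p) \<le> real k" using real_arch_simple by blast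
  then have "B \<le> b + real k * (c * b powr p)" using b c by (simp add: field_simps)
  then have "ennreal B \<le> source_mass (2 ^ k)" using *[of k] by (meson ennreal_leI order_trans)
  then show ?thesis by (intro exI[of _ "2 ^ k"]) simp
qed

text \<open>A constant lower bound on the cube, inserted into the Duhamel inequality and combined
  with the kernel mass on that same cube, returns a bound growing linearly in time. The cube does
  not shrink, so the step can be repeated indefinitely.\<close>

lemma cube_lower_bound_step:
  "\<exists>\<kappa>>0. \<forall>r>0. \<forall>M\<ge>0. \<forall>s0\<ge>0. \<forall>T. T - s0 \<le> r\<^sup>2 \<longrightarrow> (\<forall>x\<in>cube r. \<forall>t\<in>{s0..T}. M \<le> U x t) \<longrightarrow>
     (\<forall>x\<in>cube r. \<forall>t\<in>{s0..T}. \<kappa> * (t - s0) * M powr p \<le> U x t)"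
proof -
  obtain \<kappa> where \<kappa>: "\<kappa> > 0" "\<And>r (x :: 'n pt) t. 0 < r \<Longrightarrow> x \<in> cube r \<Longrightarrow> 0 < t \<Longrightarrow> t \<le> r\<^sup>2 \<Longrightarrow>
     ennreal \<kappa> \<le> (\<integral>\<^sup>+ y. ennreal (G0 x y t) * indicator (cube r) y \<partial>lborel)"
    using G0_cube_mass[where 'n='n] by blast
  have "\<kappa> * (t - s0) * M powr p \<le> U x t"
    if r: "0 < r" and M: "0 \<le> M" "0 \<le> s0" "T - s0 \<le> r\<^sup>2" "\<And>x t. x \<in> cube r \<Longrightarrow> s0 \<le> t \<Longrightarrow> t \<le> T \<Longrightarrow> M \<le> U x t"
      and x: "x \<in> cube r" and t: "s0 \<le> t" "t \<le> T" for r M s0 T x t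
  proof (cases "s0 = t")
    \<comment> \<open>The claim reduces to nonnegativity, which follows from the bound M. It is
      taken from there because t may be 0, where \<open>super\<close> gives no information.\<close>
    case True
    then show ?thesis using M(4)[OF x t] M(1) by simp
  next
    case False
    then have t0: "s0 < t" "0 < t" using t M by auto
    have cl: "0 \<le> y $ last_idx" if "y \<in> cube r" for y :: "'n pt"
      using that r by (auto simp: mem_cube dest!: spec[of _ last_idx])
    have "ennreal (\<kappa> * (t - s0) * M powr p) = ennreal (\<kappa> * M powr p) * emeasure lborel {s0<..<t}"
      using t0 \<kappa>(1) by (simp add: mult_ac flip: ennreal_mult)
    also have "\<dots> = (\<integral>\<^sup>+ s. ennreal (\<kappa> * M powr p) * indicator {s0<..<t} s \<partial>lborel)"
      by (rule nn_integral_cmult_indicator[symmetric]) simp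
    also have "\<dots> \<le> (\<integral>\<^sup>+ s. (\<integral>\<^sup>+ y. ennreal (G0 x y (t - s) * U y s powr p) * indicator Omega y \<partial>lborel) * indicator {0<..<t} s \<partial>lborel)"
    proof (rule nn_integral_mono)
      fix s
      show "ennreal (\<kappa> * M powr p) * indicator {s0<..<t} s \<le> (\<integral>\<^sup>+ y. ennreal (G0 x y (t - s) * U y s powr p) * indicator Omega y \<partial>lborel) * indicator {0<..<t} s"
      proof (cases "s \<in> {s0<..<t}")
        case True
        then have s: "s0 < s" "s < t" "0 < t - s" "t - s \<le> r\<^sup>2" "0 < s" using M t by auto
        have "ennreal (\<kappa> * M powr p) = ennreal (M powr p) * ennreal \<kappa>"
          using \<kappa>(1) by (simp add: mult.commute ennreal_mult')
        also have "\<dots> \<le> ennreal (M powr p) * (\<integral>\<^sup>+ y. ennreal (G0 x y (t - s)) * indicator (cube r) y \<partial>lborel)"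
          by (rule mult_left_mono[OF \<kappa>(2)]) (use r x s in auto)
        also have "\<dots> = (\<integral>\<^sup>+ y. ennreal (M powr p) * (ennreal (G0 x y (t - s)) * indicator (cube r) y) \<partial>lborel)"
          by (rule nn_integral_cmult[symmetric]) measurable
        also have "\<dots> \<le> (\<integral>\<^sup>+ y. ennreal (G0 x y (t - s) * U y s powr p) * indicator Omega y \<partial>lborel)"
        proof (rule nn_integral_mono)
          fix y :: "'n pt"
          show "ennreal (M powr p) * (ennreal (G0 x y (t - s)) * indicator (cube r) y) \<le> ennreal (G0 x y (t - s) * U y s powr p) * indicator Omega y"
          proof (cases "y \<in> cube r")
            case True
            have "M powr p \<le> U y s powr p" using M(4)[OF True] M(1) s t p by (intro powr_mono2) auto
            moreover have "0 \<le> G0 x y (t - s)" using cl[OF True] cl[OF x] s by (auto simp: G0_def G_kernel_nonneg)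
            ultimately have "M powr p * G0 x y (t - s) \<le> G0 x y (t - s) * U y s powr p"
              by (simp add: mult.commute mult_right_mono)
            moreover have "y \<in> Omega" using True r by (auto simp: mem_cube Omega_def dest!: spec[of _ last_idx])
            ultimately show ?thesis using True \<open>0 \<le> G0 x y (t - s)\<close> by (simp add: ennreal_leI flip: ennreal_mult)
          qed simp
        qed
        finally show ?thesis using True M by simp
      qed simp
    qed
    also have "\<dots> \<le> ennreal (U x t)" using cl[OF x] t0 by (intro super) auto
    finally have "ennreal (\<kappa> * (t - s0) * M powr p) \<le> ennreal (U x t)" .
    then show ?thesis using pos[OF cl[OF x] t0(2)] by (simp add: ennreal_le_iff)
  qed
  then show ?thesis using \<kappa>(1) by (intro exI[of _ \<kappa>]) auto
qed

text \<open>On a fixed cube, a lower bound \<open>M\<close> doubles after a time proportional to \<open>M\<^bsup>1 - p\<^esup>\<close>. These waiting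
  times form a convergent geometric series, so a large enough initial bound blows up.\<close>

lemma no_positive_supersolution: False
proof -
  define N where "N = real CARD('n)"
  obtain c where c: "c > 0" "\<And>R x t. 1 \<le> R \<Longrightarrow> (\<And>i. 0 \<le> x $ i \<and> x $ i \<le> 4 * R) \<Longrightarrow> 2 * R\<^sup>2 \<le> t \<Longrightarrow> t \<le> 4 * R\<^sup>2 \<Longrightarrow>
     ennreal (c * R powr (- N)) * source_mass R \<le> ennreal (U x t)"
    using U_ge_source_mass unfolding N_def by blast
  obtain \<kappa> where \<kappa>: "\<kappa> > 0" "\<And>r M s0 T x t. 0 < r \<Longrightarrow> 0 \<le> M \<Longrightarrow> 0 \<le> s0 \<Longrightarrow> T - s0 \<le> r\<^sup>2 \<Longrightarrow>
      (\<And>x t. x \<in> cube r \<Longrightarrow> t \<in> {s0..T} \<Longrightarrow> M \<le> U x t) \<Longrightarrow> x \<in> cube r \<Longrightarrow> t \<in> {s0..T} \<Longrightarrow> \<kappa> * (t - s0) * M powr p \<le> U x t"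
    using cube_lower_bound_step by metis
  \<comment> \<open>Replacing M by 2 M multiplies the waiting time, proportional to
    \<open>M powr (1 - p)\<close>, by this ratio.\<close>
  define \<rho> where "\<rho> = 2 powr (1 - p)"
  have \<rho>: "0 < \<rho>" "\<rho> < 1" using p powr_less_mono[of "1 - p" 0 2] by (simp_all add: \<rho>_def)
  define \<Lambda> where "\<Lambda> = 1 / (\<kappa> * (1 - \<rho>))"
  have \<Lambda>: "\<Lambda> > 0" using \<kappa> \<rho> by (simp add: \<Lambda>_def)
  \<comment> \<open>The mass b must be fixed before R, because R is obtained in response to b. One b
    works for every R: \<open>M0 powr (p - 1)\<close> equals
    \<open>\<Lambda> * R powr (- N * (p - 1))\<close>, and \<open>N * (p - 1) \<le> 2\<close> makes
    this at least \<open>\<Lambda> / R\<^sup>2\<close>. The value of \<open>\<Lambda>\<close> is the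
    one for which the total waiting time then fits into \<open>2 * R\<^sup>2\<close>.\<close>
  define b where "b = \<Lambda> powr (1 / (p - 1)) / c"
  have b: "b > 0" using \<Lambda> c by (simp add: b_def)
  obtain R where R: "R \<ge> 1" "ennreal b \<le> source_mass R" using source_mass_unbounded by blast
  define M0 where "M0 = c * R powr (- N) * b"
  have M0: "0 < M0" using c b R by (simp add: M0_def)
  \<comment> \<open>The first waiting time, determined by
    \<open>\<kappa> * l * M0 powr p = 2 * M0\<close>.\<close>
  define l where "l = 2 * M0 powr (1 - p) / \<kappa>"
  have l0: "l > 0" using M0 \<kappa> by (simp add: l_def)
  have l_le: "l / (1 - \<rho>) \<le> 2 * R\<^sup>2"
  proof -
    have "M0 powr (p - 1) = \<Lambda> * R powr (- N * (p - 1))"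
    proof -
      have "M0 powr (p - 1) = (\<Lambda> powr (1 / (p - 1)) * R powr (- N)) powr (p - 1)"
        using c by (simp add: M0_def b_def mult.commute)
      also have "\<dots> = \<Lambda> powr (1 / (p - 1) * (p - 1)) * R powr (- N * (p - 1))"
        by (simp add: powr_mult powr_powr)
      finally show ?thesis using p \<Lambda> by simp
    qed
    moreover have "R powr (-2) \<le> R powr (- N * (p - 1))"
    proof (rule powr_mono)
      have "N * (p - 1) \<le> N * (2 / N)" using p by (intro mult_left_mono) (auto simp: N_def)
      then show "- 2 \<le> - N * (p - 1)" by (simp add: N_def)
    qed (use R in auto)
    ultimately have "\<Lambda> * R powr (-2) \<le> M0 powr (p - 1)" using \<Lambda> by simp
    moreover have "R powr (-2) = 1 / R\<^sup>2" using R by (simp add: powr_minus_divide)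
    ultimately have "\<Lambda> \<le> M0 powr (p - 1) * R\<^sup>2" using R by (simp add: field_simps)
    moreover have "M0 powr (1 - p) * M0 powr (p - 1) = 1" using M0 by (simp flip: powr_add)
    ultimately have "M0 powr (1 - p) * \<Lambda> \<le> R\<^sup>2"
      using mult_left_mono[of \<Lambda> "M0 powr (p - 1) * R\<^sup>2" "M0 powr (1 - p)"] by (simp add: mult.assoc[symmetric])
    moreover have "l / (1 - \<rho>) = 2 * (M0 powr (1 - p) * \<Lambda>)" using \<kappa> \<rho> by (simp add: l_def \<Lambda>_def field_simps)
    ultimately show ?thesis by simp
  qed
  \<comment> \<open>The time by which the bound \<open>2 ^ n * M0\<close> holds on
    \<open>cube (2 * R)\<close>. Since no \<open>S n\<close> exceeds \<open>4 * R\<^sup>2\<close>,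
    all these bounds hold together at that final time.\<close>
  define S where "S n = 2 * R\<^sup>2 + (\<Sum>k<n. l * \<rho> ^ k)" for n
  have S: "2 * R\<^sup>2 \<le> S n" "S n \<le> 4 * R\<^sup>2" for n
  proof -
    show "2 * R\<^sup>2 \<le> S n" using l0 \<rho> by (auto simp: S_def intro!: sum_nonneg)
    have "(\<Sum>k<n. l * \<rho> ^ k) = l * (\<Sum>k<n. \<rho> ^ k)" by (simp add: sum_distrib_left)
    also have "\<dots> = l * ((1 - \<rho> ^ n) / (1 - \<rho>))" using \<rho> by (simp add: sum_gp_strict)
    also have "\<dots> \<le> l * (1 / (1 - \<rho>))" using \<rho> l0 by (intro mult_left_mono divide_right_mono) auto
    finally show "S n \<le> 4 * R\<^sup>2" using l_le by (simp add: S_def)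
  qed
  have lower: "2 ^ n * M0 \<le> U x t" if "x \<in> cube (2 * R)" "t \<in> {S n..4 * R\<^sup>2}" for n x t
    using that
  proof (induction n arbitrary: x t)
    case 0
    have x: "0 \<le> x $ i \<and> x $ i \<le> 4 * R" for i
      using 0(1) R by (auto simp: mem_cube dest!: spec[of _ i])
    have "ennreal M0 = ennreal (c * R powr (- N)) * ennreal b" using c b by (simp add: M0_def ennreal_mult)
    also have "\<dots> \<le> ennreal (c * R powr (- N)) * source_mass R" by (rule mult_left_mono[OF R(2)]) simp
    also have "\<dots> \<le> ennreal (U x t)" using 0 x R by (intro c(2)) (auto simp: S_def)
    finally have "ennreal M0 \<le> ennreal (U x t)" .
    moreover have "0 < t" using 0 R S(1)[of 0] by (smt (verit) atLeastAtMost_iff zero_less_power2)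
    then have "0 < U x t" using x by (intro pos) auto
    ultimately show ?case by (simp add: ennreal_le_iff)
  next
    case (Suc n)
    have SS: "S (Suc n) = S n + l * \<rho> ^ n" by (simp add: S_def)
    have "l * \<rho> ^ n > 0" using l0 \<rho> by simp
    have "\<kappa> * (t - S n) * (2 ^ n * M0) powr p \<le> U x t"
    proof (rule \<kappa>(2)[of "2 * R"])
      show "4 * R\<^sup>2 - S n \<le> (2 * R)\<^sup>2" using S(1)[of n] R by (simp add: power_mult_distrib) (smt (verit) zero_le_power2)
      show "0 \<le> S n" using S(1)[of n] by (smt (verit) zero_le_power2)
      show "t \<in> {S n..4 * R\<^sup>2}" using Suc.prems(2) \<open>l * \<rho> ^ n > 0\<close> by (auto simp: SS)
    qed (use R M0 Suc in auto)
    moreover have "2 ^ Suc n * M0 \<le> \<kappa> * (t - S n) * (2 ^ n * M0) powr p"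
    proof -
      define X where "X = 2 ^ n * M0"
      have X: "X > 0" using M0 by (simp add: X_def)
      have "\<rho> ^ n = (2 ^ n) powr (1 - p)"
        by (simp add: \<rho>_def powr_powr mult.commute flip: powr_realpow)
      then have "l * \<rho> ^ n = 2 * X powr (1 - p) / \<kappa>" using M0 by (simp add: l_def X_def powr_mult)
      then have "\<kappa> * (l * \<rho> ^ n) * X powr p = 2 * (X powr (1 - p) * X powr p)" using \<kappa> by simp
      also have "\<dots> = 2 * X" using X by (simp flip: powr_add)
      finally have "2 * X = \<kappa> * (l * \<rho> ^ n) * X powr p" by simp
      also have "\<dots> \<le> \<kappa> * (t - S n) * X powr p"
        using Suc.prems(2) \<kappa> by (intro mult_right_mono mult_left_mono) (auto simp: SS)
      finally show ?thesis by (simp add: X_def)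
    qed
    ultimately show ?case by simp
  qed
  define x0 :: "'n pt" where "x0 = (\<chi> i. 2 * R)"
  have "x0 \<in> cube (2 * R)" using R by (simp add: x0_def mem_cube)
  then have le: "2 ^ n * M0 \<le> U x0 (4 * R\<^sup>2)" for n using S(2)[of n] by (intro lower) auto
  obtain n where n: "U x0 (4 * R\<^sup>2) / M0 < 2 ^ n" using real_arch_pow[of 2] by auto
  then show False using le[of n] M0 by (simp add: field_simps)
qed

end

section \<open>From solutions to supersolutions\<close>

lemma space_surface_measure: "space surface_measure = frontier Omega"
  by (simp add: surface_measure_def space_restrict_space)

lemma Omega_sets [measurable]: "(Omega :: 'n::{finite,linorder} pt set) \<in> sets borel"
  unfolding Omega_def by measurable

lemma nn_integral_lebesgue_on_Omega:
  "(\<integral>\<^sup>+ y. f y \<partial>lebesgue_on Omega) = (\<integral>\<^sup>+ y. f y * indicator Omega y \<partial>lborel)"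
  by (subst nn_integral_restrict_space) (auto simp: nn_integral_completion intro!: sets_completionI_sets)

lemma borel_measurable_extend_zero:
  fixes u :: "'n::{finite,linorder} pt \<Rightarrow> real \<Rightarrow> real"
  assumes "continuous_on (closure Omega \<times> {0<..}) (\<lambda>(x, t). u x t)"
  shows "(\<lambda>z. if 0 \<le> fst z $ last_idx \<and> 0 < snd z then u (fst z) (snd z) else 0) \<in> borel_measurable borel"
proof -
  have [measurable]: "closure Omega \<times> {0<..} \<in> sets (borel :: ('n pt \<times> real) measure)"
    unfolding borel_prod[symmetric] by (intro pair_measureI) auto
  have "(\<lambda>z. indicator (closure Omega \<times> {0<..}) z *\<^sub>R (\<lambda>(x, t). u x t) z) \<in> borel_measurable borel"
    by (rule borel_measurable_continuous_on_indicator[OF _ assms]) measurable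
  also have "(\<lambda>z. indicator (closure Omega \<times> {0<..}) z *\<^sub>R (\<lambda>(x, t). u x t) z) =
     (\<lambda>z. if 0 \<le> fst z $ last_idx \<and> 0 < snd z then u (fst z) (snd z) else 0)"
    by (auto simp: fun_eq_iff indicator_def closure_Omega)
  finally show ?thesis .
qed

text \<open>The well-definedness clauses of a solution turn the Bochner integrals of its nonnegative
  source terms into nonnegative integrals of the same value. What remains after discarding the
  nonnegative data term is \<open>super\<close>.\<close>

lemma no_global_positive_solution:
  fixes \<phi> :: "'n::{finite,linorder} data"
  assumes p: "1 < p" "p \<le> 1 + 2 / real CARD('n)" and \<phi>: "initial_data \<phi>"
  shows "\<not> global_positive_solution p \<phi> u"
proof
  assume "global_positive_solution p \<phi> u"
  then have cont: "continuous_on (closure Omega \<times> {0<..}) (\<lambda>(x, t). u x t)"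
    and pos: "\<And>x t. 0 \<le> x $ last_idx \<Longrightarrow> 0 < t \<Longrightarrow> 0 < u x t"
    and def: "\<And>x t s. 0 \<le> x $ last_idx \<Longrightarrow> 0 < s \<Longrightarrow> s < t \<Longrightarrow> G_op_defined (t - s) (\<lambda>y. u y s powr p, \<lambda>_. 0) x"
    and int: "\<And>x t. 0 \<le> x $ last_idx \<Longrightarrow> 0 < t \<Longrightarrow> set_integrable lborel {0<..<t} (\<lambda>s. G_op (t - s) (\<lambda>y. u y s powr p, \<lambda>_. 0) x)"
    and eq: "\<And>x t. 0 \<le> x $ last_idx \<Longrightarrow> 0 < t \<Longrightarrow> u x t = G_op t \<phi> x
                + (LINT s:{0<..<t}|lborel. G_op (t - s) (\<lambda>y. u y s powr p, \<lambda>_. 0) x)"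
    unfolding global_positive_solution_def global_solution_def SH_solution_def
    by (auto simp: closure_Omega greaterThan_def)
  define U where "U x t = (if 0 \<le> x $ last_idx \<and> 0 < t then u x t else 0)" for x t
  have "positive_supersolution U p"
  proof
    show "1 < p" "p \<le> 1 + 2 / real CARD('n)" by fact+
    show "(\<lambda>z. U (fst z) (snd z)) \<in> borel_measurable borel"
      unfolding U_def by (rule borel_measurable_extend_zero[OF cont])
    show "0 < U x t" if "0 \<le> x $ last_idx" "0 < t" for x t
      using that pos by (simp add: U_def)
    fix x :: "'n pt" and t :: real
    assume x: "0 \<le> x $ last_idx" and t: "0 < t"
    define g where "g s = G_op (t - s) (\<lambda>y. u y s powr p, \<lambda>_. 0) x" for s
    have Omega: "0 \<le> y $ last_idx" if "y \<in> Omega" for y :: "'n pt" using that by (simp add: Omega_def)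
    have g: "(\<integral>\<^sup>+ y. ennreal (G0 x y (t - s) * U y s powr p) * indicator Omega y \<partial>lborel) = ennreal (g s)" "0 \<le> g s"
      if s: "0 < s" "s < t" for s
    proof -
      have nn: "0 \<le> G_kernel x y (t - s) * u y s powr p" if "y \<in> Omega" for y
        using Omega[OF that] x s by (simp add: G_kernel_nonneg)
      have "ennreal (g s) = (\<integral>\<^sup>+ y. ennreal (G_kernel x y (t - s) * u y s powr p) \<partial>lebesgue_on Omega)"
        using def[OF x s] nn unfolding g_def G_op_def G_op_defined_def
        by (subst nn_integral_eq_integral) (auto intro!: AE_I2)
      also have "\<dots> = (\<integral>\<^sup>+ y. ennreal (G0 x y (t - s) * U y s powr p) * indicator Omega y \<partial>lborel)"
        unfolding nn_integral_lebesgue_on_Omega using x s Omega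
        by (intro nn_integral_cong) (auto simp: G0_def U_def indicator_def)
      finally show "(\<integral>\<^sup>+ y. ennreal (G0 x y (t - s) * U y s powr p) * indicator Omega y \<partial>lborel) = ennreal (g s)" ..
      show "0 \<le> g s"
        unfolding g_def G_op_def using nn by (auto intro!: Bochner_Integration.integral_nonneg)
    qed
    have "(\<integral>\<^sup>+ s. (\<integral>\<^sup>+ y. ennreal (G0 x y (t - s) * U y s powr p) * indicator Omega y \<partial>lborel) * indicator {0<..<t} s \<partial>lborel)
      = (\<integral>\<^sup>+ s. ennreal (indicator {0<..<t} s *\<^sub>R g s) \<partial>lborel)"
      using g by (intro nn_integral_cong) (auto simp: indicator_def)
    also have "\<dots> = ennreal (LINT s:{0<..<t}|lborel. g s)"
      unfolding set_lebesgue_integral_def using int[OF x t] g(2)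
      by (intro nn_integral_eq_integral) (auto simp: set_integrable_def g_def indicator_def)
    also have "\<dots> \<le> ennreal (U x t)"
    proof (rule ennreal_leI)
      have "0 \<le> G_op t \<phi> x"
        unfolding G_op_def using \<phi> x t Omega
        by (intro add_nonneg_nonneg Bochner_Integration.integral_nonneg)
          (auto simp: initial_data_def space_surface_measure frontier_Omega G_kernel_nonneg intro!: mult_nonneg_nonneg)
      then show "(LINT s:{0<..<t}|lborel. g s) \<le> U x t" using eq[OF x t] x t by (simp add: U_def g_def)
    qed
    finally show "(\<integral>\<^sup>+ s. (\<integral>\<^sup>+ y. ennreal (G0 x y (t - s) * U y s powr p) * indicator Omega y \<partial>lborel) * indicator {0<..<t} s \<partial>lborel)
      \<le> ennreal (U x t)" .
  qed
  then show False by (rule positive_supersolution.no_positive_supersolution)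
qed

section \<open>The linear evolution\<close>

lemma G0_nonneg: "0 \<le> G0 x y t"
  by (simp add: G0_def G_kernel_nonneg)

lemma G0_commute: "G0 x y t = G0 y x t"
  by (auto simp: G0_def G_kernel_commute[of x y])

lemma G0_le:
  "\<exists>C>0. \<forall>(x :: 'n::{finite,linorder} pt) y t. 0 < t \<longrightarrow>
     G0 x y t \<le> C * (t powr (- real CARD('n) / 2) + t powr (- real CARD('n)))"
proof -
  obtain C where C: "C > 0" "\<And>(x :: 'n pt) y t. 0 \<le> x $ last_idx \<Longrightarrow> 0 \<le> y $ last_idx \<Longrightarrow> 0 < t \<Longrightarrow>
     G_kernel x y t \<le> C * (t powr (- real CARD('n) / 2) + t powr (- real CARD('n)))"
    using G_kernel_le[where 'n='n] by blast
  then have "G0 x y t \<le> C * (t powr (- real CARD('n) / 2) + t powr (- real CARD('n)))" if "0 < t" for x y :: "'n pt" and t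
    using that by (auto simp: G0_def)
  then show ?thesis using C(1) by blast
qed

definition lin_int :: "'n::{finite,linorder} pt measure \<Rightarrow> ('n pt \<Rightarrow> real) \<Rightarrow> 'n pt \<Rightarrow> real \<Rightarrow> ennreal" where
  "lin_int M f x t = (\<integral>\<^sup>+ y. ennreal (G0 x y t * f y) \<partial>M)"

text \<open>The common features of Lebesgue measure on \<open>Omega\<close> and of the surface
  measure, so that interior data, boundary data and the time slices of the source share one theory.
  \<open>borel_id\<close> is an assumption because the sigma-algebras are completed: they contain
  the Borel sets, but f may be measurable only for the completion.\<close>

locale half_space_data =
  fixes M :: "'n::{finite,linorder} pt measure" and f :: "'n pt \<Rightarrow> real" and l :: real
  assumes borel_id: "(\<lambda>y. y) \<in> M \<rightarrow>\<^sub>M borel"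
    and mass: "\<And>x t. (\<integral>\<^sup>+ y. ennreal (G0 x y t) \<partial>M) \<le> ennreal 5"
    and space_M: "\<And>y. y \<in> space M \<Longrightarrow> 0 \<le> y $ last_idx"
    and f_meas [measurable]: "f \<in> borel_measurable M"
    and f_nonneg: "\<And>y. y \<in> space M \<Longrightarrow> 0 \<le> f y"
    and l_nonneg: "0 \<le> l"
    and f_int: "(\<integral>\<^sup>+ y. ennreal (f y) \<partial>M) \<le> ennreal l"
begin

lemma borel_measurable_M: "g \<in> (borel :: 'n pt measure) \<rightarrow>\<^sub>M N \<Longrightarrow> g \<in> M \<rightarrow>\<^sub>M N"
  by (drule measurable_compose[OF borel_id]) simp

lemma G0_measurable_M [measurable]: "(\<lambda>y. G0 x y t) \<in> borel_measurable M"
  by (rule borel_measurable_M) measurable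

lemma lin_int_eq: "lin_int M f x t = (\<integral>\<^sup>+ y. ennreal (f y) * ennreal (G0 x y t) \<partial>M)"
  unfolding lin_int_def using f_nonneg by (intro nn_integral_cong) (simp add: ennreal_mult G0_nonneg mult.commute)

lemma lin_int_le_sup:
  assumes "AE y in M. f y \<le> m" "0 \<le> m"
  shows "lin_int M f x t \<le> ennreal (5 * m)"
proof -
  have "lin_int M f x t \<le> (\<integral>\<^sup>+ y. ennreal m * ennreal (G0 x y t) \<partial>M)"
    unfolding lin_int_eq
    by (rule nn_integral_mono_AE) (use assms in \<open>auto elim!: eventually_mono intro!: mult_right_mono ennreal_leI\<close>)
  also have "\<dots> = ennreal m * (\<integral>\<^sup>+ y. ennreal (G0 x y t) \<partial>M)"
    by (rule nn_integral_cmult) measurable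
  also have "\<dots> \<le> ennreal m * ennreal 5" by (rule mult_left_mono[OF mass]) simp
  also have "\<dots> = ennreal (5 * m)" using assms by (subst ennreal_mult[symmetric]) (auto simp: mult.commute)
  finally show ?thesis .
qed

lemma lin_int_le_L1:
  assumes "\<And>y. G0 x y t \<le> B" "0 \<le> B"
  shows "lin_int M f x t \<le> ennreal (B * l)"
proof -
  have "lin_int M f x t \<le> (\<integral>\<^sup>+ y. ennreal B * ennreal (f y) \<partial>M)"
    unfolding lin_int_eq mult.commute[of "ennreal (f _)"] using assms by (intro nn_integral_mono mult_right_mono ennreal_leI) auto
  also have "\<dots> = ennreal B * (\<integral>\<^sup>+ y. ennreal (f y) \<partial>M)"
    by (rule nn_integral_cmult) measurable
  also have "\<dots> \<le> ennreal B * ennreal l" by (rule mult_left_mono[OF f_int]) simp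
  finally show ?thesis using assms l_nonneg by (simp flip: ennreal_mult)
qed

text \<open>Joint measurability and Tonelli call for a sigma-finite measure. The density f dM is
  even finite by the L1 bound and takes over that role from M.\<close>

lemma finite_density: "finite_measure (density M (\<lambda>y. ennreal (f y)))"
proof
  show "emeasure (density M (\<lambda>y. ennreal (f y))) (space (density M (\<lambda>y. ennreal (f y)))) \<noteq> \<infinity>"
    using f_int by (auto simp: emeasure_density cong: nn_integral_cong) (simp add: top_unique cong: nn_integral_cong_simp)
qed

lemma lin_int_density: "lin_int M f x t = (\<integral>\<^sup>+ y. ennreal (G0 x y t) \<partial>density M (\<lambda>y. ennreal (f y)))"
  by (simp add: lin_int_eq nn_integral_density)

lemma borel_id_density: "(\<lambda>y. y) \<in> density M (\<lambda>y. ennreal (f y)) \<rightarrow>\<^sub>M borel"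
  using borel_id by simp

lemma lin_int_measurable [measurable]:
  assumes [measurable]: "g \<in> N \<rightarrow>\<^sub>M borel" "h \<in> N \<rightarrow>\<^sub>M borel"
  shows "(\<lambda>w. lin_int M f (g w) (h w)) \<in> borel_measurable N"
proof -
  interpret finite_measure "density M (\<lambda>y. ennreal (f y))" by (rule finite_density)
  note borel_id_density [measurable]
  show ?thesis unfolding lin_int_density by measurable
qed

text \<open>Tonelli moves the integration over x onto the kernel, and symmetry makes the mass bound
  applicable to its first argument.\<close>

lemma lin_int_L1:
  "(\<integral>\<^sup>+ x. lin_int M f x t * indicator Omega x \<partial>lborel) \<le> ennreal (5 * l)"
proof -
  let ?\<nu> = "density M (\<lambda>y. ennreal (f y))"
  interpret finite_measure ?\<nu> by (rule finite_density)
  interpret pair_sigma_finite "lborel :: 'n pt measure" ?\<nu> by standard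
  note borel_id_density [measurable]
  have "(\<integral>\<^sup>+ x. lin_int M f x t * indicator Omega x \<partial>lborel) =
     (\<integral>\<^sup>+ x. \<integral>\<^sup>+ y. ennreal (G0 x y t) * indicator Omega x \<partial>?\<nu> \<partial>lborel)"
    unfolding lin_int_density by (intro nn_integral_cong nn_integral_multc[symmetric]) measurable
  also have "\<dots> = (\<integral>\<^sup>+ y. \<integral>\<^sup>+ x. ennreal (G0 x y t) * indicator Omega x \<partial>lborel \<partial>?\<nu>)"
    by (rule Fubini'[symmetric]) measurable
  also have "\<dots> \<le> (\<integral>\<^sup>+ y. ennreal 5 \<partial>?\<nu>)"
    by (intro nn_integral_mono) (simp add: G0_commute[of _ _ t] nn_integral_G0_Omega_le del: ennreal_numeral)
  also have "\<dots> = (\<integral>\<^sup>+ y. ennreal (f y) * ennreal 5 \<partial>M)"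
    by (rule nn_integral_density) measurable
  also have "\<dots> = (\<integral>\<^sup>+ y. ennreal (f y) \<partial>M) * ennreal 5"
    by (rule nn_integral_multc) measurable
  also have "\<dots> \<le> ennreal l * ennreal 5" by (rule mult_right_mono[OF f_int]) simp
  also have "\<dots> = ennreal (5 * l)" using l_nonneg by (simp add: mult.commute ennreal_mult)
  finally show ?thesis .
qed

lemma lin_int_tendsto:
  assumes "X \<longlonglongrightarrow> x" "T \<longlonglongrightarrow> t" "0 < t" "\<And>n. 0 \<le> X n $ last_idx"
  shows "(\<lambda>n. lin_int M f (X n) (T n)) \<longlonglongrightarrow> lin_int M f x t"
proof -
  \<comment> \<open>Finitely many \<open>T n\<close> may fail to be positive, as happens for
    \<open>T n - s\<close> in the Duhamel term. Passing to a tail gives times above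
    \<open>t / 2\<close> and with them a uniform kernel bound.\<close>
  have "eventually (\<lambda>n. t / 2 < T n) sequentially" using assms by (intro order_tendstoD(1)[OF assms(2)]) auto
  then obtain k where k: "\<And>n. t / 2 < T (n + k)"
    unfolding eventually_sequentially by (metis le_add2)
  have x: "0 \<le> x $ last_idx"
    by (rule LIMSEQ_le_const[OF tendsto_vec_nth[OF assms(1)]]) (use assms(4) in auto)
  obtain C where C: "C > 0" "\<And>(x :: 'n pt) y t. 0 < t \<Longrightarrow> G0 x y t \<le> C * (t powr (- real CARD('n) / 2) + t powr (- real CARD('n)))"
    using G0_le[where 'n='n] by blast
  define B where "B = C * ((t / 2) powr (- real CARD('n) / 2) + (t / 2) powr (- real CARD('n)))"
  have B: "G0 (X (n + k)) y (T (n + k)) \<le> B" for n y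
  proof -
    have "G0 (X (n + k)) y (T (n + k)) \<le> C * (T (n + k) powr (- real CARD('n) / 2) + T (n + k) powr (- real CARD('n)))"
      using k[of n] assms(3) by (intro C(2)) auto
    also have "\<dots> \<le> B"
      unfolding B_def using k[of n] assms(3) C(1) by (intro mult_left_mono add_mono powr_mono2') auto
    finally show ?thesis .
  qed
  have B0: "0 \<le> B" using C(1) by (simp add: B_def)
  have "(\<lambda>n. lin_int M f (X (n + k)) (T (n + k))) \<longlonglongrightarrow> lin_int M f x t"
    unfolding lin_int_eq
  proof (rule nn_integral_dominated_convergence[where w = "\<lambda>y. ennreal (f y) * ennreal B"])
    show "AE y in M. ennreal (f y) * ennreal (G0 (X (n + k)) y (T (n + k))) \<le> ennreal (f y) * ennreal B" for n
      using B by (intro AE_I2 mult_left_mono ennreal_leI) auto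
    have "(\<integral>\<^sup>+ y. ennreal (f y) * ennreal B \<partial>M) = (\<integral>\<^sup>+ y. ennreal (f y) \<partial>M) * ennreal B"
      by (rule nn_integral_multc) measurable
    also have "\<dots> \<le> ennreal l * ennreal B" by (rule mult_right_mono[OF f_int]) simp
    also have "\<dots> < \<infinity>" by (simp add: ennreal_mult_less_top)
    finally show "(\<integral>\<^sup>+ y. ennreal (f y) * ennreal B \<partial>M) < \<infinity>" .
    show "AE y in M. (\<lambda>n. ennreal (f y) * ennreal (G0 (X (n + k)) y (T (n + k)))) \<longlonglongrightarrow> ennreal (f y) * ennreal (G0 x y t)"
    proof (rule AE_I2)
      fix y assume "y \<in> space M"
      then have y: "0 \<le> y $ last_idx" by (rule space_M)
      have "(\<lambda>n. G_kernel (X (n + k)) y (T (n + k))) \<longlonglongrightarrow> G_kernel x y t"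
      proof (rule G_kernel_tendsto[OF LIMSEQ_ignore_initial_segment[OF assms(1)] tendsto_const LIMSEQ_ignore_initial_segment[OF assms(2)] assms(3,4) y])
        show "0 < T (n + k)" for n using k[of n] assms(3) by auto
      qed
      moreover have "0 < T (n + k)" for n using k[of n] assms(3) by auto
      ultimately have "(\<lambda>n. G0 (X (n + k)) y (T (n + k))) \<longlonglongrightarrow> G0 x y t"
        using x y assms(3,4) by (simp add: G0_def)
      then show "(\<lambda>n. ennreal (f y) * ennreal (G0 (X (n + k)) y (T (n + k)))) \<longlonglongrightarrow> ennreal (f y) * ennreal (G0 x y t)"
        by (intro ennreal_tendsto_cmult) (auto intro: tendsto_ennrealI)
    qed
  qed measurable
  then show ?thesis by (rule LIMSEQ_offset)
qed

lemma lin_int_pos: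
  assumes "0 \<le> x $ last_idx" "0 < t" "\<not> (AE y in M. f y = 0)"
  shows "0 < lin_int M f x t"
proof (rule ccontr)
  assume "\<not> 0 < lin_int M f x t"
  then have "lin_int M f x t = 0" by simp
  then have "AE y in M. ennreal (f y) * ennreal (G0 x y t) = 0"
    unfolding lin_int_eq by (subst (asm) nn_integral_0_iff_AE) auto
  then have "AE y in M. f y = 0"
  proof (rule AE_mp, intro AE_I2 impI)
    fix y assume y: "y \<in> space M" "ennreal (f y) * ennreal (G0 x y t) = 0"
    have "0 < G0 x y t" using space_M[OF y(1)] assms by (simp add: G0_def G_kernel_pos)
    then show "f y = 0" using y f_nonneg[OF y(1)] by (simp add: ennreal_eq_0_iff)
  qed
  then show False using assms(3) by simp
qed

lemma lin_int_finite:
  assumes "0 < t"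
  shows "lin_int M f x t < \<infinity>"
proof -
  obtain C where C: "C > 0" "\<And>(x :: 'n pt) y t. 0 < t \<Longrightarrow> G0 x y t \<le> C * (t powr (- real CARD('n) / 2) + t powr (- real CARD('n)))"
    using G0_le[where 'n='n] by blast
  have "lin_int M f x t \<le> ennreal (C * (t powr (- real CARD('n) / 2) + t powr (- real CARD('n))) * l)"
    using C assms by (intro lin_int_le_L1) auto
  then show ?thesis by (rule le_less_trans) simp
qed

lemma G_kernel_integral:
  assumes "0 \<le> x $ last_idx" "0 < t"
  shows "integrable M (\<lambda>y. G_kernel x y t * f y)"
    and "0 \<le> (LINT y|M. G_kernel x y t * f y)"
    and "ennreal (LINT y|M. G_kernel x y t * f y) = lin_int M f x t"
proof -
  have eq: "G0 x y t = G_kernel x y t" if "y \<in> space M" for y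
    using assms space_M[OF that] by (simp add: G0_def)
  have nn: "0 \<le> G_kernel x y t * f y" if "y \<in> space M" for y
    using eq[OF that] G0_nonneg[of x y t] f_nonneg[OF that] by simp
  have nn_eq: "(\<integral>\<^sup>+ y. ennreal (G_kernel x y t * f y) \<partial>M) = lin_int M f x t"
    unfolding lin_int_def by (intro nn_integral_cong) (simp add: eq)
  have "(\<lambda>y. G0 x y t * f y) \<in> borel_measurable M" by measurable
  then have "(\<lambda>y. G_kernel x y t * f y) \<in> borel_measurable M"
    by (rule measurable_cong[THEN iffD1, rotated]) (simp add: eq)
  then show int: "integrable M (\<lambda>y. G_kernel x y t * f y)"
    using nn_eq lin_int_finite[OF assms(2)] nn by (intro integrableI_nonneg) (auto intro!: AE_I2)
  show "0 \<le> (LINT y|M. G_kernel x y t * f y)" using nn by (intro Bochner_Integration.integral_nonneg) auto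
  show "ennreal (LINT y|M. G_kernel x y t * f y) = lin_int M f x t"
    using nn_integral_eq_integral[OF int] nn nn_eq by (auto intro!: AE_I2)
qed

end

text \<open>For t at least 1 the kernel bound acts on the L1 norm, for smaller t the mass bound acts
  on the sup norm; hence the sum \<open>m + l\<close>. The constant is uniform over all data because
  it is also applied to the sources at all times. In \<open>D\<close>, the 2 C collects both powers
  in the kernel bound, 5 is the mass, and \<open>2 powr (N / 2)\<close> pays for replacing t or 1 by
  1 + t.\<close>

lemma lin_int_decay:
  "\<exists>C>0. \<forall>(M :: 'n::{finite,linorder} pt measure) f l m x t. half_space_data M f l \<longrightarrow> (AE y in M. f y \<le> m) \<longrightarrow> 0 \<le> m \<longrightarrow> 0 < t \<longrightarrow>
     lin_int M f x t \<le> ennreal (C * (1 + t) powr (- real CARD('n) / 2) * (m + l))"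
proof -
  define N where "N = real CARD('n)"
  obtain C where C: "C > 0" "\<And>(x :: 'n pt) y t. 0 < t \<Longrightarrow> G0 x y t \<le> C * (t powr (- N / 2) + t powr (- N))"
    using G0_le[where 'n='n] unfolding N_def by blast
  define D where "D = max (2 * C) 5 * 2 powr (N / 2)"
  have D: "D > 0" using C by (simp add: D_def less_max_iff_disj)
  have "lin_int M f x t \<le> ennreal (D * (1 + t) powr (- N / 2) * (m + l))"
    if "half_space_data M f l" and m: "AE y in M. f y \<le> m" "0 \<le> m" and t: "0 < t"
    for M :: "'n pt measure" and f l m x t
  proof -
    interpret half_space_data M f l by fact
    show ?thesis
    proof (cases "t \<ge> 1")
      case True
      have "lin_int M f x t \<le> ennreal (C * (t powr (- N / 2) + t powr (- N)) * l)"
        using C t by (intro lin_int_le_L1) auto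
      also have "\<dots> \<le> ennreal (D * (1 + t) powr (- N / 2) * (m + l))"
      proof (rule ennreal_leI, rule mult_mono)
        have "t powr (- N) \<le> t powr (- N / 2)" using True by (intro powr_mono) (auto simp: N_def)
        then have "C * (t powr (- N / 2) + t powr (- N)) \<le> 2 * C * t powr (- N / 2)" using C by simp
        also have "\<dots> \<le> max (2 * C) 5 * t powr (- N / 2)" by (intro mult_right_mono) auto
        also have "t powr (- N / 2) \<le> ((1 + t) / 2) powr (- N / 2)"
          using True by (intro powr_mono2') (auto simp: N_def)
        also have "\<dots> = 2 powr (N / 2) * (1 + t) powr (- N / 2)"
          using t by (simp add: powr_divide powr_minus field_simps)
        finally show "C * (t powr (- N / 2) + t powr (- N)) \<le> D * (1 + t) powr (- N / 2)"
          by (simp add: D_def mult.assoc mult_left_mono)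
      qed (use m l_nonneg D in auto)
      finally show ?thesis .
    next
      case False
      have "lin_int M f x t \<le> ennreal (5 * m)" using m by (rule lin_int_le_sup)
      also have "\<dots> \<le> ennreal (D * (1 + t) powr (- N / 2) * (m + l))"
      proof (rule ennreal_leI, rule mult_mono)
        have "1 = 2 powr (N / 2) * 2 powr (- N / 2)" by (simp flip: powr_add)
        also have "\<dots> \<le> 2 powr (N / 2) * (1 + t) powr (- N / 2)"
          using False t by (intro mult_left_mono powr_mono2') (auto simp: N_def)
        finally have "5 * 1 \<le> max (2 * C) 5 * (2 powr (N / 2) * (1 + t) powr (- N / 2))"
          by (intro mult_mono) auto
        then show "5 \<le> D * (1 + t) powr (- N / 2)" by (simp add: D_def mult.assoc)
      qed (use m l_nonneg D in auto)
      finally show ?thesis .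
    qed
  qed
  then show ?thesis using D by (auto simp: N_def)
qed

lemma half_space_data_Omega:
  fixes f :: "'n::{finite,linorder} pt \<Rightarrow> real"
  assumes "f \<in> borel_measurable (lebesgue_on Omega)" "\<And>y. y \<in> Omega \<Longrightarrow> 0 \<le> f y"
    "(\<integral>\<^sup>+ y. ennreal (f y) \<partial>lebesgue_on Omega) \<le> ennreal l" "0 \<le> l"
  shows "half_space_data (lebesgue_on Omega) f l"
proof
  show "(\<lambda>y. y) \<in> lebesgue_on Omega \<rightarrow>\<^sub>M borel"
    by (intro measurable_restrict_space1 measurable_completion) simp
  show "(\<integral>\<^sup>+ y. ennreal (G0 x y t) \<partial>lebesgue_on Omega) \<le> ennreal 5" for x :: "'n pt" and t
    unfolding nn_integral_lebesgue_on_Omega by (rule nn_integral_G0_Omega_le)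
qed (use assms in \<open>auto simp: Omega_def\<close>)

lemma half_space_data_surface:
  fixes f :: "'n::{finite,linorder} pt \<Rightarrow> real"
  assumes "f \<in> borel_measurable surface_measure" "\<And>y. y \<in> frontier Omega \<Longrightarrow> 0 \<le> f y"
    "(\<integral>\<^sup>+ y. ennreal (f y) \<partial>surface_measure) \<le> ennreal l" "0 \<le> l"
  shows "half_space_data surface_measure f l"
proof
  show "(\<lambda>y. y) \<in> surface_measure \<rightarrow>\<^sub>M (borel :: 'n pt measure)"
    unfolding surface_measure_def by (intro measurable_restrict_space1 measurable_completion) simp
  show "(\<integral>\<^sup>+ y. ennreal (G0 x y t) \<partial>surface_measure) \<le> ennreal 5" for x :: "'n pt" and t
    by (rule nn_integral_G0_surface_le)
qed (use assms in \<open>auto simp: space_surface_measure frontier_Omega\<close>)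

section \<open>The Duhamel term\<close>

definition duhamel_inner :: "real \<Rightarrow> ('n::{finite,linorder} pt \<Rightarrow> real \<Rightarrow> real) \<Rightarrow> 'n pt \<Rightarrow> real \<Rightarrow> real \<Rightarrow> ennreal" where
  "duhamel_inner p W x t s = (\<integral>\<^sup>+ y. ennreal (G0 x y (t - s) * W y s powr p) * indicator Omega y \<partial>lborel)"

definition duhamel :: "real \<Rightarrow> ('n::{finite,linorder} pt \<Rightarrow> real \<Rightarrow> real) \<Rightarrow> 'n pt \<Rightarrow> real \<Rightarrow> ennreal" where
  "duhamel p W x t = (\<integral>\<^sup>+ s. duhamel_inner p W x t s * indicator {0<..<t} s \<partial>lborel)"

text \<open>The invariant class of the iteration. Only measurability is demanded, because monotone
  limits preserve it; continuity is recovered afterwards from the integral equation.\<close>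

definition decaying :: "real \<Rightarrow> ('n::{finite,linorder} pt \<Rightarrow> real \<Rightarrow> real) \<Rightarrow> bool" where
  "decaying M W \<longleftrightarrow> (\<lambda>z. W (fst z) (snd z)) \<in> borel_measurable borel \<and>
     (\<forall>x t. 0 < t \<longrightarrow> 0 \<le> W x t \<and> W x t \<le> M * (1 + t) powr (- real CARD('n) / 2)) \<and>
     (\<forall>t>0. (\<integral>\<^sup>+ x. ennreal (W x t) * indicator Omega x \<partial>lborel) \<le> ennreal M)"

lemma decaying_measurable:
  fixes W :: "'n::{finite,linorder} pt \<Rightarrow> real \<Rightarrow> real"
  assumes "decaying M W" and [measurable]: "f \<in> N \<rightarrow>\<^sub>M borel" "g \<in> N \<rightarrow>\<^sub>M borel"
  shows "(\<lambda>w. W (f w) (g w)) \<in> borel_measurable N"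
proof -
  have "(\<lambda>z. W (fst z) (snd z)) \<in> borel_measurable borel" using assms(1) by (simp add: decaying_def)
  moreover have "(\<lambda>w. (f w, g w)) \<in> N \<rightarrow>\<^sub>M borel" by measurable
  ultimately show ?thesis using measurable_compose[of "\<lambda>w. (f w, g w)" N borel "\<lambda>z. W (fst z) (snd z)"] by simp
qed

lemma duhamel_inner_lin_int:
  "duhamel_inner p W x t s = lin_int (lebesgue_on Omega) (\<lambda>y. W y s powr p) x (t - s)"
  by (simp add: duhamel_inner_def lin_int_def nn_integral_lebesgue_on_Omega)

lemma duhamel_inner_measurable:
  assumes "decaying M W" and [measurable]: "f \<in> N \<rightarrow>\<^sub>M borel" "g \<in> N \<rightarrow>\<^sub>M borel" "h \<in> N \<rightarrow>\<^sub>M borel"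
  shows "(\<lambda>w. duhamel_inner p W (f w) (g w) (h w)) \<in> borel_measurable N"
proof -
  note decaying_measurable[OF assms(1), measurable]
  show ?thesis unfolding duhamel_inner_def by measurable
qed

lemma duhamel_measurable:
  assumes "decaying M W" and [measurable]: "f \<in> N \<rightarrow>\<^sub>M borel" "g \<in> N \<rightarrow>\<^sub>M borel"
  shows "(\<lambda>w. duhamel p W (f w) (g w)) \<in> borel_measurable N"
proof -
  note duhamel_inner_measurable[OF assms(1), measurable]
  have [measurable]: "Measurable.pred (N \<Otimes>\<^sub>M borel) (\<lambda>x. snd x \<in> {0<..<g (fst x)})"
    unfolding greaterThanLessThan_iff by measurable
  show ?thesis unfolding duhamel_def by measurable
qed

lemma duhamel_mono:
  assumes "\<And>y s. 0 < s \<Longrightarrow> 0 \<le> W y s \<and> W y s \<le> W' y s" "0 \<le> p"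
  shows "duhamel p W x t \<le> duhamel p W' x t"
  unfolding duhamel_def duhamel_inner_def
proof (intro nn_integral_mono)
  fix s
  show "(\<integral>\<^sup>+ y. ennreal (G0 x y (t - s) * W y s powr p) * indicator Omega y \<partial>lborel) * indicator {0<..<t} s
      \<le> (\<integral>\<^sup>+ y. ennreal (G0 x y (t - s) * W' y s powr p) * indicator Omega y \<partial>lborel) * indicator {0<..<t} s"
    by (cases "s \<in> {0<..<t}")
       (use assms in \<open>auto intro!: nn_integral_mono mult_right_mono mult_left_mono ennreal_leI powr_mono2 simp: G0_nonneg\<close>)
qed

text \<open>Monotone convergence for the inner and then the outer integral. Positivity of p makes
  the power continuous also where the limit is 0.\<close>

lemma duhamel_LIMSEQ:
  fixes W :: "nat \<Rightarrow> 'n::{finite,linorder} pt \<Rightarrow> real \<Rightarrow> real"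
  assumes dec: "\<And>k. decaying M (W k)"
    and mono: "\<And>k y s. 0 < s \<Longrightarrow> W k y s \<le> W (Suc k) y s"
    and lim: "\<And>y s. 0 < s \<Longrightarrow> (\<lambda>k. W k y s) \<longlonglongrightarrow> W' y s"
    and p: "0 < p"
  shows "(\<lambda>k. duhamel p (W k) x t) \<longlonglongrightarrow> duhamel p W' x t"
proof -
  have nn: "0 \<le> W k y s" if "0 < s" for k y s using dec[of k] that by (simp add: decaying_def)
  have mono': "W j y s \<le> W k y s" if "j \<le> k" "0 < s" for j k y s
    using that(1) by (rule lift_Suc_mono_le[rotated]) (rule mono[OF that(2)])
  note [measurable] = decaying_measurable[OF dec] duhamel_inner_measurable[OF dec]
  have inner: "(\<lambda>k. duhamel_inner p (W k) x t s) \<longlonglongrightarrow> duhamel_inner p W' x t s" if s: "0 < s" for s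
    unfolding duhamel_inner_def
  proof (rule nn_integral_LIMSEQ)
    show "incseq (\<lambda>k y. ennreal (G0 x y (t - s) * W k y s powr p) * indicator Omega y)"
      using s nn mono' p by (auto simp: incseq_def le_fun_def G0_nonneg intro!: mult_right_mono mult_left_mono ennreal_leI powr_mono2)
    show "(\<lambda>k. ennreal (G0 x y (t - s) * W k y s powr p) * indicator Omega y) \<longlonglongrightarrow> ennreal (G0 x y (t - s) * W' y s powr p) * indicator Omega y" for y
      using lim[OF s, of y] nn[OF s] p
      by (cases "y \<in> Omega") (auto intro!: tendsto_ennrealI tendsto_mult tendsto_const tendsto_powr2 always_eventually)
  qed measurable
  show ?thesis
    unfolding duhamel_def
  proof (rule nn_integral_LIMSEQ)
    show "incseq (\<lambda>k s. duhamel_inner p (W k) x t s * indicator {0<..<t} s)"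
      using nn mono' p unfolding duhamel_inner_def
      by (auto simp: incseq_def le_fun_def indicator_def G0_nonneg intro!: nn_integral_mono mult_left_mono ennreal_leI powr_mono2)
    show "(\<lambda>k. duhamel_inner p (W k) x t s * indicator {0<..<t} s) \<longlonglongrightarrow> duhamel_inner p W' x t s * indicator {0<..<t} s" for s
      using inner[of s] by (cases "s \<in> {0<..<t}") auto
  qed measurable
qed

lemma nn_integral_powr_tail:
  assumes "1 < a"
  shows "(\<integral>\<^sup>+ s. ennreal ((1 + s) powr (- a)) * indicator {0<..} s \<partial>lborel) = ennreal (1 / (a - 1))"
proof -
  have "(\<integral>\<^sup>+ s. ennreal ((1 + s) powr (- a)) * indicator {0<..} s \<partial>lborel) =
     (\<integral>\<^sup>+ s. ennreal ((1 + s) powr (- a)) * indicator {0..} s \<partial>lborel)"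
    by (rule nn_integral_cong_AE, rule AE_mp[OF AE_lborel_singleton[of 0]])
       (auto intro!: AE_I2 simp: indicator_def)
  also have "\<dots> = ennreal (0 - (- 1 / (a - 1) * (1 + 0) powr (1 - a)))"
  proof (rule nn_integral_FTC_atLeast)
    show "DERIV (\<lambda>s. - 1 / (a - 1) * (1 + s) powr (1 - a)) s :> (1 + s) powr (- a)" if "0 \<le> s" for s
    proof -
      have "DERIV (\<lambda>s. (1 + s) powr (1 - a)) s :> (1 - a) * (1 + s) powr (- a)"
        using that by (auto intro!: derivative_eq_intros)
      from DERIV_cmult[OF this, of "- 1 / (a - 1)"] show ?thesis
        by (rule DERIV_cong) (use assms in \<open>simp add: field_simps\<close>)
    qed
    have "((\<lambda>s. (1 + s) powr (1 - a)) \<longlongrightarrow> 0) at_top" using assms by real_asymp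
    from tendsto_mult_left[OF this, of "- 1 / (a - 1)"]
    show "((\<lambda>s. - 1 / (a - 1) * (1 + s) powr (1 - a)) \<longlongrightarrow> 0) at_top" by simp
  qed auto
  finally show ?thesis by simp
qed

section \<open>Decay of the source and of the Duhamel term\<close>

context
  fixes W :: "'n::{finite,linorder} pt \<Rightarrow> real \<Rightarrow> real" and M p :: real
  assumes W: "decaying M W" and p: "1 < p" and M: "0 \<le> M"
begin

text \<open>Write \<open>W powr p\<close> as \<open>W powr (p - 1) * W\<close>. The sup bound on the
  first factor yields the decay exponent N (p - 1) / 2, and the L1 bound on the second yields the
  remaining M.\<close>

lemma half_space_data_source:
  assumes s: "0 < s"
  shows "half_space_data (lebesgue_on Omega) (\<lambda>y. W y s powr p)
    (M powr p * (1 + s) powr (- real CARD('n) / 2 * (p - 1)))"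
proof (rule half_space_data_Omega)
  let ?q = "real CARD('n) / 2"
  note [measurable] = decaying_measurable[OF W]
  have "(\<lambda>y. W y s powr p) \<in> borel_measurable borel" by measurable
  then show "(\<lambda>y. W y s powr p) \<in> borel_measurable (lebesgue_on Omega)"
    by (intro measurable_restrict_space1 measurable_completion) simp
  have W': "0 \<le> W y s" "W y s \<le> M * (1 + s) powr (- ?q)" for y using W s by (auto simp: decaying_def)
  have "(\<integral>\<^sup>+ y. ennreal (W y s powr p) \<partial>lebesgue_on Omega)
     \<le> (\<integral>\<^sup>+ y. ennreal ((M * (1 + s) powr (- ?q)) powr (p - 1)) * (ennreal (W y s) * indicator Omega y) \<partial>lborel)"
    unfolding nn_integral_lebesgue_on_Omega mult.assoc[symmetric]
  proof (intro nn_integral_mono mult_right_mono)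
    fix y
    have "W y s powr p = W y s powr (p - 1) * W y s"
      using W'(1)[of y] by (cases "W y s = 0") (auto simp: powr_diff)
    also have "\<dots> \<le> (M * (1 + s) powr (- ?q)) powr (p - 1) * W y s"
      using W'[of y] p by (intro mult_right_mono powr_mono2) auto
    finally show "ennreal (W y s powr p) \<le> ennreal ((M * (1 + s) powr (- ?q)) powr (p - 1)) * ennreal (W y s)"
      using W'(1) by (simp add: ennreal_leI flip: ennreal_mult)
  qed simp
  also have "\<dots> = ennreal ((M * (1 + s) powr (- ?q)) powr (p - 1)) * (\<integral>\<^sup>+ y. ennreal (W y s) * indicator Omega y \<partial>lborel)"
    by (rule nn_integral_cmult) measurable
  also have "\<dots> \<le> ennreal ((M * (1 + s) powr (- ?q)) powr (p - 1)) * ennreal M"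
    using W s by (intro mult_left_mono) (auto simp: decaying_def)
  also have "\<dots> = ennreal (M powr p * (1 + s) powr (- ?q * (p - 1)))"
  proof -
    have "M powr (p - 1) * M = M powr p" using M by (cases "M = 0") (auto simp: powr_diff)
    then show ?thesis using M s by (simp add: powr_mult powr_powr mult_ac flip: ennreal_mult)
  qed
  finally show "(\<integral>\<^sup>+ y. ennreal (W y s powr p) \<partial>lebesgue_on Omega) \<le> ennreal (M powr p * (1 + s) powr (- real CARD('n) / 2 * (p - 1)))"
    by simp
qed (use s in auto)

lemma source_sup_le:
  assumes "0 < s"
  shows "W y s powr p \<le> M powr p * (1 + s) powr (- real CARD('n) / 2 * (p - 1)) * (1 + s) powr (- real CARD('n) / 2)"
proof -
  have "W y s powr p \<le> (M * (1 + s) powr (- real CARD('n) / 2)) powr p"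
    using W assms p by (intro powr_mono2) (auto simp: decaying_def)
  also have "\<dots> = M powr p * (1 + s) powr (- real CARD('n) / 2 * p)"
    using M assms by (simp add: powr_mult powr_powr)
  also have "- real CARD('n) / 2 * p = - real CARD('n) / 2 * (p - 1) + - real CARD('n) / 2" by (simp add: field_simps)
  finally show ?thesis by (simp only: powr_add mult.assoc)
qed

end

text \<open>Both halves of the time interval give the full decay in t. For
  \<open>s \<le> t / 2\<close> the elapsed time \<open>t - s\<close> is at least
  \<open>t / 2\<close> and the linear evolution decays. For later s the source itself carries an
  additional \<open>(1 + s) powr (- N / 2)\<close> in sup norm, and the bounded mass of the kernel
  preserves it.\<close>

lemma duhamel_inner_decay:
  "\<exists>K>0. \<forall>(W :: 'n::{finite,linorder} pt \<Rightarrow> real \<Rightarrow> real) M p x t s. decaying M W \<longrightarrow> 1 < p \<longrightarrow> 0 \<le> M \<longrightarrow> 0 < s \<longrightarrow> s < t \<longrightarrow>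
     duhamel_inner p W x t s \<le> ennreal (K * M powr p * (1 + t) powr (- real CARD('n) / 2) * (1 + s) powr (- real CARD('n) / 2 * (p - 1)))"
proof -
  define q where "q = real CARD('n) / 2"
  obtain C where C: "C > 0" "\<And>(M :: 'n pt measure) f l m x t. half_space_data M f l \<Longrightarrow> (AE y in M. f y \<le> m) \<Longrightarrow> 0 \<le> m \<Longrightarrow> 0 < t \<Longrightarrow>
     lin_int M f x t \<le> ennreal (C * (1 + t) powr (- q) * (m + l))"
    using lin_int_decay[where 'n='n] unfolding q_def minus_divide_left by blast
  define K where "K = max (2 * C) 5 * 2 powr q"
  have K: "K > 0" using C by (simp add: K_def less_max_iff_disj)
  have q: "q > 0" by (simp add: q_def)
  have half: "y powr (- q) \<le> 2 powr q * (1 + t) powr (- q)" if "(1 + t) / 2 \<le> y" "0 < t" for y t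
  proof -
    have "y powr (- q) \<le> ((1 + t) / 2) powr (- q)" using that q by (intro powr_mono2') auto
    also have "\<dots> = 2 powr q * (1 + t) powr (- q)" using that by (simp add: powr_divide powr_minus field_simps)
    finally show ?thesis .
  qed
  have "duhamel_inner p W x t s \<le> ennreal (K * M powr p * (1 + t) powr (- q) * (1 + s) powr (- q * (p - 1)))"
    if W: "decaying M W" and p: "1 < p" and M: "0 \<le> M" and s: "0 < s" "s < t"
    for W :: "'n pt \<Rightarrow> real \<Rightarrow> real" and M p x t s
  proof -
    define m where "m = M powr p * (1 + s) powr (- q * (p - 1))"
    have m: "0 \<le> m" by (simp add: m_def)
    have data: "half_space_data (lebesgue_on Omega) (\<lambda>y. W y s powr p) m"
      using half_space_data_source[OF W p M s(1)] by (simp add: m_def q_def)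
    interpret half_space_data "lebesgue_on Omega" "\<lambda>y. W y s powr p" m by (rule data)
    have sup: "W y s powr p \<le> m * (1 + s) powr (- q)" for y
      using source_sup_le[OF W p M s(1), of y] by (simp add: m_def q_def)
    have "lin_int (lebesgue_on Omega) (\<lambda>y. W y s powr p) x (t - s) \<le> ennreal (K * (1 + t) powr (- q) * m)"
    proof (cases "s \<le> t / 2")
      case True
      have "m * (1 + s) powr (- q) \<le> m * (1 + s) powr 0" using m s q by (intro mult_left_mono powr_mono) auto
      then have "AE y in lebesgue_on Omega. W y s powr p \<le> m" using sup s by (auto intro!: AE_I2 intro: order_trans)
      then have "lin_int (lebesgue_on Omega) (\<lambda>y. W y s powr p) x (t - s) \<le> ennreal (C * (1 + (t - s)) powr (- q) * (m + m))"
        using s m by (intro C(2) data) auto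
      also have "\<dots> \<le> ennreal (K * (1 + t) powr (- q) * m)"
      proof (rule ennreal_leI)
        have "C * (1 + (t - s)) powr (- q) * (m + m) = (2 * C) * ((1 + (t - s)) powr (- q)) * m" by (simp add: algebra_simps)
        also have "\<dots> \<le> max (2 * C) 5 * (2 powr q * (1 + t) powr (- q)) * m"
          using m s True C by (intro mult_right_mono mult_mono half) auto
        finally show "C * (1 + (t - s)) powr (- q) * (m + m) \<le> K * (1 + t) powr (- q) * m" by (simp add: K_def mult_ac)
      qed
      finally show ?thesis .
    next
      case False
      have "lin_int (lebesgue_on Omega) (\<lambda>y. W y s powr p) x (t - s) \<le> ennreal (5 * (m * (1 + s) powr (- q)))"
        using sup m by (intro lin_int_le_sup) auto
      also have "\<dots> \<le> ennreal (K * (1 + t) powr (- q) * m)"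
      proof (rule ennreal_leI)
        have "5 * (m * (1 + s) powr (- q)) = 5 * ((1 + s) powr (- q)) * m" by simp
        also have "\<dots> \<le> max (2 * C) 5 * (2 powr q * (1 + t) powr (- q)) * m"
          using m s False C by (intro mult_right_mono mult_mono half) auto
        finally show "5 * (m * (1 + s) powr (- q)) \<le> K * (1 + t) powr (- q) * m" by (simp add: K_def mult_ac)
      qed
      finally show ?thesis .
    qed
    then show ?thesis by (simp add: duhamel_inner_lin_int m_def mult_ac)
  qed
  then show ?thesis using K unfolding q_def by (intro exI[of _ K]) auto
qed

text \<open>The hypothesis on p says a = N (p - 1) / 2 > 1, so that
  \<open>(1 + s) powr (- a)\<close> has the finite integral \<open>1 / (a - 1)\<close>. In
  \<open>K\<close>, the \<open>K0\<close> serves the pointwise bound and 5 the L1 bound. M stays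
  free: it is chosen later in terms of K.\<close>

lemma duhamel_bounds:
  assumes p: "p > 1 + 2 / real CARD('n::{finite,linorder})"
  shows "\<exists>K>0. \<forall>(W :: 'n pt \<Rightarrow> real \<Rightarrow> real) M. decaying M W \<longrightarrow> 0 \<le> M \<longrightarrow>
     (\<forall>x. \<forall>t>0. duhamel p W x t \<le> ennreal (K * M powr p * (1 + t) powr (- real CARD('n) / 2))) \<and>
     (\<forall>t>0. (\<integral>\<^sup>+ x. duhamel p W x t * indicator Omega x \<partial>lborel) \<le> ennreal (K * M powr p)) \<and>
     (\<forall>X T x t. X \<longlonglongrightarrow> x \<longrightarrow> T \<longlonglongrightarrow> t \<longrightarrow> 0 < t \<longrightarrow> (\<forall>n. 0 \<le> X n $ last_idx \<and> 0 < T n) \<longrightarrow>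
        (\<lambda>n. duhamel p W (X n) (T n)) \<longlonglongrightarrow> duhamel p W x t)"
proof -
  define q where "q = real CARD('n) / 2"
  define a where "a = q * (p - 1)"
  have q: "q > 0" by (simp add: q_def)
  have p1: "1 < p" using p by (smt (verit) divide_nonneg_nonneg of_nat_0_le_iff)
  have a: "a > 1" using p by (simp add: a_def q_def field_simps)
  have q1: "- real CARD('n) / 2 = - q" and a1: "- a = - q * (p - 1)" by (simp_all add: q_def a_def)
  obtain K0 where K0: "K0 > 0" "\<And>(W :: 'n pt \<Rightarrow> real \<Rightarrow> real) M x t s. decaying M W \<Longrightarrow> 0 \<le> M \<Longrightarrow> 0 < s \<Longrightarrow> s < t \<Longrightarrow>
     duhamel_inner p W x t s \<le> ennreal (K0 * M powr p * (1 + t) powr (- q) * (1 + s) powr (- a))"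
    using duhamel_inner_decay[where 'n='n] p1 unfolding q1 a1 by blast
  define K where "K = max K0 5 / (a - 1)"
  have K: "K > 0" using a by (simp add: K_def less_max_iff_disj)
  have *: "(\<forall>x. \<forall>t>0. duhamel p W x t \<le> ennreal (K * M powr p * (1 + t) powr (- q))) \<and>
     (\<forall>t>0. (\<integral>\<^sup>+ x. duhamel p W x t * indicator Omega x \<partial>lborel) \<le> ennreal (K * M powr p)) \<and>
     (\<forall>X T x t. X \<longlonglongrightarrow> x \<longrightarrow> T \<longlonglongrightarrow> t \<longrightarrow> 0 < t \<longrightarrow> (\<forall>n. 0 \<le> X n $ last_idx \<and> 0 < T n) \<longrightarrow>
        (\<lambda>n. duhamel p W (X n) (T n)) \<longlonglongrightarrow> duhamel p W x t)"
    if W: "decaying M W" and M: "0 \<le> M" for W :: "'n pt \<Rightarrow> real \<Rightarrow> real" and M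
  proof (intro conjI allI impI)
    note [measurable] = decaying_measurable[OF W] duhamel_inner_measurable[OF W]
    show "duhamel p W x t \<le> ennreal (K * M powr p * (1 + t) powr (- q))" if t: "0 < t" for x t
    proof -
      let ?c = "K0 * M powr p * (1 + t) powr (- q)"
      have "duhamel p W x t \<le> (\<integral>\<^sup>+ s. ennreal ?c * (ennreal ((1 + s) powr (- a)) * indicator {0<..} s) \<partial>lborel)"
        unfolding duhamel_def
      proof (rule nn_integral_mono)
        fix s
        show "duhamel_inner p W x t s * indicator {0<..<t} s \<le> ennreal ?c * (ennreal ((1 + s) powr (- a)) * indicator {0<..} s)"
          using K0(2)[OF W M, of s t x] K0(1) by (cases "s \<in> {0<..<t}") (auto simp: ennreal_mult)
      qed
      also have "\<dots> = ennreal ?c * ennreal (1 / (a - 1))"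
        by (subst nn_integral_cmult) (auto simp: nn_integral_powr_tail[OF a])
      also have "\<dots> = ennreal (?c * (1 / (a - 1)))" using a K0(1) by (intro ennreal_mult[symmetric]) auto
      also have "\<dots> \<le> ennreal (K * M powr p * (1 + t) powr (- q))"
      proof (rule ennreal_leI)
        have "?c * (1 / (a - 1)) = K0 / (a - 1) * (M powr p * (1 + t) powr (- q))" by simp
        also have "\<dots> \<le> K * (M powr p * (1 + t) powr (- q))"
          unfolding K_def using a by (intro mult_right_mono divide_right_mono) auto
        finally show "?c * (1 / (a - 1)) \<le> K * M powr p * (1 + t) powr (- q)" by simp
      qed
      finally show ?thesis .
    qed
    show "(\<integral>\<^sup>+ x. duhamel p W x t * indicator Omega x \<partial>lborel) \<le> ennreal (K * M powr p)" if t: "0 < t" for t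
    proof -
      have "(\<integral>\<^sup>+ x. duhamel p W x t * indicator Omega x \<partial>lborel) =
        (\<integral>\<^sup>+ x. \<integral>\<^sup>+ s. duhamel_inner p W x t s * indicator {0<..<t} s * indicator Omega x \<partial>lborel \<partial>lborel)"
        unfolding duhamel_def by (intro nn_integral_cong nn_integral_multc[symmetric]) measurable
      also have "\<dots> = (\<integral>\<^sup>+ s. \<integral>\<^sup>+ x. duhamel_inner p W x t s * indicator {0<..<t} s * indicator Omega x \<partial>lborel \<partial>lborel)"
        by (rule lborel_pair.Fubini') measurable
      also have "\<dots> \<le> (\<integral>\<^sup>+ s. ennreal (5 * M powr p) * (ennreal ((1 + s) powr (- a)) * indicator {0<..} s) \<partial>lborel)"
      proof (rule nn_integral_mono)
        fix s
        show "(\<integral>\<^sup>+ x. duhamel_inner p W x t s * indicator {0<..<t} s * indicator Omega x \<partial>lborel)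
           \<le> ennreal (5 * M powr p) * (ennreal ((1 + s) powr (- a)) * indicator {0<..} s)"
        proof (cases "s \<in> {0<..<t}")
          case True
          interpret half_space_data "lebesgue_on Omega" "\<lambda>y. W y s powr p" "M powr p * (1 + s) powr (- a)"
            using half_space_data_source[OF W p1 M, of s] True by (simp add: a_def q_def)
          show ?thesis using True lin_int_L1[of "t - s"] by (simp add: duhamel_inner_lin_int mult.assoc flip: ennreal_mult)
        qed simp
      qed
      also have "\<dots> = ennreal (5 * M powr p) * ennreal (1 / (a - 1))"
        by (subst nn_integral_cmult) (auto simp: nn_integral_powr_tail[OF a])
      also have "\<dots> = ennreal (5 * M powr p * (1 / (a - 1)))" using a by (intro ennreal_mult[symmetric]) auto
      also have "\<dots> \<le> ennreal (K * M powr p)"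
      proof (rule ennreal_leI)
        have "5 * M powr p * (1 / (a - 1)) = 5 / (a - 1) * M powr p" by simp
        also have "\<dots> \<le> K * M powr p"
          unfolding K_def using a by (intro mult_right_mono divide_right_mono) auto
        finally show "5 * M powr p * (1 / (a - 1)) \<le> K * M powr p" .
      qed
      finally show ?thesis .
    qed
    show "(\<lambda>n. duhamel p W (X n) (T n)) \<longlonglongrightarrow> duhamel p W x t"
      if X: "X \<longlonglongrightarrow> x" and T: "T \<longlonglongrightarrow> t" and t: "0 < t" and nn: "\<forall>n. 0 \<le> X n $ last_idx \<and> 0 < T n" for X T x t
      unfolding duhamel_def
    proof (rule nn_integral_dominated_convergence[where w = "\<lambda>s. ennreal (K0 * M powr p) * (ennreal ((1 + s) powr (- a)) * indicator {0<..} s)"])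
      show "AE s in lborel. duhamel_inner p W (X n) (T n) s * indicator {0<..<T n} s
         \<le> ennreal (K0 * M powr p) * (ennreal ((1 + s) powr (- a)) * indicator {0<..} s)" for n
      proof (rule AE_I2)
        fix s
        show "duhamel_inner p W (X n) (T n) s * indicator {0<..<T n} s
          \<le> ennreal (K0 * M powr p) * (ennreal ((1 + s) powr (- a)) * indicator {0<..} s)"
        proof (cases "s \<in> {0<..<T n}")
          case True
          \<comment> \<open>The decay in the final time is given up here, so that the dominating
            function does not depend on n.\<close>
          have "(1 + T n) powr (- q) \<le> (1 + T n) powr 0" using q nn by (intro powr_mono) (auto intro: less_imp_le)
          moreover have "(1 + T n) powr 0 = 1" using nn[rule_format, of n] by simp
          ultimately have le: "K0 * M powr p * (1 + s) powr (- a) * (1 + T n) powr (- q) \<le> K0 * M powr p * (1 + s) powr (- a) * 1"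
            using K0(1) by (intro mult_left_mono) auto
          have "duhamel_inner p W (X n) (T n) s \<le> ennreal (K0 * M powr p * (1 + T n) powr (- q) * (1 + s) powr (- a))"
            using True by (intro K0(2) W M) auto
          also have "\<dots> \<le> ennreal (K0 * M powr p * (1 + s) powr (- a))"
            using le by (intro ennreal_leI) (simp add: mult_ac)
          finally show ?thesis using True K0(1) by (simp add: ennreal_mult)
        qed simp
      qed
      have "(\<integral>\<^sup>+ s. ennreal (K0 * M powr p) * (ennreal ((1 + s) powr (- a)) * indicator {0<..} s) \<partial>lborel) = ennreal (K0 * M powr p) * ennreal (1 / (a - 1))"
        by (subst nn_integral_cmult) (auto simp: nn_integral_powr_tail[OF a])
      also have "\<dots> < \<infinity>" by (simp add: ennreal_mult_less_top)
      finally show "(\<integral>\<^sup>+ s. ennreal (K0 * M powr p) * (ennreal ((1 + s) powr (- a)) * indicator {0<..} s) \<partial>lborel) < \<infinity>" .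
      show "AE s in lborel. (\<lambda>n. duhamel_inner p W (X n) (T n) s * indicator {0<..<T n} s) \<longlonglongrightarrow> duhamel_inner p W x t s * indicator {0<..<t} s"
        using AE_lborel_singleton[of t]
      proof eventually_elim
        case (elim s)
        consider "s \<le> 0" | "0 < s" "s < t" | "t < s" using elim by linarith
        then show ?case
        proof cases
          case 2
          interpret half_space_data "lebesgue_on Omega" "\<lambda>y. W y s powr p" "M powr p * (1 + s) powr (- a)"
            using half_space_data_source[OF W p1 M, of s] 2 by (simp add: a_def q_def)
          have lim: "(\<lambda>n. duhamel_inner p W (X n) (T n) s) \<longlonglongrightarrow> duhamel_inner p W x t s"
            unfolding duhamel_inner_lin_int using 2 nn X T by (intro lin_int_tendsto tendsto_diff tendsto_const) auto
          have "eventually (\<lambda>n. s < T n) sequentially" using order_tendstoD(1)[OF T 2(2)] .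
          then have "eventually (\<lambda>n. duhamel_inner p W (X n) (T n) s = duhamel_inner p W (X n) (T n) s * indicator {0<..<T n} s) sequentially"
            by eventually_elim (use 2 in auto)
          from Lim_transform_eventually[OF lim this] show ?thesis using 2 by simp
        next
          case 3
          have "eventually (\<lambda>n. T n < s) sequentially" using order_tendstoD(2)[OF T 3] .
          then have "eventually (\<lambda>n. duhamel_inner p W (X n) (T n) s * indicator {0<..<T n} s = duhamel_inner p W x t s * indicator {0<..<t} s) sequentially"
            by eventually_elim (use 3 in auto)
          then show ?thesis by (rule tendsto_eventually)
        qed simp
      qed
    qed measurable
  qed
  show ?thesis using K * unfolding q_def by (intro exI[of _ K]) auto
qed

section \<open>Global existence for small data\<close>

text \<open>Half of the bound M is reserved for the linear part L, the other half for the Duhamel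
  term, which \<open>small\<close> makes fit. The right-hand side is increasing in W, so the
  iterates increase from 0 and converge without any Lipschitz estimate of the power.\<close>

lemma duhamel_fixpoint:
  fixes L :: "'n::{finite,linorder} pt \<Rightarrow> real \<Rightarrow> real"
  assumes p: "0 < p" and M: "0 \<le> M" and small: "K * M powr p \<le> M / 2"
    and bound: "\<And>(W :: 'n pt \<Rightarrow> real \<Rightarrow> real) x t. decaying M W \<Longrightarrow> 0 < t \<Longrightarrow> duhamel p W x t \<le> ennreal (K * M powr p * (1 + t) powr (- real CARD('n) / 2))"
    and boundL1: "\<And>(W :: 'n pt \<Rightarrow> real \<Rightarrow> real) t. decaying M W \<Longrightarrow> 0 < t \<Longrightarrow> (\<integral>\<^sup>+ x. duhamel p W x t * indicator Omega x \<partial>lborel) \<le> ennreal (K * M powr p)"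
    and L_meas: "(\<lambda>z. L (fst z) (snd z)) \<in> borel_measurable borel"
    and L: "\<And>x t. 0 < t \<Longrightarrow> 0 \<le> L x t" "\<And>x t. 0 < t \<Longrightarrow> L x t \<le> M / 2 * (1 + t) powr (- real CARD('n) / 2)"
    and L_L1: "\<And>t. 0 < t \<Longrightarrow> (\<integral>\<^sup>+ x. ennreal (L x t) * indicator Omega x \<partial>lborel) \<le> ennreal (M / 2)"
  shows "\<exists>V. decaying M V \<and> (\<forall>x t. 0 < t \<longrightarrow> ennreal (V x t) = ennreal (L x t) + duhamel p V x t)"
proof -
  define q where "q = real CARD('n) / 2"
  define step where "step W = (\<lambda>x t. enn2real (ennreal (L x t) + duhamel p W x t))" for W
  have L_meas' [measurable]: "(\<lambda>w. L (f w) (g w)) \<in> borel_measurable N"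
    if [measurable]: "f \<in> N \<rightarrow>\<^sub>M borel" "g \<in> N \<rightarrow>\<^sub>M borel" for f g and N :: "'x measure"
  proof -
    have "(\<lambda>w. (f w, g w)) \<in> N \<rightarrow>\<^sub>M borel" by measurable
    from measurable_compose[OF this L_meas] show ?thesis by simp
  qed
  have step_eq: "ennreal (step W x t) = ennreal (L x t) + duhamel p W x t"
    and step_le: "step W x t \<le> M * (1 + t) powr (- q)"
    if "decaying M W" "0 < t" for W x t
  proof -
    have "duhamel p W x t \<le> ennreal (K * M powr p * (1 + t) powr (- q))"
      using bound[OF that] by (simp add: q_def)
    also have "\<dots> \<le> ennreal (M / 2 * (1 + t) powr (- q))"
      using small by (intro ennreal_leI mult_right_mono) auto
    finally have d: "duhamel p W x t \<le> ennreal (M / 2 * (1 + t) powr (- q))" .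
    have "ennreal (L x t) + duhamel p W x t \<le> ennreal (M / 2 * (1 + t) powr (- q)) + ennreal (M / 2 * (1 + t) powr (- q))"
      using L(2)[OF that(2), of x] d by (intro add_mono ennreal_leI) (auto simp: q_def)
    also have "\<dots> = ennreal (M * (1 + t) powr (- q))"
      using M by (subst ennreal_plus[symmetric]) (auto simp: algebra_simps)
    finally have le: "ennreal (L x t) + duhamel p W x t \<le> ennreal (M * (1 + t) powr (- q))" .
    then have "ennreal (L x t) + duhamel p W x t < top" by (rule le_less_trans) simp
    then show eq: "ennreal (step W x t) = ennreal (L x t) + duhamel p W x t" by (simp add: step_def)
    have "0 \<le> M * (1 + t) powr (- q)" using M by simp
    then show "step W x t \<le> M * (1 + t) powr (- q)" using le unfolding eq[symmetric] by (simp add: ennreal_le_iff)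
  qed
  have step_dec: "decaying M (step W)" if W: "decaying M W" for W
    unfolding decaying_def
  proof (intro conjI allI impI)
    note [measurable] = duhamel_measurable[OF W]
    have [measurable]: "(\<lambda>z. duhamel p W (fst z) (snd z)) \<in> borel_measurable borel"
      by (rule duhamel_measurable[OF W]) (intro borel_measurable_continuous_onI continuous_intros)+
    show "(\<lambda>z. step W (fst z) (snd z)) \<in> borel_measurable borel" unfolding step_def using L_meas by measurable
    show "0 \<le> step W x t" for x t by (simp add: step_def)
    show "step W x t \<le> M * (1 + t) powr (- real CARD('n) / 2)" if "0 < t" for x t
      using step_le[OF W that, of x] by (simp add: q_def)
    show "(\<integral>\<^sup>+ x. ennreal (step W x t) * indicator Omega x \<partial>lborel) \<le> ennreal M" if t: "0 < t" for t
    proof -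
      have "(\<integral>\<^sup>+ x. ennreal (step W x t) * indicator Omega x \<partial>lborel) =
        (\<integral>\<^sup>+ x. ennreal (L x t) * indicator Omega x + duhamel p W x t * indicator Omega x \<partial>lborel)"
        using step_eq[OF W t] by (simp add: distrib_right)
      also have "\<dots> = (\<integral>\<^sup>+ x. ennreal (L x t) * indicator Omega x \<partial>lborel) + (\<integral>\<^sup>+ x. duhamel p W x t * indicator Omega x \<partial>lborel)"
        by (rule nn_integral_add) measurable
      also have "\<dots> \<le> ennreal (M / 2) + ennreal (M / 2)"
        using small by (intro add_mono L_L1[OF t] order_trans[OF boundL1[OF W t]] ennreal_leI) auto
      also have "\<dots> = ennreal M" using M by (subst ennreal_plus[symmetric]) auto
      finally show ?thesis .
    qed
  qed
  define V where "V k = (step ^^ k) (\<lambda>_ _. 0)" for k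
  have V_Suc: "V (Suc k) = step (V k)" for k by (simp add: V_def)
  have V_dec: "decaying M (V k)" for k
  proof (induction k)
    case 0
    show ?case using M by (simp add: V_def decaying_def)
  next
    case (Suc k)
    then show ?case by (simp add: V_Suc step_dec)
  qed
  have V_nn: "0 \<le> V k x t" and V_le: "V k x t \<le> M * (1 + t) powr (- q)" if "0 < t" for k x t
    using V_dec[of k] that by (auto simp: decaying_def q_def)
  have V_eq: "ennreal (V (Suc k) x t) = ennreal (L x t) + duhamel p (V k) x t" if "0 < t" for k x t
    using step_eq[OF V_dec that] by (simp add: V_Suc)
  have V_mono: "V k x t \<le> V (Suc k) x t" if "0 < t" for k x t
    using that
  proof (induction k arbitrary: x t)
    case 0
    then show ?case using V_nn[of t 1 x] by (simp add: V_def)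
  next
    case (Suc k)
    have "duhamel p (V k) x t \<le> duhamel p (V (Suc k)) x t"
      using Suc.IH V_nn p by (intro duhamel_mono) auto
    then have "ennreal (V (Suc k) x t) \<le> ennreal (V (Suc (Suc k)) x t)"
      by (simp only: V_eq[OF Suc.prems] add_left_mono)
    then show ?case using V_nn[OF Suc.prems] by (simp add: ennreal_le_iff)
  qed
  \<comment> \<open>Defined at all (x, t), where it is measurable as a pointwise \<open>lim\<close>;
    convergence is proved for positive t, the only times that enter the equation.\<close>
  define V' where "V' x t = lim (\<lambda>k. V k x t)" for x t
  have V_inc: "incseq (\<lambda>k. V k x t)" if "0 < t" for x t
    using V_mono[OF that] by (simp add: incseq_Suc_iff)
  have V_lim: "(\<lambda>k. V k x t) \<longlonglongrightarrow> V' x t" if t: "0 < t" for x t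
  proof -
    obtain l where "(\<lambda>k. V k x t) \<longlonglongrightarrow> l"
      using incseq_convergent[OF V_inc[OF t], of x "M * (1 + t) powr (- q)"] V_le[OF t] by metis
    then show ?thesis unfolding V'_def by (metis limI)
  qed
  note [measurable] = decaying_measurable[OF V_dec]
  have "decaying M V'"
    unfolding decaying_def
  proof (intro conjI allI impI)
    show "(\<lambda>z. V' (fst z) (snd z)) \<in> borel_measurable borel"
      unfolding V'_def by (rule borel_measurable_lim_metric) (use V_dec in \<open>simp add: decaying_def\<close>)
    show "0 \<le> V' x t" if "0 < t" for x t
      by (rule LIMSEQ_le_const[OF V_lim[OF that]]) (use V_nn[OF that] in auto)
    show "V' x t \<le> M * (1 + t) powr (- real CARD('n) / 2)" if "0 < t" for x t
      by (rule LIMSEQ_le_const2[OF V_lim[OF that]]) (use V_le[OF that] in \<open>auto simp: q_def\<close>)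
    show "(\<integral>\<^sup>+ x. ennreal (V' x t) * indicator Omega x \<partial>lborel) \<le> ennreal M" if t: "0 < t" for t
    proof (rule LIMSEQ_le_const2)
      show "(\<lambda>k. \<integral>\<^sup>+ x. ennreal (V k x t) * indicator Omega x \<partial>lborel) \<longlonglongrightarrow> (\<integral>\<^sup>+ x. ennreal (V' x t) * indicator Omega x \<partial>lborel)"
      proof (rule nn_integral_LIMSEQ)
        show "incseq (\<lambda>k x. ennreal (V k x t) * indicator Omega x)"
          using V_inc[OF t] by (auto simp: incseq_def le_fun_def intro!: mult_right_mono ennreal_leI)
        show "(\<lambda>k. ennreal (V k x t) * indicator Omega x) \<longlonglongrightarrow> ennreal (V' x t) * indicator Omega x" for x
          using V_lim[OF t, of x] by (cases "x \<in> Omega") (auto intro: tendsto_ennrealI)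
      qed measurable
      show "\<exists>N. \<forall>k\<ge>N. (\<integral>\<^sup>+ x. ennreal (V k x t) * indicator Omega x \<partial>lborel) \<le> ennreal M"
        using V_dec t by (auto simp: decaying_def)
    qed
  qed
  moreover have "ennreal (V' x t) = ennreal (L x t) + duhamel p V' x t" if t: "0 < t" for x t
  proof (rule LIMSEQ_unique)
    show "(\<lambda>k. ennreal (V (Suc k) x t)) \<longlonglongrightarrow> ennreal (V' x t)"
      by (intro tendsto_ennrealI LIMSEQ_Suc V_lim[OF t])
    have "(\<lambda>k. duhamel p (V k) x t) \<longlonglongrightarrow> duhamel p V' x t"
      using V_dec V_mono V_lim p by (rule duhamel_LIMSEQ)
    then show "(\<lambda>k. ennreal (V (Suc k) x t)) \<longlonglongrightarrow> ennreal (L x t) + duhamel p V' x t"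
      unfolding V_eq[OF t] by (intro tendsto_add tendsto_const)
  qed
  ultimately show ?thesis by blast
qed

text \<open>The way back from nonnegative integrals to the Bochner integrals of the definition:
  finiteness of \<open>duhamel\<close> supplies integrability, and nonnegativity lets the two values
  be identified.\<close>

lemma duhamel_G_op:
  fixes u :: "'n::{finite,linorder} pt \<Rightarrow> real \<Rightarrow> real"
  assumes u: "decaying M u" and p: "1 < p" and M: "0 \<le> M" and x: "0 \<le> x $ last_idx" and t: "0 < t"
    and fin: "duhamel p u x t < \<infinity>"
  shows "\<And>s. 0 < s \<Longrightarrow> s < t \<Longrightarrow> G_op_defined (t - s) (\<lambda>y. u y s powr p, \<lambda>_. 0) x"
    and "set_integrable lborel {0<..<t} (\<lambda>s. G_op (t - s) (\<lambda>y. u y s powr p, \<lambda>_. 0) x)"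
    and "0 \<le> (LINT s:{0<..<t}|lborel. G_op (t - s) (\<lambda>y. u y s powr p, \<lambda>_. 0) x)"
    and "ennreal (LINT s:{0<..<t}|lborel. G_op (t - s) (\<lambda>y. u y s powr p, \<lambda>_. 0) x) = duhamel p u x t"
proof -
  define g where "g s = G_op (t - s) (\<lambda>y. u y s powr p, \<lambda>_. 0) x" for s
  note data = half_space_data_source[OF u p M]
  show "G_op_defined (t - s) (\<lambda>y. u y s powr p, \<lambda>_. 0) x" if "0 < s" "s < t" for s
    using half_space_data.G_kernel_integral(1)[OF data[OF that(1)] x, of "t - s"] that
    by (simp add: G_op_defined_def)
  have g: "0 \<le> g s" "ennreal (g s) = duhamel_inner p u x t s" if "0 < s" "s < t" for s
    using half_space_data.G_kernel_integral(2,3)[OF data[OF that(1)] x, of "t - s"] that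
    by (simp_all add: g_def G_op_def duhamel_inner_lin_int)
  have ind: "ennreal (indicator {0<..<t} s *\<^sub>R g s) = duhamel_inner p u x t s * indicator {0<..<t} s" for s
    using g[of s] by (auto simp: indicator_def)
  \<comment> \<open>Measurability in s is obtained from the nonnegative integral, to which Tonelli
    applies, and carried over to \<open>G_op\<close> by equality of the values.\<close>
  have "(\<lambda>s. enn2real (duhamel_inner p u x t s * indicator {0<..<t} s)) \<in> borel_measurable lborel"
    using duhamel_inner_measurable[OF u, of "\<lambda>_. x" lborel "\<lambda>_. t" "\<lambda>s. s" p] by measurable
  also have "(\<lambda>s. enn2real (duhamel_inner p u x t s * indicator {0<..<t} s)) = (\<lambda>s. indicator {0<..<t} s *\<^sub>R g s)"
  proof
    fix s
    have "0 \<le> indicator {0<..<t} s *\<^sub>R g s" using g(1)[of s] by (auto simp: indicator_def)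
    then show "enn2real (duhamel_inner p u x t s * indicator {0<..<t} s) = indicator {0<..<t} s *\<^sub>R g s"
      unfolding ind[symmetric] by (rule enn2real_ennreal)
  qed
  finally have meas: "(\<lambda>s. indicator {0<..<t} s *\<^sub>R g s) \<in> borel_measurable lborel" .
  have nn_eq: "(\<integral>\<^sup>+ s. ennreal (indicator {0<..<t} s *\<^sub>R g s) \<partial>lborel) = duhamel p u x t"
    unfolding duhamel_def ind ..
  have nn: "0 \<le> indicator {0<..<t} s *\<^sub>R g s" for s using g(1)[of s] by (auto simp: indicator_def)
  have int: "integrable lborel (\<lambda>s. indicator {0<..<t} s *\<^sub>R g s)"
    using meas nn fin nn_eq by (intro integrableI_nonneg) auto
  then show "set_integrable lborel {0<..<t} (\<lambda>s. G_op (t - s) (\<lambda>y. u y s powr p, \<lambda>_. 0) x)"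
    by (simp add: set_integrable_def g_def)
  show "0 \<le> (LINT s:{0<..<t}|lborel. G_op (t - s) (\<lambda>y. u y s powr p, \<lambda>_. 0) x)"
    unfolding set_lebesgue_integral_def g_def[symmetric] using nn by (intro Bochner_Integration.integral_nonneg)
  show "ennreal (LINT s:{0<..<t}|lborel. G_op (t - s) (\<lambda>y. u y s powr p, \<lambda>_. 0) x) = duhamel p u x t"
    unfolding set_lebesgue_integral_def g_def[symmetric] nn_eq[symmetric]
    using int nn by (intro nn_integral_eq_integral[symmetric]) auto
qed

section \<open>Choice of constants and assembly of the solution\<close>

lemma AE_le_of_Linf_norm:
  assumes "Linf_norm M f \<le> ennreal \<delta>" "0 \<le> \<delta>"
  shows "AE x in M. f x \<le> \<delta>"
  using esssup_AE[of "\<lambda>x. ennreal \<bar>f x\<bar>" M]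
proof eventually_elim
  case (elim x)
  then have "ennreal \<bar>f x\<bar> \<le> ennreal \<delta>" using assms(1) by (simp add: Linf_norm_def)
  then have "\<bar>f x\<bar> \<le> \<delta>" using assms(2) by (simp add: ennreal_le_iff)
  then show ?case by simp
qed

lemma summand_le_of_add_le:
  fixes a b c d e :: ennreal
  assumes "(a + b) + (c + d) \<le> e"
  shows "a \<le> e" "b \<le> e" "c \<le> e" "d \<le> e"
  by (rule order_trans[OF _ assms],
      simp add: add_increasing add_increasing2)+

lemma small_data_global_solution:
  assumes p: "p > 1 + 2 / real CARD('n::{finite,linorder})"
  shows "\<exists>\<delta>>0. \<forall>\<phi> :: 'n data. initial_data \<phi> \<and> L1_pair_norm \<phi> + Linf_pair_norm \<phi> \<le> ennreal \<delta> \<longrightarrow>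
           (\<exists>u. global_solution p \<phi> u \<and> (\<not> trivial_data \<phi> \<longrightarrow> global_positive_solution p \<phi> u))"
proof -
  have p1: "1 < p" using p by (smt (verit) divide_nonneg_nonneg of_nat_0_le_iff)
  obtain K where K: "K > 0" and K_bounds: "\<forall>(W :: 'n pt \<Rightarrow> real \<Rightarrow> real) M. decaying M W \<longrightarrow> 0 \<le> M \<longrightarrow>
     (\<forall>x. \<forall>t>0. duhamel p W x t \<le> ennreal (K * M powr p * (1 + t) powr (- real CARD('n) / 2))) \<and>
     (\<forall>t>0. (\<integral>\<^sup>+ x. duhamel p W x t * indicator Omega x \<partial>lborel) \<le> ennreal (K * M powr p)) \<and>
     (\<forall>X T x t. X \<longlonglongrightarrow> x \<longrightarrow> T \<longlonglongrightarrow> t \<longrightarrow> 0 < t \<longrightarrow> (\<forall>n. 0 \<le> X n $ last_idx \<and> 0 < T n) \<longrightarrow>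
        (\<lambda>n. duhamel p W (X n) (T n)) \<longlonglongrightarrow> duhamel p W x t)"
    using duhamel_bounds[OF p] by (elim exE conjE) (rule that)
  have bound: "duhamel p W x t \<le> ennreal (K * M powr p * (1 + t) powr (- real CARD('n) / 2))"
    if "decaying M W" "0 \<le> M" "0 < t" for W :: "'n pt \<Rightarrow> real \<Rightarrow> real" and M x t
    using K_bounds[rule_format, OF that(1,2)] that(3) by simp
  have boundL1: "(\<integral>\<^sup>+ x. duhamel p W x t * indicator Omega x \<partial>lborel) \<le> ennreal (K * M powr p)"
    if "decaying M W" "0 \<le> M" "0 < t" for W :: "'n pt \<Rightarrow> real \<Rightarrow> real" and M t
    using K_bounds[rule_format, OF that(1,2)] that(3) by simp
  have cont: "(\<lambda>n. duhamel p W (X n) (T n)) \<longlonglongrightarrow> duhamel p W x t"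
    if "decaying M W" "0 \<le> M" "X \<longlonglongrightarrow> x" "T \<longlonglongrightarrow> t" "0 < t" "\<And>n. 0 \<le> X n $ last_idx \<and> 0 < T n"
    for W :: "'n pt \<Rightarrow> real \<Rightarrow> real" and M X T x t
    using K_bounds[rule_format, OF that(1,2)] that(3-6) by simp
  obtain C where C: "C > 0" "\<And>(M :: 'n pt measure) f l m x t. half_space_data M f l \<Longrightarrow> (AE y in M. f y \<le> m) \<Longrightarrow> 0 \<le> m \<Longrightarrow> 0 < t \<Longrightarrow>
     lin_int M f x t \<le> ennreal (C * (1 + t) powr (- real CARD('n) / 2) * (m + l))"
    using lin_int_decay[where 'n='n] by blast
  \<comment> \<open>The solution of \<open>K * M powr p = M / 2\<close>, so the Duhamel term uses
    exactly its half of the bound.\<close>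
  define M where "M = (1 / (2 * K)) powr (1 / (p - 1))"
  have M: "0 < M" using K by (simp add: M_def)
  have small: "K * M powr p \<le> M / 2"
  proof -
    have "M powr (p - 1) = 1 / (2 * K)" using p1 K by (simp add: M_def powr_powr)
    moreover have "M powr p = M powr (p - 1) * M" using M by (simp add: powr_diff)
    ultimately have "K * M powr p = K * (1 / (2 * K)) * M" by (simp only: mult.assoc)
    then show ?thesis using K by simp
  qed
  \<comment> \<open>Each of the two data has sup bound and L1 bound \<open>\<delta>\<close>, so the
    linear part is at most \<open>4 * C * \<delta>\<close> times the decay factor, and its L1 norm
    is at most \<open>5 * \<delta>\<close> twice. Both must stay below \<open>M / 2\<close>.\<close>
  define D where "D = max (4 * C) 10"
  define \<delta> where "\<delta> = M / (2 * D)"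
  have D: "D > 0" by (simp add: D_def less_max_iff_disj)
  have \<delta>: "0 < \<delta>" using M D by (simp add: \<delta>_def)
  have D\<delta>: "D * \<delta> = M / 2" using D by (simp add: \<delta>_def)
  have "4 * C * \<delta> \<le> D * \<delta>" "10 * \<delta> \<le> D * \<delta>" using \<delta> by (intro mult_right_mono; simp add: D_def)+
  then have \<delta>_le: "4 * C * \<delta> \<le> M / 2" "10 * \<delta> \<le> M / 2" unfolding D\<delta> by auto
  have "\<exists>u. global_solution p \<phi> u \<and> (\<not> trivial_data \<phi> \<longrightarrow> global_positive_solution p \<phi> u)"
    if \<phi>: "initial_data \<phi>" and norm: "L1_pair_norm \<phi> + Linf_pair_norm \<phi> \<le> ennreal \<delta>" for \<phi> :: "'n data"
  proof -
    have norms: "L1_norm (lebesgue_on Omega) (fst \<phi>) \<le> ennreal \<delta>" "L1_norm surface_measure (snd \<phi>) \<le> ennreal \<delta>"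
      "Linf_norm (lebesgue_on Omega) (fst \<phi>) \<le> ennreal \<delta>" "Linf_norm surface_measure (snd \<phi>) \<le> ennreal \<delta>"
      using norm summand_le_of_add_le unfolding L1_pair_norm_def Linf_pair_norm_def by blast+
    interpret i: half_space_data "lebesgue_on Omega" "fst \<phi>" \<delta>
    proof (rule half_space_data_Omega)
      have "(\<integral>\<^sup>+ y. ennreal (fst \<phi> y) \<partial>lebesgue_on Omega) = L1_norm (lebesgue_on Omega) (fst \<phi>)"
        unfolding L1_norm_def using \<phi> by (intro nn_integral_cong) (auto simp: initial_data_def)
      then show "(\<integral>\<^sup>+ y. ennreal (fst \<phi> y) \<partial>lebesgue_on Omega) \<le> ennreal \<delta>" using norms by simp
    qed (use \<phi> \<delta> in \<open>auto simp: initial_data_def\<close>)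
    interpret b: half_space_data surface_measure "snd \<phi>" \<delta>
    proof (rule half_space_data_surface)
      have "(\<integral>\<^sup>+ y. ennreal (snd \<phi> y) \<partial>surface_measure) = L1_norm surface_measure (snd \<phi>)"
        unfolding L1_norm_def using \<phi> by (intro nn_integral_cong) (auto simp: initial_data_def space_surface_measure)
      then show "(\<integral>\<^sup>+ y. ennreal (snd \<phi> y) \<partial>surface_measure) \<le> ennreal \<delta>" using norms by simp
    qed (use \<phi> \<delta> in \<open>auto simp: initial_data_def\<close>)
    define \<Lambda> where "\<Lambda> x t = lin_int (lebesgue_on Omega) (fst \<phi>) x t + lin_int surface_measure (snd \<phi>) x t" for x t
    define L where "L x t = enn2real (\<Lambda> x t)" for x t
    have L_eq: "ennreal (L x t) = \<Lambda> x t" if "0 < t" for x t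
      using i.lin_int_finite[OF that, of x] b.lin_int_finite[OF that, of x] by (simp add: L_def \<Lambda>_def)
    obtain u where u: "decaying M u" and eq: "\<And>x t. 0 < t \<Longrightarrow> ennreal (u x t) = ennreal (L x t) + duhamel p u x t"
    proof (atomize_elim, rule duhamel_fixpoint[OF _ _ small])
      show "(\<lambda>z. L (fst z) (snd z)) \<in> borel_measurable borel"
      proof -
        have fs: "fst \<in> borel_measurable (borel :: ('n pt \<times> real) measure)" "snd \<in> borel_measurable (borel :: ('n pt \<times> real) measure)"
          by (intro borel_measurable_continuous_onI continuous_intros)+
        note [measurable] = i.lin_int_measurable[OF fs] b.lin_int_measurable[OF fs]
        show ?thesis unfolding L_def \<Lambda>_def by measurable
      qed
      show "0 \<le> L x t" for x t by (simp add: L_def)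
      show "L x t \<le> M / 2 * (1 + t) powr (- real CARD('n) / 2)" if t: "0 < t" for x t
      proof -
        have "ennreal (L x t) \<le> ennreal (C * (1 + t) powr (- real CARD('n) / 2) * (\<delta> + \<delta>)) + ennreal (C * (1 + t) powr (- real CARD('n) / 2) * (\<delta> + \<delta>))"
          unfolding L_eq[OF t] \<Lambda>_def using \<delta> t norms
          by (intro add_mono C(2) AE_le_of_Linf_norm i.half_space_data_axioms b.half_space_data_axioms) auto
        also have "\<dots> = ennreal (4 * C * \<delta> * (1 + t) powr (- real CARD('n) / 2))"
          using C(1) \<delta> by (subst ennreal_plus[symmetric]) (auto simp: algebra_simps)
        finally have "L x t \<le> 4 * C * \<delta> * (1 + t) powr (- real CARD('n) / 2)"
          using C(1) \<delta> by (subst (asm) ennreal_le_iff) auto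
        also have "\<dots> \<le> M / 2 * (1 + t) powr (- real CARD('n) / 2)"
          by (intro mult_right_mono \<delta>_le) auto
        finally show ?thesis .
      qed
      show "(\<integral>\<^sup>+ x. ennreal (L x t) * indicator Omega x \<partial>lborel) \<le> ennreal (M / 2)" if t: "0 < t" for t
      proof -
        have "(\<integral>\<^sup>+ x. ennreal (L x t) * indicator Omega x \<partial>lborel) =
          (\<integral>\<^sup>+ x. lin_int (lebesgue_on Omega) (fst \<phi>) x t * indicator Omega x + lin_int surface_measure (snd \<phi>) x t * indicator Omega x \<partial>lborel)"
          unfolding L_eq[OF t] \<Lambda>_def by (simp add: distrib_right)
        also have "\<dots> = (\<integral>\<^sup>+ x. lin_int (lebesgue_on Omega) (fst \<phi>) x t * indicator Omega x \<partial>lborel) +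
           (\<integral>\<^sup>+ x. lin_int surface_measure (snd \<phi>) x t * indicator Omega x \<partial>lborel)"
          by (rule nn_integral_add) measurable
        also have "\<dots> \<le> ennreal (5 * \<delta>) + ennreal (5 * \<delta>)"
          by (intro add_mono i.lin_int_L1 b.lin_int_L1)
        also have "\<dots> = ennreal (10 * \<delta>)" using \<delta> by (subst ennreal_plus[symmetric]) auto
        also have "\<dots> \<le> ennreal (M / 2)" by (intro ennreal_leI \<delta>_le)
        finally show ?thesis .
      qed
    qed (use p1 M bound boundL1 in auto)
    have u_nn: "0 \<le> u x t" and u_le: "u x t \<le> M" if "0 < t" for x t
    proof -
      show "0 \<le> u x t" using u that by (simp add: decaying_def)
      have "u x t \<le> M * (1 + t) powr (- real CARD('n) / 2)" using u that by (simp add: decaying_def)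
      also have "\<dots> \<le> M * (1 + t) powr 0" using M that by (intro mult_left_mono powr_mono) auto
      finally show "u x t \<le> M" using that by simp
    qed
    have fin: "duhamel p u x t < \<infinity>" if "0 < t" for x t
      using bound[OF u _ that, of x] M by (auto intro: le_less_trans)
    have sol: "global_solution p \<phi> u"
      unfolding global_solution_def SH_solution_def
    proof (intro conjI ballI allI impI)
      show "continuous_on (closure Omega \<times> {t. 0 < t \<and> ereal t < \<infinity>}) (\<lambda>(x, t). u x t)"
        unfolding continuous_on_sequentially
      proof safe
        fix Z :: "nat \<Rightarrow> 'n pt \<times> real" and x t
        assume Z: "\<forall>n. Z n \<in> closure Omega \<times> {t. 0 < t \<and> ereal t < \<infinity>}" "Z \<longlonglongrightarrow> (x, t)"
          and "x \<in> closure Omega" and t: "0 < t"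
        define X where "X n = fst (Z n)" for n
        define T where "T n = snd (Z n)" for n
        have XT: "X \<longlonglongrightarrow> x" "T \<longlonglongrightarrow> t" using tendsto_fst[OF Z(2)] tendsto_snd[OF Z(2)] by (simp_all add: X_def[abs_def] T_def[abs_def])
        have dom: "0 \<le> X n $ last_idx" "0 < T n" for n
          using Z(1)[rule_format, of n] by (auto simp: X_def T_def closure_Omega mem_Times_iff)
        \<comment> \<open>The fixed point is known only to be measurable. Its continuity is read off
          from the right-hand side of its own equation, where both terms are sequentially
          continuous.\<close>
        have "(\<lambda>n. \<Lambda> (X n) (T n) + duhamel p u (X n) (T n)) \<longlonglongrightarrow> \<Lambda> x t + duhamel p u x t"
          unfolding \<Lambda>_def using XT t dom M
          by (intro tendsto_add i.lin_int_tendsto b.lin_int_tendsto cont[OF u]) auto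
        then have "(\<lambda>n. ennreal (u (X n) (T n))) \<longlonglongrightarrow> ennreal (u x t)"
          using eq L_eq dom t by simp
        then have "(\<lambda>n. u (X n) (T n)) \<longlonglongrightarrow> u x t"
          using u_nn dom t by (subst (asm) tendsto_ennreal_iff) auto
        then show "((\<lambda>(x, t). u x t) \<circ> Z) \<longlonglongrightarrow> u x t"
          by (simp add: o_def split_beta X_def T_def)
      qed
      show "0 \<le> u x t" if "0 < t \<and> ereal t < \<infinity>" for x t using u_nn that by simp
      show "Linf_loc \<infinity> u"
        unfolding Linf_loc_def
      proof (intro allI impI exI[of _ M])
        fix a b :: real assume "0 < a"
        show "AE t in lebesgue_on {a..b}. AE x in lebesgue_on Omega. \<bar>u x t\<bar> \<le> M"
          using \<open>0 < a\<close> u_nn u_le by (auto intro!: AE_I2)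
      qed
    next
      fix x :: "'n pt" and t :: real assume "x \<in> closure Omega" "0 < t \<and> ereal t < \<infinity>"
      then have x: "0 \<le> x $ last_idx" and t: "0 < t" by (auto simp: closure_Omega)
      note D = duhamel_G_op[OF u p1 less_imp_le[OF M] x t fin[OF t]]
      note I = i.G_kernel_integral[OF x t] and B = b.G_kernel_integral[OF x t]
      show "G_op_defined t \<phi> x" using I(1) B(1) by (simp add: G_op_defined_def)
      show "G_op_defined (t - s) (\<lambda>y. u y s powr p, \<lambda>_. 0) x" if "s \<in> {0<..<t}" for s
        using that by (intro D(1)) auto
      show "set_integrable lborel {0<..<t} (\<lambda>s. G_op (t - s) (\<lambda>y. u y s powr p, \<lambda>_. 0) x)" by (rule D(2))
      have G: "0 \<le> G_op t \<phi> x" "ennreal (G_op t \<phi> x) = \<Lambda> x t"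
        using I(2,3) B(2,3) by (simp_all add: G_op_def \<Lambda>_def)
      have "ennreal (u x t) = ennreal (G_op t \<phi> x + (LINT s:{0<..<t}|lborel. G_op (t - s) (\<lambda>y. u y s powr p, \<lambda>_. 0) x))"
        using eq[OF t, of x] G D(3,4) L_eq[OF t, of x] by (simp add: ennreal_plus)
      then show "u x t = G_op t \<phi> x + (LINT s:{0<..<t}|lborel. G_op (t - s) (\<lambda>y. u y s powr p, \<lambda>_. 0) x)"
        using G(1) D(3) u_nn[OF t] by (subst (asm) ennreal_inj) auto
    qed
    \<comment> \<open>For trivial data the iteration never leaves 0, so positivity has to come from
      the data: the kernel is strictly positive up to the boundary, hence so is the linear part at
      every positive time, and the Duhamel term only adds to it.\<close>
    moreover have "0 < u x t" if nontriv: "\<not> trivial_data \<phi>" and x: "x \<in> closure Omega" and t: "0 < t" for x t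
    proof -
      have x: "0 \<le> x $ last_idx" using x by (simp add: closure_Omega)
      have "0 < lin_int (lebesgue_on Omega) (fst \<phi>) x t \<or> 0 < lin_int surface_measure (snd \<phi>) x t"
        using nontriv i.lin_int_pos[OF x t] b.lin_int_pos[OF x t] unfolding trivial_data_def by blast
      then have "0 < \<Lambda> x t" by (auto simp: \<Lambda>_def intro: add_pos_nonneg add_nonneg_pos)
      then have "0 < ennreal (u x t)" using eq[OF t, of x] L_eq[OF t, of x] by (auto intro: add_pos_nonneg)
      then show ?thesis by simp
    qed
    ultimately show ?thesis by (auto simp: global_positive_solution_def)
  qed
  then show ?thesis using \<delta> by blast
qed

theorem theorem3p1:
  fixes p p_F :: real
  assumes "p > 1"
    and "p_F = 1 + 2 / real CARD('n::{finite,linorder})"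
  shows
    "(p \<le> p_F \<longrightarrow>
        (\<forall>\<phi> :: 'n data. initial_data \<phi> \<longrightarrow> \<not> (\<exists>u. global_positive_solution p \<phi> u))) \<and>
     (p > p_F \<longrightarrow>
        (\<exists>\<delta>>0. \<forall>\<phi> :: 'n data.
           initial_data \<phi> \<and> L1_pair_norm \<phi> + Linf_pair_norm \<phi> \<le> ennreal \<delta> \<longrightarrow>
           (\<exists>u. global_solution p \<phi> u \<and>
                (\<not> trivial_data \<phi> \<longrightarrow> global_positive_solution p \<phi> u))))"
  using assms no_global_positive_solution[of p, where 'n='n] small_data_global_solution[of p, where 'n='n] by blast

end
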